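(* Consider the system $$\dot{x}_1(t)=f_1(t,d(t),T_{r_1}(t)x_1,u(t),v_1(t)),\qquad Y_1(t)=H_1(t,T_{r_1}(t)x_1),\qquad (S1)$$ with $x_1(t)\in\mathbb{R}^{n_1}$, $Y_1(t)\in S_1$, $(u(t),v_1(t))\in U\times S_2$, $d(t)\in D$, $t\ge0$, under the standing hypotheses on $f_1,H_1$ given in the context. Suppose that there exist a functional $V:\mathbb{R}^+\times C^0([-r_1,0];\mathbb{R}^{n_1})\to\mathbb{R}^+$ which is almost Lipschitz on bounded sets, functions $a_2\in K_\infty$, $\zeta,\zeta^u\in N$, $\beta,\delta_1,\delta_1^u\in K^+$ and a continuous positive definite function $\rho:\mathbb{R}^+\to\mathbb{R}^+$ such that $$V(t,x_1)\le a_2(\beta(t)\|x_1\|_{r_1}),\quad\forall(t,x_1)\in\mathbb{R}^+\times C^0([-r_1,0];\mathbb{R}^{n_1}),$$ $$V^0(t,x_1;f_1(t,d,x_1,u,v_1))\le-\rho(V(t,x_1))$$ for all $(t,x_1,u,v_1,d)\in\mathbb{R}^+\times C^0([-r_1,0];\mathbb{R}^{n_1})\times U\times S_2\times D$ with $\max\{\zeta(\delta_1(t)|v_1|),\zeta^u(\delta_1^u(t)|u|)\}\le V(t,x_1)$. Moreover, suppose that there exist functions $a_1,p\in K_\infty$, $\mu\in K^+$ and a constant $R\ge0$ such that one of the following inequalities holds: $$\text{(A)}\quad a_1(|H_1(t,x_1)|)\le V(t,x_1),\quad\forall(t,x_1)\in\mathbb{R}^+\times C^0([-r_1,0];\mathbb{R}^{n_1}),$$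 $$\text{or (B)}\quad p(\mu(t)|x_1(0)|)\le V(t,x_1)+R,\quad\forall(t,x_1)\in\mathbb{R}^+\times C^0([-r_1,0];\mathbb{R}^{n_1}).$$ Then: (i) If (A) holds and there exist functions $\mu_1,c_1,\phi\in K^+$, $g_1,p_1,p_1^u\in N$ such that for every $(t_0,x_{10},(v_1,u,d))\in\mathbb{R}^+\times C^0([-r_1,0];\mathbb{R}^{n_1})\times L^\infty_{loc}(\mathbb{R}^+;S_2\times U\times D)$ the solution $x_1(t)$ of (S1) with initial condition $T_{r_1}(t_0)x_1=x_{10}$ corresponding to inputs $(v_1,u,d)$ exists for all $t\ge t_0$ and satisfies $$\phi(t)\|T_{r_1}(t)x_1\|_{r_1}\le\max\Big\{\mu_1(t-t_0),c_1(t_0),g_1(\|x_{10}\|_{r_1}),\sup_{t_0\le s\le t}p_1(|v_1(s)|),\sup_{t_0\le s\le t}p_1^u(\delta_1^u(s)|u(s)|)\Big\},\qquad(E)$$ then there exists $\sigma_1\in KL$ such that, with $\beta_1(t)\equiv\beta(t)$, $\gamma_1(s):=a_1^{-1}(\zeta(s))$, $\gamma_1^u(s):=a_1^{-1}(\zeta^u(s))$, the estimate $$|H_1(t,T_{r_1}(t)x_1)|\le\sigma_1(\beta_1(t_0)\|x_{10}\|_{r_1},t-t_0)+\sup_{t_0\le s\le t}\gamma_1(\delta_1(s)|v_1(s)|)+\sup_{t_0\le s\le t}\gamma_1^u(\delta_1^u(s)|u(s)|)$$ holds for all $(t_0,x_{10},(v_1,u,d))\in\mathbb{R}^+\times C^0([-r_1,0];\mathbb{R}^{n_1})\times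 L^\infty_{loc}(\mathbb{R}^+;S_2\times U\times D)$ and $t\ge t_0$ for the solution $x_1(t)$ of (S1) with $T_{r_1}(t_0)x_1=x_{10}$ corresponding to inputs $(v_1,u,d)$. (ii) If (B) holds and $\delta_1(t)\equiv1$ then for every $(t_0,x_{10},(v_1,u,d))\in\mathbb{R}^+\times C^0([-r_1,0];\mathbb{R}^{n_1})\times L^\infty_{loc}(\mathbb{R}^+;S_2\times U\times D)$ the solution $x_1(t)$ of (S1) with $T_{r_1}(t_0)x_1=x_{10}$ corresponding to inputs $(v_1,u,d)$ exists for all $t\ge t_0$. Furthermore, for every $\phi\in K^+$ there exist functions $\mu_1,c_1\in K^+$, $g_1,p_1,p_1^u\in N$ such that (E) holds for all such data and all $t\ge t_0$. Moreover, if $\phi\in K^+$ is bounded and there exists a constant $L>0$ such that $$\beta(t)+\frac{1}{\mu(t)}\le L,\quad\forall t\ge0,$$ then the function $c_1\in K^+$ can be taken bounded.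
   Context: Notation. $\mathbb{R}^+=[0,+\infty)$; $|x|$ is the Euclidean norm, $x'$ the transpose. $L^\infty_{loc}(I;\Omega)$ is the set of measurable and locally bounded functions $I\to\Omega$, as genuine functions with pointwise suprema (no identification a.e.); $C^0(I;\Omega)$ is the set of continuous functions. $\|x\|_r:=\sup_{\theta\in[-r,0]}|x(\theta)|$. $T_r(t)x$ is the function $\theta\mapsto x(t+\theta)$, $\theta\in[-r,0]$. $K^+$: positive continuous functions on $\mathbb{R}^+$. $\rho:\mathbb{R}^+\to\mathbb{R}^+$ is positive definite if $\rho(0)=0$ and $\rho(s)>0$ for $s>0$. $N$: non-decreasing $\rho:\mathbb{R}^+\to\mathbb{R}^+$ with $\rho(0)=0$. $K$: continuous, increasing, positive definite functions. $K_\infty$: $\rho\in K$ with $\lim_{s\to+\infty}\rho(s)=+\infty$. $KL$: continuous $\sigma:\mathbb{R}^+\times\mathbb{R}^+\to\mathbb{R}^+$ with $\sigma(\cdot,t)\in K$ for each $t\ge0$ and $\sigma(s,\cdot)$ non-increasing with $\lim_{t\to+\infty}\sigma(s,t)=0$ for each $s\ge0$. Standing hypotheses. $r_1\ge0$; $D\subseteq\mathbb{R}^l$ non-empty; $U\subseteq\mathbb{R}^m$, $S_1\subseteq\mathbb{R}^{k_1}$, $S_2\subseteq\mathbb{R}^{k_2}$ each containing $0$; $f_1:\mathbb{R}^+\times D\times C^0([-r_1,0];\mathbb{R}^{n_1})\times U\times S_2\to\mathbb{R}^{n_1}$ is locally bounded, and: - $H_1:\mathbb{R}^+\times C^0([-r_1,0];\mathbb{R}^{n_1})\to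 S_1$ is continuous, maps bounded sets into bounded sets, and $H_1(t,0)=0$ for all $t\ge0$. - There exist $\tilde\beta\in K^+$, $\tilde a\in K_\infty$ such that $|f_1(t,d,x,u,v)|\le\tilde a(\tilde\beta(t)\|x\|_{r_1})+\tilde a(\tilde\beta(t)|u|)+\tilde a(\tilde\beta(t)|v|)$ for all $(t,x,u,v,d)\in\mathbb{R}^+\times C^0([-r_1,0];\mathbb{R}^{n_1})\times U\times S_2\times D$. - The mapping $(x,u,v,d)\mapsto f_1(t,d,x,u,v)$ is continuous for each fixed $t\ge0$, and for every bounded $I\subseteq\mathbb{R}^+$ and bounded $\Omega\subset C^0([-r_1,0];\mathbb{R}^{n_1})\times U\times S_2$ there exists $L\ge0$ such that $(x(0)-y(0))'(f_1(t,d,x,u,v)-f_1(t,d,y,u,v))\le L\max_{s\in[-r_1,0]}|x(s)-y(s)|^2$ for all $t\in I$, $(x,u,v)\in\Omega$, $(y,u,v)\in\Omega$, $d\in D$. - There exists a countable set $A\subset\mathbb{R}^+$, either finite or $A=\{t_k;k=1,2,\dots\}$ with $t_{k+1}>t_k>0$ and $\lim t_k=+\infty$, such that $(t,x,u,v,d)\mapsto f_1(t,d,x,u,v)$ is continuous on $(\mathbb{R}^+\setminus A)\times C^0([-r_1,0];\mathbb{R}^{n_1})\times U\times S_2\times D$; moreover, for each fixed $(t_0,x,u,v,d)\in\mathbb{R}^+\times C^0([-r_1,0];\mathbb{R}^{n_1})\times U\times S_2\times D$, $\lim_{t\to t_0^+}f_1(t,d,x,u,v)=f_1(t_0,d,x,u,v)$.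 Solutions. For measurable, locally bounded inputs, the solution of (S1) is the unique maximal continuous function with $T_{r_1}(t_0)x_1=x_{10}$, absolutely continuous from $t_0$ on, satisfying the differential equation a.e. Generalized derivative. For $V:\mathbb{R}^+\times C^0([-r,0];\mathbb{R}^n)\to\mathbb{R}$ and $v\in\mathbb{R}^n$, $$V^0(t,x;v):=\limsup_{h\to0^+,\ y\to0,\ y\in C^0([-r,0];\mathbb{R}^n)}\frac{V(t+h,E_h(x;v)+hy)-V(t,x)}{h},$$ where, for $0\le h<r$, $E_h(x;v)$ is the function equal to $x(0)+(\theta+h)v$ for $-h<\theta\le0$ and to $x(\theta+h)$ for $-r\le\theta\le-h$. Almost Lipschitz on bounded sets. A continuous functional $V:\mathbb{R}^+\times C^0([-r,0];\mathbb{R}^n)\to\mathbb{R}^+$ is almost Lipschitz on bounded sets if there exist non-decreasing functions $M:\mathbb{R}^+\to\mathbb{R}^+$, $P:\mathbb{R}^+\to\mathbb{R}^+$, $G:\mathbb{R}^+\to[1,+\infty)$ such that for all $R\ge0$: (1) for all $x,y\in C^0([-r,0];\mathbb{R}^n)$ with $\|x\|_r\le R$, $\|y\|_r\le R$ and all $t\in[0,R]$, $|V(t,y)-V(t,x)|\le M(R)\|y-x\|_r$; (2) for every absolutely continuous $x:[-r,0]\to\mathbb{R}^n$ with $\|x\|_r\le R$ and essentially bounded derivative, $|V(t+h,x)-V(t,x)|\le hP(R)\big(1+\sup_{-r\le s\le0}|\dot{x}(s)|\big)$ for all $t\in[0,R]$ and $0\le h\le 1/G\big(R+\sup_{-r\le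 s\le0}|\dot{x}(s)|\big)$ (suprema of $|\dot x|$ being essential suprema). *)

theory Defs
  imports "HOL-Probability.Essential_Supremum"
begin

subsection \<open>Comparison functions\<close>

text \<open>All functions on $[0,\infty)$ are total functions on \<^typ>\<open>real\<close> of which only the values on
  \<^term>\<open>{0::real..}\<close> matter.\<close>

definition class_Kplus :: "(real \<Rightarrow> real) set" where
  "class_Kplus = {g. continuous_on {0..} g \<and> (\<forall>t\<ge>0. 0 < g t)}"

definition pos_def_fun :: "(real \<Rightarrow> real) \<Rightarrow> bool" where
  "pos_def_fun \<rho> \<longleftrightarrow> \<rho> 0 = 0 \<and> (\<forall>s>0. 0 < \<rho> s)"

definition class_N :: "(real \<Rightarrow> real) set" where
  "class_N = {\<rho>. mono_on {0..} \<rho> \<and> (\<forall>s\<ge>0. 0 \<le> \<rho> s) \<and> \<rho> 0 = 0}"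

definition class_K :: "(real \<Rightarrow> real) set" where
  "class_K = {\<rho>. continuous_on {0..} \<rho> \<and> strict_mono_on {0..} \<rho> \<and> pos_def_fun \<rho>}"

definition class_Kinf :: "(real \<Rightarrow> real) set" where
  "class_Kinf = {\<rho> \<in> class_K. filterlim \<rho> at_top at_top}"

definition class_KL :: "(real \<Rightarrow> real \<Rightarrow> real) set" where
  "class_KL = {\<sigma>. continuous_on ({0..} \<times> {0..}) (\<lambda>(s, t). \<sigma> s t) \<and>
     (\<forall>t\<ge>0. (\<lambda>s. \<sigma> s t) \<in> class_K) \<and>
     (\<forall>s\<ge>0. antimono_on {0..} (\<sigma> s) \<and> (\<sigma> s \<longlongrightarrow> 0) at_top)}"

subsection \<open>The space of continuous histories\<close>

text \<open>\<open>C0 r\<close> is $C^0([-r,0];\mathbb{R}^n)$ with the uniform metric; its points are extensional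
  functions, i.e. they take the value \<^const>\<open>undefined\<close> outside \<open>{-r..0}\<close>.\<close>

abbreviation C0 :: "real \<Rightarrow> (real \<Rightarrow> real ^ 'n) metric" where
  "C0 r \<equiv> cfunspace (top_of_set {-r..0}) euclidean_metric"

abbreviation C0_top :: "real \<Rightarrow> (real \<Rightarrow> real ^ 'n) topology" where
  "C0_top r \<equiv> mtopology_of (C0 r)"

abbreviation C0_zero :: "real \<Rightarrow> real \<Rightarrow> real ^ 'n" where
  "C0_zero r \<equiv> restrict (\<lambda>_. 0) {-r..0}"

abbreviation mbounded_of :: "'a metric \<Rightarrow> 'a set \<Rightarrow> bool" where
  "mbounded_of m S \<equiv> Metric_space.mbounded (mspace m) (mdist m) S"

definition hnorm :: "real \<Rightarrow> (real \<Rightarrow> real ^ 'n) \<Rightarrow> real" where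
  "hnorm r x = (SUP \<theta>\<in>{-r..0}. norm (x \<theta>))"

definition Tr :: "real \<Rightarrow> real \<Rightarrow> (real \<Rightarrow> real ^ 'n) \<Rightarrow> real \<Rightarrow> real ^ 'n" where
  "Tr r t x = restrict (\<lambda>\<theta>. x (t + \<theta>)) {-r..0}"

text \<open>Measurability is Lebesgue measurability. Bounds are pointwise, on every compact subset of
  the interval.\<close>

definition Linf_loc :: "real set \<Rightarrow> 'a::euclidean_space set \<Rightarrow> (real \<Rightarrow> 'a) set" where
  "Linf_loc I \<Omega> = {w. w \<in> borel_measurable (lebesgue_on I) \<and> w ` I \<subseteq> \<Omega> \<and>
     (\<forall>K. compact K \<and> K \<subseteq> I \<longrightarrow> bounded (w ` K))}"

text \<open>The usual epsilon-delta definition on an interval \<open>S\<close>; the finite families of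
  non-overlapping compact subintervals are the divisions of their own unions.\<close>

definition abs_cont_on :: "real set \<Rightarrow> (real \<Rightarrow> 'a::real_normed_vector) \<Rightarrow> bool" where
  "abs_cont_on S f \<longleftrightarrow> (\<forall>\<epsilon>>0. \<exists>\<eta>>0. \<forall>\<D>. \<D> division_of \<Union>\<D> \<and> \<Union>\<D> \<subseteq> S \<and> (\<Sum>K\<in>\<D>. measure lborel K) < \<eta>
     \<longrightarrow> (\<Sum>K\<in>\<D>. norm (f (Sup K) - f (Inf K))) < \<epsilon>)"

text \<open>For \<open>r = 0\<close> the interval is a null set and the essential supremum is \<open>-\<infinity>\<close>, which
  \<^const>\<open>real_of_ereal\<close> maps to \<open>0\<close>, the intended value.\<close>

definition deriv_esssup :: "real \<Rightarrow> (real \<Rightarrow> real ^ 'n) \<Rightarrow> ereal" where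
  "deriv_esssup r x =
     esssup (lebesgue_on {-r..0}) (\<lambda>s. ereal (norm (vector_derivative x (at s within {-r..0}))))"

subsection \<open>Functionals\<close>

text \<open>The formula is only of interest for \<open>0 \<le> h < r\<close> when \<open>r > 0\<close>. For \<open>r = 0\<close> it gives
  \<open>x 0 + h *\<^sub>R w\<close> at the only point \<open>\<theta> = 0\<close>, so that \<open>V0\<close> below is then the usual
  upper directional derivative.\<close>

definition Eh :: "real \<Rightarrow> (real \<Rightarrow> real ^ 'n) \<Rightarrow> real ^ 'n \<Rightarrow> real \<Rightarrow> real ^ 'n" where
  "Eh h x w \<theta> = (if - h < \<theta> then x 0 + (\<theta> + h) *\<^sub>R w else x (\<theta> + h))"

definition V0 :: "real \<Rightarrow> (real \<Rightarrow> (real \<Rightarrow> real ^ 'n) \<Rightarrow> real)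
    \<Rightarrow> real \<Rightarrow> (real \<Rightarrow> real ^ 'n) \<Rightarrow> real ^ 'n \<Rightarrow> ereal" where
  "V0 r V t x w =
     Limsup (at_right 0 \<times>\<^sub>F nhdsin (C0_top r) (C0_zero r))
       (\<lambda>(h, y). ereal ((V (t + h) (restrict (\<lambda>\<theta>. Eh h x w \<theta> + h *\<^sub>R y \<theta>) {-r..0}) - V t x) / h))"

definition almost_Lipschitz :: "real \<Rightarrow> (real \<Rightarrow> (real \<Rightarrow> real ^ 'n) \<Rightarrow> real) \<Rightarrow> bool" where
  "almost_Lipschitz r V \<longleftrightarrow>
     (\<forall>t\<ge>0. \<forall>x\<in>mspace (C0 r). 0 \<le> V t x) \<and>
     continuous_map (prod_topology (top_of_set {0..}) (C0_top r)) euclidean (\<lambda>(t, x). V t x) \<and>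
     (\<exists>M P G. mono_on {0..} M \<and> mono_on {0..} P \<and> mono_on {0..} G \<and>
        (\<forall>R\<ge>0. 0 \<le> M R \<and> 0 \<le> P R \<and> 1 \<le> G R) \<and>
        (\<forall>R\<ge>0.
          (\<forall>x\<in>mspace (C0 r). \<forall>y\<in>mspace (C0 r). \<forall>t\<in>{0..R}. hnorm r x \<le> R \<and> hnorm r y \<le> R \<longrightarrow>
             \<bar>V t y - V t x\<bar> \<le> M R * hnorm r (\<lambda>\<theta>. y \<theta> - x \<theta>)) \<and>
          (\<forall>x\<in>mspace (C0 r). abs_cont_on {-r..0} x \<and> deriv_esssup r x < \<infinity> \<and> hnorm r x \<le> R \<longrightarrow>
             (\<forall>t\<in>{0..R}. \<forall>h. 0 \<le> h \<and> h \<le> 1 / G (R + real_of_ereal (deriv_esssup r x)) \<longrightarrow>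
                \<bar>V (t + h) x - V t x\<bar> \<le> h * P R * (1 + real_of_ereal (deriv_esssup r x))))))"

subsection \<open>The system\<close>

locale delay_system =
  fixes r :: real
    and D :: "(real ^ 'l) set" and U :: "(real ^ 'm) set"
    and S1 :: "(real ^ 'k1) set" and S2 :: "(real ^ 'k2) set"
    and f :: "real \<Rightarrow> real ^ 'l \<Rightarrow> (real \<Rightarrow> real ^ 'n) \<Rightarrow> real ^ 'm \<Rightarrow> real ^ 'k2 \<Rightarrow> real ^ 'n"
    and H :: "real \<Rightarrow> (real \<Rightarrow> real ^ 'n) \<Rightarrow> real ^ 'k1"
  assumes r_nonneg: "0 \<le> r"
    and D_nonempty: "D \<noteq> {}"
    and zero_mem: "0 \<in> U" "0 \<in> S1" "0 \<in> S2"
    and f_locally_bounded: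
      "\<forall>z \<in> {0..} \<times> D \<times> mspace (C0 r) \<times> U \<times> S2. \<exists>W.
         openin (prod_topology (top_of_set {0..}) (prod_topology (top_of_set D)
                  (prod_topology (C0_top r) (top_of_set (U \<times> S2))))) W \<and>
         z \<in> W \<and> bounded ((\<lambda>(t, d, x, u, v). f t d x u v) ` W)"
    and H_continuous:
      "continuous_map (prod_topology (top_of_set {0..}) (C0_top r)) (top_of_set S1)
         (\<lambda>(t, x). H t x)"
    and H_bounded:
      "\<forall>B. mbounded_of (prod_metric (submetric euclidean_metric {0..}) (C0 r)) B
         \<longrightarrow> bounded ((\<lambda>(t, x). H t x) ` B)"
    and H_zero: "\<forall>t\<ge>0. H t (C0_zero r) = 0"
    and f_growth:
      "\<exists>\<beta>\<in>class_Kplus. \<exists>a\<in>class_Kinf.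
         \<forall>t\<ge>0. \<forall>x\<in>mspace (C0 r). \<forall>u\<in>U. \<forall>v\<in>S2. \<forall>d\<in>D.
           norm (f t d x u v) \<le> a (\<beta> t * hnorm r x) + a (\<beta> t * norm u) + a (\<beta> t * norm v)"
    and f_continuous:
      "\<forall>t\<ge>0. continuous_map (prod_topology (C0_top r) (top_of_set (U \<times> S2 \<times> D))) euclidean
         (\<lambda>(x, u, v, d). f t d x u v)"
    and f_one_sided_Lipschitz:
      "\<forall>I \<Omega>. I \<subseteq> {0..} \<and> bounded I \<and>
         mbounded_of (prod_metric (C0 r) (submetric euclidean_metric (U \<times> S2))) \<Omega> \<longrightarrow>
         (\<exists>L\<ge>0. \<forall>t\<in>I. \<forall>x y u v. \<forall>d\<in>D. (x, u, v) \<in> \<Omega> \<and> (y, u, v) \<in> \<Omega> \<longrightarrow>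
            (x 0 - y 0) \<bullet> (f t d x u v - f t d y u v) \<le> L * (SUP s\<in>{-r..0}. (norm (x s - y s))\<^sup>2))"
    and f_time_regular:
      "\<exists>A\<subseteq>{0..}. (finite A \<or>
           (\<exists>\<tau> :: nat \<Rightarrow> real. A = range \<tau> \<and> strict_mono \<tau> \<and> (\<forall>k. 0 < \<tau> k) \<and>
              filterlim \<tau> at_top sequentially)) \<and>
         continuous_map (prod_topology (top_of_set ({0..} - A))
             (prod_topology (C0_top r) (top_of_set (U \<times> S2 \<times> D)))) euclidean
           (\<lambda>(t, x, u, v, d). f t d x u v)"
    and f_right_continuous:
      "\<forall>t0\<ge>0. \<forall>x\<in>mspace (C0 r). \<forall>u\<in>U. \<forall>v\<in>S2. \<forall>d\<in>D.
         ((\<lambda>t. f t d x u v) \<longlongrightarrow> f t0 d x u v) (at_right t0)"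

definition admissible_data :: "real \<Rightarrow> (real ^ 'l) set \<Rightarrow> (real ^ 'm) set \<Rightarrow> (real ^ 'k2) set
    \<Rightarrow> real \<Rightarrow> (real \<Rightarrow> real ^ 'n) \<Rightarrow> (real \<Rightarrow> real ^ 'k2) \<Rightarrow> (real \<Rightarrow> real ^ 'm) \<Rightarrow> (real \<Rightarrow> real ^ 'l) \<Rightarrow> bool" where
  "admissible_data r D U S2 t0 x0 v u d \<longleftrightarrow>
     0 \<le> t0 \<and> x0 \<in> mspace (C0 r) \<and> (\<lambda>t. (v t, u t, d t)) \<in> Linf_loc {0..} (S2 \<times> U \<times> D)"

text \<open>\<open>x\<close> is a solution on \<open>[t0 - r, T)\<close>, where \<open>T\<close> may be infinite; its values elsewhere are
  irrelevant.\<close>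

definition is_solution :: "real
    \<Rightarrow> (real \<Rightarrow> real ^ 'l \<Rightarrow> (real \<Rightarrow> real ^ 'n) \<Rightarrow> real ^ 'm \<Rightarrow> real ^ 'k2 \<Rightarrow> real ^ 'n)
    \<Rightarrow> real \<Rightarrow> (real \<Rightarrow> real ^ 'n) \<Rightarrow> (real \<Rightarrow> real ^ 'k2) \<Rightarrow> (real \<Rightarrow> real ^ 'm) \<Rightarrow> (real \<Rightarrow> real ^ 'l)
    \<Rightarrow> ereal \<Rightarrow> (real \<Rightarrow> real ^ 'n) \<Rightarrow> bool" where
  "is_solution r f t0 x0 v u d T x \<longleftrightarrow>
     ereal t0 < T \<and>
     continuous_on {t. t0 - r \<le> t \<and> ereal t < T} x \<and>
     Tr r t0 x = x0 \<and>
     (\<forall>b\<ge>t0. ereal b < T \<longrightarrow> abs_cont_on {t0..b} x) \<and>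
     (AE t in lebesgue. t0 < t \<and> ereal t < T \<longrightarrow>
        (x has_vector_derivative f t (d t) (Tr r t x) (u t) (v t)) (at t))"

text \<open>\<open>x\<close> on \<open>[t0 - r, T)\<close> is the unique maximal solution: every solution is a restriction of it.
  With \<open>T = \<infinity>\<close> this says that the solution exists for all \<open>t \<ge> t0\<close>.\<close>

definition maximal_solution :: "real
    \<Rightarrow> (real \<Rightarrow> real ^ 'l \<Rightarrow> (real \<Rightarrow> real ^ 'n) \<Rightarrow> real ^ 'm \<Rightarrow> real ^ 'k2 \<Rightarrow> real ^ 'n)
    \<Rightarrow> real \<Rightarrow> (real \<Rightarrow> real ^ 'n) \<Rightarrow> (real \<Rightarrow> real ^ 'k2) \<Rightarrow> (real \<Rightarrow> real ^ 'm) \<Rightarrow> (real \<Rightarrow> real ^ 'l)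
    \<Rightarrow> ereal \<Rightarrow> (real \<Rightarrow> real ^ 'n) \<Rightarrow> bool" where
  "maximal_solution r f t0 x0 v u d T x \<longleftrightarrow>
     is_solution r f t0 x0 v u d T x \<and>
     (\<forall>T' y. is_solution r f t0 x0 v u d T' y \<longrightarrow>
        T' \<le> T \<and> (\<forall>t. t0 - r \<le> t \<and> ereal t < T' \<longrightarrow> y t = x t))"

definition growth_estimate :: "real \<Rightarrow> (real \<Rightarrow> real) \<Rightarrow> (real \<Rightarrow> real) \<Rightarrow> (real \<Rightarrow> real) \<Rightarrow> (real \<Rightarrow> real)
    \<Rightarrow> (real \<Rightarrow> real) \<Rightarrow> (real \<Rightarrow> real) \<Rightarrow> (real \<Rightarrow> real) \<Rightarrow> real \<Rightarrow> (real \<Rightarrow> real ^ 'n)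
    \<Rightarrow> (real \<Rightarrow> real ^ 'k2) \<Rightarrow> (real \<Rightarrow> real ^ 'm) \<Rightarrow> (real \<Rightarrow> real ^ 'n) \<Rightarrow> bool" where
  "growth_estimate r \<phi> \<mu>1 c1 g1 p1 p1u \<delta>1u t0 x0 v u x \<longleftrightarrow>
     (\<forall>t\<ge>t0. \<phi> t * hnorm r (Tr r t x) \<le>
        Max {\<mu>1 (t - t0), c1 t0, g1 (hnorm r x0),
             SUP s\<in>{t0..t}. p1 (norm (v s)),
             SUP s\<in>{t0..t}. p1u (\<delta>1u s * norm (u s))})"

end

theory Submission
  imports Defs
begin

text \<open>Along a solution \<open>x\<close> the function \<open>W t = V t (T t x)\<close> is only known to be continuous when the initial
  history is merely continuous. Still, at \<^emph>\<open>every\<close> time at which \<open>W\<close> dominates the input gains, its upper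
  right Dini derivative is bounded by a constant: \<open>x\<close> is Lipschitz after \<open>t0\<close>, so \<open>T (t + h) x\<close> differs
  from \<open>Eh h (T t x) w\<close> by \<open>O(h)\<close>, and \<open>V\<close> is Lipschitz in the history. At almost every time the bound
  improves to \<open>- \<rho> (W t)\<close>. A continuous function with these two properties obeys the scalar comparison
  principle, which gives \<open>W t \<le> max q (\<sigma> (W t0) (t - t0))\<close> with \<open>\<sigma>\<close> of class KL and \<open>q\<close> the supremum of the
  gains; no approximation of the initial data is needed. For part (ii) this is the a priori bound that
  turns local into global existence. Local solutions are limits of solutions of the equation with an
  additional delay \<open>h \<rightarrow> 0\<close>; the one-sided Lipschitz condition makes them uniformly Cauchy.\<close>

subsection \<open>Lebesgue differentiation of indefinite integrals\<close>

text \<open>A slope bound at almost every time alone controls nothing for a merely continuous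
  function: the Cantor function has derivative 0 almost everywhere. The cruder bound at every time
  closes the gap, because the null set of bad times is covered by an open set of arbitrarily small
  measure and the surplus slope is paid only there. The same device bounds the squared distance of
  two solutions. Decay becomes a KL bound by a change of variable: the travel time of w' =
  -min(\<rho>(w), w), written in ln w, is an increasing bijection of the real line, so its inverse
  is defined for all times; the minimum with w keeps the flow from reaching 0 in finite time. In
  part (ii) the obstacle is that (E) asks for a maximum of functions of separate variables, whereas
  the natural bound is a product of a function of t and a function of the data. Factors are
  separated by squaring, and a monotone function of t is split through t <= 2 t0 or t <= 2 (t -
  t0).\<close>

lemma bounded_measurable_integrable_on:
  fixes g :: "real \<Rightarrow> 'a::euclidean_space"
  assumes g: "g \<in> borel_measurable (lebesgue_on T)" and bd: "\<And>t. t \<in> T \<Longrightarrow> norm (g t) \<le> M"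
    and S: "S \<in> lmeasurable" "S \<subseteq> T" and T: "T \<in> sets lebesgue"
  shows "g integrable_on S"
proof -
  have "g \<in> borel_measurable (lebesgue_on S)"
    using borel_measurable_subalgebra measurable_restrict_mono[OF g S(2)] by blast
  moreover have "(\<lambda>x. M) integrable_on S"
    using S(1) integrable_on_const by blast
  ultimately show ?thesis
    using measurable_bounded_by_integrable_imp_integrable[of g S "\<lambda>x. M"] S bd
    by (auto simp: fmeasurableD)
qed

text \<open>Vitali argument behind Lebesgue differentiation. Short intervals on which the mean of
  \<open>g\<close> exceeds \<open>q\<close> are chosen inside an open set of which all but a part of
  measure at most \<open>e'\<close> satisfies \<open>g < p\<close>. On a finite disjoint union U of
  them, q |U| <= integral of g <= p |U| + K e', which forces |U| to be small. The intervals need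
  only contain \<open>t\<close>, not start there, so two-sided derivatives come out.\<close>

lemma negligible_upper_interval_slope:
  fixes g :: "real \<Rightarrow> real"
  assumes g: "g \<in> borel_measurable lebesgue" and M: "\<And>t. \<bar>g t\<bar> \<le> M" and pq: "p < q"
  shows "negligible {t \<in> {a<..<b}. g t < p \<and>
     (\<forall>d>0. \<exists>s1 s2. s1 \<le> t \<and> t \<le> s2 \<and> s1 < s2 \<and> s2 - s1 < d \<and> q * (s2 - s1) < integral {s1..s2} g)}"
    (is "negligible ?E")
  unfolding negligible_outer_le
proof (intro allI impI)
  fix e :: real assume e: "e > 0"
  have M0: "0 \<le> M" using M[of 0] by linarith
  \<comment> \<open>\<open>K\<close> bounds \<open>g - p\<close> everywhere; \<open>e'\<close> is
    scaled so that (q - p) |U| <= K e' reads |U| <= e.\<close>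
  define K where "K = M + \<bar>p\<bar> + 1"
  have K: "K > 0" using M0 by (simp add: K_def)
  define e' where "e' = e * (q - p) / K"
  have e': "e' > 0" using e pq K by (simp add: e'_def)
  define G where "G = {t \<in> {a<..<b}. g t < p}"
  have "G = {a<..<b} \<inter> (g -` {..<p} \<inter> space lebesgue)" by (auto simp: G_def)
  moreover have "g -` {..<p} \<inter> space lebesgue \<in> sets lebesgue"
    using g by (rule measurable_sets) auto
  ultimately have Gs: "G \<in> sets lebesgue" by auto
  obtain W where W: "open W" "G \<subseteq> W" "W - G \<in> lmeasurable" "emeasure lebesgue (W - G) < ennreal e'"
    using sets_lebesgue_outer_open[OF Gs e'] by blast
  have WG: "measure lebesgue (W - G) \<le> e'"
    using W(3,4) e' by (simp add: emeasure_eq_measure2 ennreal_less_iff)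
  define O' where "O' = W \<inter> {a<..<b}"
  have oO: "open O'" using W by (auto simp: O'_def)
  have int: "g integrable_on S" if "S \<in> lmeasurable" for S
    by (rule bounded_measurable_integrable_on[where T=UNIV and M=M]) (use g M that in auto)
  define I where "I = {(c, r). r > 0 \<and> cball c r \<subseteq> O' \<and> q * (2*r) < integral (cball c r) g}"
  obtain C where C: "countable C" "C \<subseteq> I"
    "pairwise (\<lambda>i j. disjnt (cball (fst i) (snd i)) (cball (fst j) (snd j))) C"
    "negligible (?E - (\<Union>i \<in> C. cball (fst i) (snd i)))"
  proof (rule Vitali_covering_theorem_cballs[of I snd ?E fst])
    show "0 < snd i" if "i \<in> I" for i using that by (auto simp: I_def)
    fix x d :: real assume x: "x \<in> ?E" and d: "d > 0"
    have "x \<in> O'" using x W by (auto simp: O'_def G_def)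
    then obtain d2 where d2: "d2 > 0" "ball x d2 \<subseteq> O'" using oO openE by blast
    have small: "\<exists>s1 s2. s1 \<le> x \<and> x \<le> s2 \<and> s1 < s2 \<and> s2 - s1 < d' \<and> q * (s2 - s1) < integral {s1..s2} g"
      if "d' > 0" for d' using x that by blast
    have "min d d2 > 0" using d d2(1) by simp
    from small[OF this] obtain s1 s2 where s: "s1 \<le> x" "x \<le> s2" "s1 < s2" "s2 - s1 < min d d2"
      "q * (s2 - s1) < integral {s1..s2} g" by blast
    have cb: "cball ((s1+s2)/2) ((s2-s1)/2) = {s1..s2}"
      by (auto simp: cball_eq_atLeastAtMost field_simps)
    have "{s1..s2} \<subseteq> ball x d2" using s by (auto simp: dist_real_def)
    moreover have "q * (2 * ((s2-s1)/2)) < integral {s1..s2} g" using s(5) by (simp only: field_simps)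
    ultimately have "((s1+s2)/2, (s2-s1)/2) \<in> I" using s d2 cb by (auto simp: I_def simp del: mult_less_cancel_right_disj)
    moreover have "x \<in> cball ((s1+s2)/2) ((s2-s1)/2)" using s cb by auto
    ultimately show "\<exists>i. i \<in> I \<and> x \<in> cball (fst i) (snd i) \<and> snd i < d"
      using s d by (intro exI[of _ "((s1+s2)/2, (s2-s1)/2)"]) auto
  qed auto
  define B where "B i = cball (fst i) (snd i)" for i :: "real \<times> real"
  have Bm: "B i \<in> lmeasurable" for i by (auto simp: B_def)
  have fin: "measure lebesgue (\<Union>i\<in>C0. B i) \<le> e" if C0: "C0 \<subseteq> C" "finite C0" for C0
  proof -
    let ?U = "\<Union>i\<in>C0. B i"
    have Um: "?U \<in> lmeasurable" using C0 by (auto simp: B_def)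
    have pw: "pairwise (\<lambda>i j. negligible (B i \<inter> B j)) C0"
      using pairwise_subset[OF C(3) C0(1)] by (auto simp: pairwise_def disjnt_def B_def)
    have dj: "disjoint_family_on B C0"
      using pairwise_subset[OF C(3) C0(1)] by (auto simp: pairwise_def disjnt_def B_def disjoint_family_on_def)
    have "(g has_integral (\<Sum>i\<in>C0. integral (B i) g)) ?U"
      by (rule has_integral_UN[OF C0(2) _ pw]) (auto simp: B_def intro!: integrable_integral int)
    then have s1: "integral ?U g = (\<Sum>i\<in>C0. integral (B i) g)" by blast
    have m1: "measure lebesgue ?U = (\<Sum>i\<in>C0. measure lebesgue (B i))"
      by (rule measure_finite_Union[OF C0(2) _ dj]) (use fmeasurableD[OF Bm] fmeasurableD2[OF Bm] in auto)
    have m2: "measure lebesgue (B i) = 2 * snd i" if "i \<in> C0" for i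
    proof -
      have "snd i > 0" using that C0 C(2) by (auto simp: I_def)
      then show ?thesis by (simp add: B_def cball_eq_atLeastAtMost)
    qed
    have "q * measure lebesgue ?U = (\<Sum>i\<in>C0. q * (2 * snd i))"
      using m1 m2 by (simp add: sum_distrib_left)
    also have "\<dots> \<le> (\<Sum>i\<in>C0. integral (B i) g)"
      by (rule sum_mono) (use C0 C(2) in \<open>force simp: I_def B_def\<close>)
    finally have lo: "q * measure lebesgue ?U \<le> integral ?U g" using s1 by simp
    have UO: "?U \<subseteq> O'" using C0 C(2) by (force simp: I_def B_def)
    let ?D = "?U \<inter> (W - G)"
    have Dm: "?D \<in> lmeasurable" using Um W(3) by blast
    have ii: "(indicator ?D has_integral measure lebesgue ?D) ?U"
    proof -
      have "(\<lambda>x. if x \<in> ?U then indicator ?D x else 0) = (indicator ?D :: real \<Rightarrow> real)"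
        by (auto simp: indicator_def)
      then show ?thesis
        using Dm has_integral_restrict_UNIV[of ?U "indicator ?D :: real \<Rightarrow> real"]
        by (simp add: lmeasurable_iff_has_integral)
    qed
    have pc: "((\<lambda>x. p) has_integral p * measure lebesgue ?U) ?U"
    proof -
      have "(\<lambda>x. if x \<in> ?U then p else 0) = (\<lambda>x. p * indicator ?U x)"
        by (auto simp: indicator_def)
      then show ?thesis
        using has_integral_mult_right[OF lmeasurable_iff_has_integral[THEN iffD1, OF Um], of p]
          has_integral_restrict_UNIV[of ?U "\<lambda>x. p" "p * measure lebesgue ?U"]
        by metis
    qed
    have "integral ?U g \<le> p * measure lebesgue ?U + K * measure lebesgue ?D"
    proof (rule has_integral_le)
      show "(g has_integral integral ?U g) ?U" using int[OF Um] by blast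
      show "((\<lambda>x. p + K * indicator ?D x) has_integral p * measure lebesgue ?U + K * measure lebesgue ?D) ?U"
        by (intro has_integral_add pc has_integral_mult_right ii)
      fix x assume x: "x \<in> ?U"
      show "g x \<le> p + K * indicator ?D x"
      proof (cases "x \<in> G")
        case True then show ?thesis by (auto simp: G_def)
      next
        case False
        then have "x \<in> ?D" using x UO by (auto simp: O'_def)
        then show ?thesis using M[of x] by (auto simp: K_def)
      qed
    qed
    also have "measure lebesgue ?D \<le> e'"
      by (rule order_trans[OF _ WG]) (rule measure_mono_fmeasurable, use Dm W in auto)
    finally have "(q - p) * measure lebesgue ?U \<le> K * e'"
      using lo K by (simp add: algebra_simps)
    also have "K * e' = (q - p) * e" using K by (simp add: e'_def)
    finally show ?thesis using pq by simp
  qed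
  have T: "(\<Union>i\<in>C. B i) \<in> lmeasurable" "measure lebesgue (\<Union>i\<in>C. B i) \<le> e"
    using fmeasurable_UN_bound[OF C(1) Bm fin] measure_UN_bound[OF C(1) Bm fin] by auto
  let ?N = "?E - (\<Union>i\<in>C. B i)"
  have N: "negligible ?N" using C(4) by (simp add: B_def)
  show "\<exists>T. ?E \<subseteq> T \<and> T \<in> lmeasurable \<and> measure lebesgue T \<le> e"
  proof (intro exI conjI)
    show "?E \<subseteq> (\<Union>i\<in>C. B i) \<union> ?N" by blast
    show "(\<Union>i\<in>C. B i) \<union> ?N \<in> lmeasurable"
      using T N negligible_imp_measurable by blast
    show "measure lebesgue ((\<Union>i\<in>C. B i) \<union> ?N) \<le> e"
      using T(2) measure_Un_null_set[OF fmeasurableD[OF T(1)] N[unfolded negligible_iff_null_sets]]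
      by (simp only:)
  qed
qed


text \<open>For e > 0 there are rationals p < q strictly between \<open>g t\<close> and
  \<open>g t + e\<close>, so countably many null sets of the preceding kind catch every exceptional
  point.\<close>

lemma AE_upper_interval_slope:
  fixes g :: "real \<Rightarrow> real"
  assumes g: "g \<in> borel_measurable lebesgue" and M: "\<And>t. \<bar>g t\<bar> \<le> M"
  obtains N where "negligible N"
    "\<And>t e. \<lbrakk>t \<in> {a<..<b} - N; e > 0\<rbrakk> \<Longrightarrow> \<exists>d>0. \<forall>s1 s2. s1 \<le> t \<and> t \<le> s2 \<and> s1 < s2 \<and> s2 - s1 < d
        \<longrightarrow> integral {s1..s2} g \<le> (g t + e) * (s2 - s1)"
proof -
  define E where "E p q = {t \<in> {a<..<b}. g t < p \<and>
     (\<forall>d>0. \<exists>s1 s2. s1 \<le> t \<and> t \<le> s2 \<and> s1 < s2 \<and> s2 - s1 < d \<and> q * (s2 - s1) < integral {s1..s2} g)}" for p q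
  define N where "N = (\<Union>(p,q)\<in>{(p,q) \<in> \<rat> \<times> \<rat>. p < q}. E p q)"
  have "countable {(p::real,q) \<in> \<rat> \<times> \<rat>. p < q}"
    by (rule countable_subset[of _ "\<rat> \<times> \<rat>"]) (auto simp: countable_rat)
  then have "negligible N"
    unfolding N_def
    by (intro negligible_countable_Union countable_image)
       (auto simp only: E_def intro!: negligible_upper_interval_slope[OF g M])
  moreover have "\<exists>d>0. \<forall>s1 s2. s1 \<le> t \<and> t \<le> s2 \<and> s1 < s2 \<and> s2 - s1 < d
        \<longrightarrow> integral {s1..s2} g \<le> (g t + e) * (s2 - s1)" if t: "t \<in> {a<..<b} - N" and e: "e > 0" for t e
  proof -
    obtain p where p: "p \<in> \<rat>" "g t < p" "p < g t + e"
      using Rats_dense_in_real[of "g t" "g t + e"] e by auto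
    obtain q where q: "q \<in> \<rat>" "p < q" "q < g t + e"
      using Rats_dense_in_real[of p "g t + e"] p by auto
    have "t \<notin> E p q" using t p q unfolding N_def by blast
    then obtain d where d: "d > 0" "\<And>s1 s2. s1 \<le> t \<Longrightarrow> t \<le> s2 \<Longrightarrow> s1 < s2 \<Longrightarrow> s2 - s1 < d \<Longrightarrow> integral {s1..s2} g \<le> q * (s2 - s1)"
      using t p unfolding E_def by fastforce
    have "integral {s1..s2} g \<le> (g t + e) * (s2 - s1)" if "s1 \<le> t" "t \<le> s2" "s1 < s2" "s2 - s1 < d" for s1 s2
    proof -
      have "q * (s2 - s1) \<le> (g t + e) * (s2 - s1)"
        using q that by (intro mult_right_mono) auto
      then show ?thesis using d(2)[OF that] by linarith
    qed
    then show ?thesis using d(1) by blast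
  qed
  ultimately show ?thesis using that by blast
qed

text \<open>Applied to \<open>g\<close> and to its negative, the upper estimate pins the means of
  \<open>g\<close> over short intervals around \<open>t\<close> to \<open>g t\<close> from both
  sides.\<close>

lemma AE_indefinite_integral_has_real_derivative:
  fixes g :: "real \<Rightarrow> real"
  assumes g: "g \<in> borel_measurable lebesgue" and M: "\<And>t. \<bar>g t\<bar> \<le> M"
  obtains N where "negligible N"
    "\<And>t. t \<in> {a<..<b} - N \<Longrightarrow> ((\<lambda>s. integral {a..s} g) has_real_derivative g t) (at t)"
proof -
  have int: "g integrable_on {s1..s2}" for s1 s2
    by (rule bounded_measurable_integrable_on[where T=UNIV and M=M]) (use g M in auto)
  have g': "(\<lambda>t. - g t) \<in> borel_measurable lebesgue" using g by measurable
  obtain N1 where N1: "negligible N1"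
    "\<And>t e. \<lbrakk>t \<in> {a<..<b} - N1; e > 0\<rbrakk> \<Longrightarrow> \<exists>d>0. \<forall>s1 s2. s1 \<le> t \<and> t \<le> s2 \<and> s1 < s2 \<and> s2 - s1 < d
        \<longrightarrow> integral {s1..s2} g \<le> (g t + e) * (s2 - s1)"
    using AE_upper_interval_slope[OF g M, where a=a and b=b and thesis=thesis] by blast
  obtain N2 where N2: "negligible N2"
    "\<And>t e. \<lbrakk>t \<in> {a<..<b} - N2; e > 0\<rbrakk> \<Longrightarrow> \<exists>d>0. \<forall>s1 s2. s1 \<le> t \<and> t \<le> s2 \<and> s1 < s2 \<and> s2 - s1 < d
        \<longrightarrow> integral {s1..s2} (\<lambda>t. - g t) \<le> (- g t + e) * (s2 - s1)"
    using AE_upper_interval_slope[OF g', of M a b thesis] M by (simp only: abs_minus_cancel)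
  have "((\<lambda>s. integral {a..s} g) has_real_derivative g t) (at t)" if t: "t \<in> {a<..<b} - (N1 \<union> N2)" for t
    unfolding has_field_derivative_def has_derivative_at_alt
  proof (intro conjI allI impI)
    show "bounded_linear ((*) (g t))" by (rule bounded_linear_mult_right)
    fix e :: real assume e: "e > 0"
    obtain d1 where d1: "d1 > 0" "\<And>s1 s2. s1 \<le> t \<and> t \<le> s2 \<and> s1 < s2 \<and> s2 - s1 < d1
        \<Longrightarrow> integral {s1..s2} g \<le> (g t + e) * (s2 - s1)" using N1(2)[of t e] t e by blast
    obtain d2 where d2: "d2 > 0" "\<And>s1 s2. s1 \<le> t \<and> t \<le> s2 \<and> s1 < s2 \<and> s2 - s1 < d2
        \<Longrightarrow> integral {s1..s2} (\<lambda>t. - g t) \<le> (- g t + e) * (s2 - s1)" using N2(2)[of t e] t e by blast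
    have bd: "\<bar>integral {s1..s2} g - g t * (s2 - s1)\<bar> \<le> e * (s2 - s1)"
      if "s1 \<le> t" "t \<le> s2" "s1 < s2" "s2 - s1 < min d1 d2" for s1 s2
      using d1(2)[of s1 s2] d2(2)[of s1 s2] that by (auto simp: abs_le_iff algebra_simps)
    show "\<exists>d>0. \<forall>y. norm (y - t) < d \<longrightarrow>
      norm (integral {a..y} g - integral {a..t} g - g t * (y - t)) \<le> e * norm (y - t)"
    proof (intro exI conjI allI impI)
      show "0 < min (min d1 d2) (t - a)" using d1 d2 t by auto
      fix y assume y: "norm (y - t) < min (min d1 d2) (t - a)"
      then have ya: "a < y" by (auto simp: abs_if split: if_splits)
      consider "y = t" | "t < y" | "y < t" by linarith
      then show "norm (integral {a..y} g - integral {a..t} g - g t * (y - t)) \<le> e * norm (y - t)"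
      proof cases
        case 2
        have "integral {a..t} g + integral {t..y} g = integral {a..y} g"
          using t 2 by (intro Henstock_Kurzweil_Integration.integral_combine int) auto
        then show ?thesis using bd[of t y] 2 y by simp
      next
        case 3
        have "integral {a..y} g + integral {y..t} g = integral {a..t} g"
          using ya 3 by (intro Henstock_Kurzweil_Integration.integral_combine int) auto
        then show ?thesis using bd[of y t] 3 y by (simp add: abs_le_iff algebra_simps)
      qed auto
    qed
  qed
  then show ?thesis using that negligible_Un[OF N1(1) N2(1)] by blast
qed

lemma AE_indefinite_integral_has_vector_derivative:
  fixes g :: "real \<Rightarrow> 'a::euclidean_space"
  assumes g: "g \<in> borel_measurable lebesgue" and M: "\<And>t. norm (g t) \<le> M"
  obtains N where "negligible N"
    "\<And>t. t \<in> {a<..<b} - N \<Longrightarrow> ((\<lambda>s. integral {a..s} g) has_vector_derivative g t) (at t)"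
proof -
  have int: "g integrable_on {s1..s2}" for s1 s2
    by (rule bounded_measurable_integrable_on[where T=UNIV and M=M]) (use g M in auto)
  have "\<exists>N. negligible N \<and> (\<forall>t \<in> {a<..<b} - N. ((\<lambda>s. integral {a..s} (\<lambda>t. g t \<bullet> i)) has_real_derivative g t \<bullet> i) (at t))"
    if "i \<in> Basis" for i
  proof -
    have "(\<lambda>t. g t \<bullet> i) \<in> borel_measurable lebesgue" using g by measurable
    moreover have "\<bar>g t \<bullet> i\<bar> \<le> M" for t using Basis_le_norm[OF that, of "g t"] M[of t] by linarith
    ultimately show ?thesis
    proof (rule AE_indefinite_integral_has_real_derivative[of "\<lambda>t. g t \<bullet> i" M a b])
      fix N assume "negligible N"
        "\<And>t. t \<in> {a<..<b} - N \<Longrightarrow> ((\<lambda>s. integral {a..s} (\<lambda>t. g t \<bullet> i)) has_real_derivative g t \<bullet> i) (at t)"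
      then show ?thesis by (intro exI[of _ N]) blast
    qed
  qed
  then have "\<forall>i\<in>Basis. \<exists>N. negligible N \<and> (\<forall>t \<in> {a<..<b} - N.
      ((\<lambda>s. integral {a..s} (\<lambda>t. g t \<bullet> i)) has_real_derivative g t \<bullet> i) (at t))" by blast
  from bchoice[OF this] obtain N where N: "\<And>i. i \<in> Basis \<Longrightarrow> negligible (N i)"
    "\<And>i t. i \<in> Basis \<Longrightarrow> t \<in> {a<..<b} - N i \<Longrightarrow> ((\<lambda>s. integral {a..s} (\<lambda>t. g t \<bullet> i)) has_real_derivative g t \<bullet> i) (at t)"
    by blast
  have "((\<lambda>s. integral {a..s} g) has_vector_derivative g t) (at t)" if t: "t \<in> {a<..<b} - (\<Union>i\<in>Basis. N i)" for t
    unfolding has_vector_derivative_def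
  proof (subst has_derivative_componentwise_within, intro ballI)
    fix i :: 'a assume i: "i \<in> Basis"
    have "((\<lambda>s. integral {a..s} (\<lambda>t. g t \<bullet> i)) has_derivative (\<lambda>x. x * (g t \<bullet> i))) (at t)"
    proof -
      have "(\<lambda>x. x * (g t \<bullet> i)) = (*) (g t \<bullet> i)" by (rule ext) (rule mult.commute)
      then show ?thesis using N(2)[OF i, of t] t i by (simp add: has_field_derivative_def)
    qed
    moreover have "integral {a..s} (\<lambda>t. g t \<bullet> i) = integral {a..s} g \<bullet> i" for s
      by (rule integral_component_eq[OF int])
    ultimately show "((\<lambda>x. integral {a..x} g \<bullet> i) has_derivative (\<lambda>x. (x *\<^sub>R g t) \<bullet> i)) (at t)" by simp
  qed
  moreover have "negligible (\<Union>i\<in>Basis. N i)" using N(1) by (intro negligible_Union) auto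
  ultimately show ?thesis using that by blast
qed

subsection \<open>Right Dini slopes and absolute continuity\<close>

text \<open>The upper right Dini derivative of \<open>W\<close> at \<open>t\<close> is at most
  \<open>c\<close>. The slack \<open>e\<close> replaces a limit superior, so no extended-real value
  is needed where the derivative is minus infinity.\<close>

definition right_slope_le :: "(real \<Rightarrow> real) \<Rightarrow> real \<Rightarrow> real \<Rightarrow> bool" where
  "right_slope_le W t c \<longleftrightarrow> (\<forall>e>0. \<forall>\<^sub>F h in at_right 0. W (t + h) \<le> W t + (c + e) * h)"

lemma right_slope_leD:
  assumes "right_slope_le W t c" "e > 0"
  obtains h0 where "h0 > 0" "\<And>h. \<lbrakk>0 \<le> h; h < h0\<rbrakk> \<Longrightarrow> W (t + h) \<le> W t + (c + e) * h"
proof -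
  have "\<forall>\<^sub>F h in at_right 0. W (t + h) \<le> W t + (c + e) * h"
    using assms by (auto simp: right_slope_le_def)
  then obtain b where b: "b > 0" "\<And>h. \<lbrakk>0 < h; h < b\<rbrakk> \<Longrightarrow> W (t + h) \<le> W t + (c + e) * h"
    unfolding eventually_at_right_field by auto
  have "W (t + h) \<le> W t + (c + e) * h" if "0 \<le> h" "h < b" for h
    using b(2)[of h] that by (cases "h = 0") auto
  then show ?thesis using that b(1) by blast
qed

lemma right_slope_leI:
  assumes "\<And>e. e > 0 \<Longrightarrow> \<exists>h0>0. \<forall>h. 0 < h \<and> h < h0 \<longrightarrow> W (t + h) \<le> W t + (c + e) * h"
  shows "right_slope_le W t c"
  unfolding right_slope_le_def eventually_at_right_field
proof (intro allI impI)
  fix e :: real assume "e > 0"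
  from assms[OF this] obtain h0 where "h0 > 0" "\<And>h. 0 < h \<and> h < h0 \<Longrightarrow> W (t + h) \<le> W t + (c + e) * h" by blast
  then show "\<exists>b>0. \<forall>y>0. y < b \<longrightarrow> W (t + y) \<le> W t + (c + e) * y" by (intro exI[of _ h0]) auto
qed

lemma right_slope_le_mono:
  assumes "right_slope_le W t c" "c \<le> c'"
  shows "right_slope_le W t c'"
proof (rule right_slope_leI)
  fix e :: real assume "e > 0"
  then obtain h0 where h0: "h0 > 0" "\<And>h. \<lbrakk>0 \<le> h; h < h0\<rbrakk> \<Longrightarrow> W (t + h) \<le> W t + (c + e) * h"
    using right_slope_leD[OF assms(1)] by metis
  have "W (t + h) \<le> W t + (c' + e) * h" if "0 < h" "h < h0" for h
  proof -
    have "(c + e) * h \<le> (c' + e) * h" using assms(2) that by (intro mult_right_mono) auto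
    then show ?thesis using h0(2)[of h] that by linarith
  qed
  then show "\<exists>h0>0. \<forall>h. 0 < h \<and> h < h0 \<longrightarrow> W (t + h) \<le> W t + (c' + e) * h" using h0(1) by blast
qed

text \<open>Comparison with a majorant \<open>F\<close> of slope c + e that has the extra slope
  \<open>K\<close> on a thin open set \<open>P\<close> covering the null set. Points outside
  \<open>P\<close> use the almost-everywhere bound \<open>c\<close>, points of \<open>P\<close> the
  bound \<open>C\<close>; the total surcharge is at most K e. A continuous induction carries W <= F
  from \<open>a\<close> to \<open>b\<close>.\<close>

lemma right_slope_growth:
  fixes W :: "real \<Rightarrow> real"
  assumes ab: "a \<le> b" and cont: "continuous_on {a..b} W" and N: "negligible N"
    and ev: "\<And>t. t \<in> {a..<b} \<Longrightarrow> right_slope_le W t C"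
    and ae: "\<And>t. t \<in> {a..<b} - N \<Longrightarrow> right_slope_le W t c"
  shows "W b \<le> W a + c * (b - a)"
proof -
  define K where "K = \<bar>C\<bar> + \<bar>c\<bar> + 1"
  have K: "K > 0" "C \<le> c + K" by (auto simp: K_def)
  have main: "W b \<le> W a + (c + e) * (b - a) + K * e" if e: "e > 0" for e
  proof -
    let ?N = "N \<inter> {a..b}"
    have nN: "negligible ?N" using N negligible_subset by blast
    then have "?N \<in> sets lebesgue" using negligible_imp_sets by blast
    then obtain P where P: "open P" "?N \<subseteq> P" "P - ?N \<in> lmeasurable" "emeasure lebesgue (P - ?N) < ennreal e"
      using sets_lebesgue_outer_open[OF _ e] by blast
    have Pm: "P \<in> lmeasurable"
    proof -
      have "P = (P - ?N) \<union> ?N" using P(2) by blast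
      then show ?thesis using P(3) negligible_imp_measurable[OF nN] fmeasurable.Un by metis
    qed
    have Pe: "measure lebesgue P \<le> e"
    proof -
      have "measure lebesgue (P - ?N) = measure lebesgue P"
        by (rule measure_Diff_null_set) (use nN Pm fmeasurableD in \<open>auto simp: negligible_iff_null_sets\<close>)
      moreover have "measure lebesgue (P - ?N) \<le> e"
        using P(3,4) e by (simp add: emeasure_eq_measure2 ennreal_less_iff)
      ultimately show ?thesis by simp
    qed
    define G where "G t = measure lebesgue (P \<inter> {a..t})" for t
    have Gm: "P \<inter> {a..t} \<in> lmeasurable" for t using Pm by blast
    have Gmono: "G s \<le> G t" if "s \<le> t" for s t
      unfolding G_def by (rule measure_mono_fmeasurable) (use Gm that in auto)
    have G0: "0 \<le> G t" for t by (simp add: G_def)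
    have Ge: "G t \<le> e" for t
      unfolding G_def using Pe by (rule order_trans[rotated]) (rule measure_mono_fmeasurable, use Pm in auto)
    have Gstep: "G t + h \<le> G (t + h)" if "a \<le> t" "0 \<le> h" "{t..t+h} \<subseteq> P" for t h
    proof -
      have "G t + h = measure lebesgue (P \<inter> {a..t}) + measure lebesgue {t<..t+h}"
        using that by (simp add: G_def)
      also have "\<dots> = measure lebesgue (P \<inter> {a..t} \<union> {t<..t+h})"
        by (rule measure_Un_AE[symmetric]) (use Gm in \<open>auto intro: bounded_set_imp_lmeasurable\<close>)
      also have "\<dots> \<le> G (t + h)"
        unfolding G_def by (rule measure_mono_fmeasurable) (use Gm that in auto)
      finally show ?thesis .
    qed
    define F where "F t = W a + (c + e) * (t - a) + K * G t" for t
    define S where "S = {t \<in> {a..b}. \<forall>s\<in>{a..t}. W s \<le> F s}"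
    have aS: "a \<in> S" using ab K G0[of a] by (auto simp: S_def F_def)
    have bdS: "bdd_above S" by (auto simp: S_def bdd_above_def)
    define T where "T = Sup S"
    have T: "a \<le> T" "T \<le> b"
    proof -
      show "a \<le> T" unfolding T_def by (rule cSup_upper[OF aS bdS])
      show "T \<le> b" unfolding T_def by (rule cSup_least) (use aS in \<open>auto simp: S_def\<close>)
    qed
    have below: "W s \<le> F s" if "a \<le> s" "s < T" for s
    proof -
      have "S \<noteq> {}" using aS by blast
      then obtain t where "t \<in> S" "s < t" using \<open>s < T\<close> less_cSup_iff[of S s] bdS unfolding T_def by blast
      then show ?thesis using that by (auto simp: S_def)
    qed
    have atT: "W T \<le> F T"
    proof (cases "T = a")
      case True then show ?thesis using aS by (auto simp: S_def)
    next
      case False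
      \<comment> \<open>Only the part without \<open>G\<close> is passed to the left limit. For
        \<open>G\<close> monotonicity suffices: \<open>G s\<close> is replaced by \<open>G T\<close>
        before the limit.\<close>
      have "((\<lambda>s. W s - (c + e) * (s - a)) \<longlongrightarrow> W T - (c + e) * (T - a)) (at_left T)"
      proof (intro tendsto_intros)
        have "(W \<longlongrightarrow> W T) (at T within {a..b})" using cont T by (auto simp: continuous_on)
        moreover have "at T within {a<..<T} = at_left T"
          using False T by (intro at_within_nhd[where S="{a<..}"]) auto
        moreover have "(W \<longlongrightarrow> W T) (at T within {a<..<T})"
          using calculation(1) by (rule tendsto_within_subset) (use T in auto)
        ultimately show "(W \<longlongrightarrow> W T) (at_left T)" by simp
      qed
      moreover have "\<forall>\<^sub>F s in at_left T. W s - (c + e) * (s - a) \<le> W a + K * G T"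
      proof -
        have "\<forall>\<^sub>F s in at_left T. a < s" using False T by (intro eventually_at_leftI[of a]) auto
        moreover have "\<forall>\<^sub>F s in at_left T. s < T" by (simp add: eventually_at_filter)
        ultimately show ?thesis
        proof eventually_elim
          case (elim s)
          have "K * G s \<le> K * G T" using Gmono[of s T] elim K by (intro mult_left_mono) auto
          then show ?case using below[of s] elim by (simp add: F_def)
        qed
      qed
      ultimately have "W T - (c + e) * (T - a) \<le> W a + K * G T"
        by (rule tendsto_upperbound) simp
      then show ?thesis by (simp add: F_def)
    qed
    have "W s \<le> F s" if "s \<in> {a..T}" for s
      using below[of s] atT that by (cases "s = T") auto
    then have TS: "T \<in> S" using T by (simp add: S_def)
    have "T = b"
    proof (rule ccontr)
      assume "T \<noteq> b"
      then have Tb: "T < b" using T by simp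
      have "\<exists>h0>0. \<forall>h. 0 \<le> h \<and> h < h0 \<longrightarrow> W (T + h) \<le> F (T + h)"
      proof (cases "T \<in> P")
        \<comment> \<open>Inside \<open>P\<close> the measure \<open>G\<close> grows at unit rate,
          so \<open>F\<close> gains slope c + e + K, which is at least C + e.\<close>
        case True
        obtain h1 where h1: "h1 > 0" "\<And>h. \<lbrakk>0 \<le> h; h < h1\<rbrakk> \<Longrightarrow> W (T + h) \<le> W T + (C + e) * h"
          using right_slope_leD[OF ev[of T] e] T Tb by auto
        obtain h2 where h2: "h2 > 0" "ball T h2 \<subseteq> P" using True P(1) openE by blast
        have "W (T + h) \<le> F (T + h)" if h: "0 \<le> h" "h < min h1 h2" for h
        proof -
          have "{T..T+h} \<subseteq> P" using h h2(2) by (auto simp: dist_real_def subset_iff)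
          then have "G T + h \<le> G (T + h)" using Gstep T h by auto
          then have "K * (G T + h) \<le> K * G (T + h)" using K by (intro mult_left_mono) auto
          moreover have "(C + e) * h \<le> (c + K + e) * h" using K h by (intro mult_right_mono) auto
          ultimately show ?thesis using h1(2)[of h] h atT by (simp add: F_def algebra_simps)
        qed
        then show ?thesis using h1(1) h2(1) by (intro exI[of _ "min h1 h2"]) auto
      next
        case False
        then have "T \<notin> N" using P(2) T by auto
        then obtain h1 where h1: "h1 > 0" "\<And>h. \<lbrakk>0 \<le> h; h < h1\<rbrakk> \<Longrightarrow> W (T + h) \<le> W T + (c + e) * h"
          using right_slope_leD[OF ae[of T] e] T Tb by auto
        have "W (T + h) \<le> F (T + h)" if h: "0 \<le> h" "h < h1" for h
        proof -
          have "K * G T \<le> K * G (T + h)" using Gmono[of T "T+h"] h K by (intro mult_left_mono) auto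
          then show ?thesis using h1(2)[of h] h atT by (simp add: F_def algebra_simps)
        qed
        then show ?thesis using h1(1) by auto
      qed
      then obtain h0 where h0: "h0 > 0" "\<And>h. 0 \<le> h \<and> h < h0 \<Longrightarrow> W (T + h) \<le> F (T + h)" by blast
      define T' where "T' = min b (T + h0 / 2)"
      have T': "T < T'" "T' \<le> b" using Tb h0 by (auto simp: T'_def)
      have "W s \<le> F s" if "s \<in> {a..T'}" for s
      proof (cases "s \<le> T")
        case True then show ?thesis using TS that by (auto simp: S_def)
      next
        case False
        then show ?thesis using h0(2)[of "s - T"] h0(1) that by (auto simp: T'_def min_def field_simps split: if_splits)
      qed
      then have "T' \<in> S" using T' T by (auto simp: S_def)
      then have "T' \<le> T" using bdS cSup_upper by (auto simp: T_def)
      then show False using T' by simp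
    qed
    then have "W b \<le> F b" using atT by simp
    also have "F b \<le> W a + (c + e) * (b - a) + K * e" using Ge[of b] K by (simp add: F_def)
    finally show ?thesis .
  qed
  show ?thesis
  proof (rule field_le_epsilon)
    fix d :: real assume d: "d > 0"
    define e where "e = d / (b - a + K)"
    have e: "e > 0" "e * (b - a + K) = d" using d ab K by (auto simp: e_def)
    show "W b \<le> W a + c * (b - a) + d"
      using main[OF e(1)] e(2) by (simp add: algebra_simps)
  qed
qed


section \<open>Absolute continuity and a mean value inequality\<close>

lemma abs_cont_on_subset: "abs_cont_on S f \<Longrightarrow> T \<subseteq> S \<Longrightarrow> abs_cont_on T f"
  unfolding abs_cont_on_def by (meson subset_trans)

lemma lipschitz_imp_abs_cont_on:
  fixes f :: "real \<Rightarrow> 'a::real_normed_vector"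
  assumes L: "\<And>s t. \<lbrakk>a \<le> s; s \<le> t; t \<le> b\<rbrakk> \<Longrightarrow> norm (f t - f s) \<le> M * (t - s)"
  shows "abs_cont_on {a..b} f"
  unfolding abs_cont_on_def
proof (intro allI impI)
  fix e :: real assume e: "e > 0"
  define K where "K = \<bar>M\<bar> + 1"
  have K: "K > 0" "M \<le> K" by (auto simp: K_def)
  show "\<exists>\<eta>>0. \<forall>\<D>. \<D> division_of \<Union>\<D> \<and> \<Union>\<D> \<subseteq> {a..b} \<and> (\<Sum>K\<in>\<D>. measure lborel K) < \<eta>
     \<longrightarrow> (\<Sum>K\<in>\<D>. norm (f (Sup K) - f (Inf K))) < e"
  proof (intro exI conjI allI impI)
    show "e / K > 0" using e K by simp
    fix \<D> :: "real set set"
    assume D: "\<D> division_of \<Union>\<D> \<and> \<Union>\<D> \<subseteq> {a..b} \<and> (\<Sum>K\<in>\<D>. measure lborel K) < e / K"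
    have "(\<Sum>k\<in>\<D>. norm (f (Sup k) - f (Inf k))) \<le> (\<Sum>k\<in>\<D>. K * measure lborel k)"
    proof (rule sum_mono)
      fix k assume k: "k \<in> \<D>"
      obtain c d where cd: "k = cbox c d" "k \<noteq> {}" using D k division_ofD(3,4)[of \<D> "\<Union>\<D>" k] by blast
      then have "c \<le> d" "k = {c..d}" by auto
      moreover have "{c..d} \<subseteq> {a..b}" using D k calculation by blast
      ultimately have "norm (f d - f c) \<le> M * (d - c)" using L[of c d] by auto
      also have "\<dots> \<le> K * (d - c)" using K \<open>c \<le> d\<close> by (intro mult_right_mono) auto
      finally show "norm (f (Sup k) - f (Inf k)) \<le> K * measure lborel k"
        using \<open>c \<le> d\<close> \<open>k = {c..d}\<close> by simp
    qed
    also have "\<dots> = K * (\<Sum>k\<in>\<D>. measure lborel k)" by (simp add: sum_distrib_left)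
    also have "\<dots> < e" using D K by (simp add: field_simps)
    finally show "(\<Sum>K\<in>\<D>. norm (f (Sup K) - f (Inf K))) < e" .
  qed
qed

text \<open>A gauge argument. A tag with a derivative gets a ball where difference quotients are at
  most M + e; a tag in the null set gets a thin open set \<open>P\<close>. In a fine tagged division
  the intervals of the first kind contribute at most (M + e) (b - a); those of the second kind have
  total length below \<eta> and contribute at most \<open>e\<close> by absolute continuity.\<close>

lemma abs_cont_on_AE_deriv_bound:
  fixes f :: "real \<Rightarrow> 'a::real_normed_vector"
  assumes ab: "a \<le> b" and ac: "abs_cont_on {a..b} f" and N: "negligible N"
    and M0: "0 \<le> M" and M: "\<And>t. t \<in> {a<..<b} - N \<Longrightarrow> \<exists>D. norm D \<le> M \<and> (f has_vector_derivative D) (at t)"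
  shows "norm (f b - f a) \<le> M * (b - a)"
proof -
  \<comment> \<open>The endpoints join the exceptional set because a derivative is assumed only in
    the open interval.\<close>
  let ?N = "(N \<inter> {a..b}) \<union> {a, b}"
  have nN: "negligible ?N" using N negligible_subset[of N "N \<inter> {a..b}"] by (auto intro!: negligible_Un)
  have main: "norm (f b - f a) \<le> (M + e) * (b - a) + e" if e: "e > 0" for e
  proof -
    obtain \<eta> where \<eta>: "\<eta> > 0" "\<And>\<D>. \<lbrakk>\<D> division_of \<Union>\<D>; \<Union>\<D> \<subseteq> {a..b}; (\<Sum>K\<in>\<D>. measure lborel K) < \<eta>\<rbrakk>
       \<Longrightarrow> (\<Sum>K\<in>\<D>. norm (f (Sup K) - f (Inf K))) < e"
      using ac[unfolded abs_cont_on_def, rule_format, OF e] by blast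
    have "?N \<in> sets lebesgue" using nN negligible_imp_sets by blast
    then obtain P where P: "open P" "?N \<subseteq> P" "P - ?N \<in> lmeasurable" "emeasure lebesgue (P - ?N) < ennreal \<eta>"
      using sets_lebesgue_outer_open[OF _ \<eta>(1)] by blast
    have Pm: "P \<in> lmeasurable"
    proof -
      have "P = (P - ?N) \<union> ?N" using P(2) by blast
      then show ?thesis using P(3) negligible_imp_measurable[OF nN] fmeasurable.Un by metis
    qed
    have Pe: "measure lebesgue P < \<eta>"
    proof -
      have "measure lebesgue (P - ?N) = measure lebesgue P"
        by (rule measure_Diff_null_set) (use nN Pm fmeasurableD in \<open>auto simp: negligible_iff_null_sets\<close>)
      moreover have "measure lebesgue (P - ?N) < \<eta>"
        using P(3,4) \<eta> by (simp add: emeasure_eq_measure2 ennreal_less_iff)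
      ultimately show ?thesis by simp
    qed
    have "\<exists>d>0. \<forall>s. norm (s - t) < d \<longrightarrow> norm (f s - f t) \<le> (M + e) * norm (s - t)"
      if t: "t \<in> {a..b} - ?N" for t
    proof -
      obtain D where D: "norm D \<le> M" "(f has_vector_derivative D) (at t)" using M[of t] t by auto
      then obtain d where d: "d > 0" "\<And>s. norm (s - t) < d \<Longrightarrow> norm (f s - f t - (s - t) *\<^sub>R D) \<le> e * norm (s - t)"
        using e unfolding has_vector_derivative_def has_derivative_at_alt by blast
      have "norm (f s - f t) \<le> (M + e) * norm (s - t)" if "norm (s - t) < d" for s
      proof -
        have "norm (f s - f t) \<le> norm (f s - f t - (s - t) *\<^sub>R D) + norm ((s - t) *\<^sub>R D)"
          using norm_triangle_ineq[of "f s - f t - (s - t) *\<^sub>R D" "(s - t) *\<^sub>R D"] by simp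
        also have "\<dots> \<le> e * norm (s - t) + norm (s - t) * M"
          using d(2)[OF that] D(1) by (auto intro!: add_mono mult_left_mono)
        finally show ?thesis by (simp add: algebra_simps)
      qed
      then show ?thesis using d(1) by blast
    qed
    then have "\<forall>t\<in>{a..b} - ?N. \<exists>d>0. \<forall>s. norm (s - t) < d \<longrightarrow> norm (f s - f t) \<le> (M + e) * norm (s - t)"
      by blast
    from bchoice[OF this] obtain d where d: "\<And>t. t \<in> {a..b} - ?N \<Longrightarrow> d t > 0"
      "\<And>t s. t \<in> {a..b} - ?N \<Longrightarrow> norm (s - t) < d t \<Longrightarrow> norm (f s - f t) \<le> (M + e) * norm (s - t)"
      by blast
    define \<gamma> where "\<gamma> t = (if t \<in> ?N then P else if t \<in> {a..b} then ball t (d t) else UNIV)" for t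
    have "gauge \<gamma>" unfolding gauge_def \<gamma>_def using P(1,2) d(1) by auto
    then obtain p where p: "p tagged_division_of {a..b}" "\<gamma> fine p" using fine_division_exists_real by blast
    have fp: "finite p" using p(1) by auto
    define p1 where "p1 = {(x, k) \<in> p. x \<in> ?N}"
    define p2 where "p2 = {(x, k) \<in> p. x \<notin> ?N}"
    have pp: "p = p1 \<union> p2" "p1 \<inter> p2 = {}" "p1 \<subseteq> p" "p2 \<subseteq> p" by (auto simp: p1_def p2_def)
    have fin: "finite p1" "finite p2" using fp pp finite_subset by blast+
    let ?g = "\<lambda>(x :: real, k). f (Sup k) - f (Inf k)"
    have pD: "x \<in> k \<and> k \<subseteq> {a..b} \<and> (\<exists>c d. c \<le> d \<and> k = {c..d})" if xk: "(x, k) \<in> p" for x k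
    proof -
      obtain c d where cd: "k = cbox c d" using tagged_division_ofD(4)[OF p(1) xk] by blast
      have "x \<in> k" "k \<subseteq> {a..b}" using tagged_division_ofD(2,3)[OF p(1) xk] by auto
      then show ?thesis using cd by auto
    qed
    have "f b - f a = sum ?g p" using additive_tagged_division_1[OF ab p(1), of f] by simp
    also have "\<dots> = sum ?g p1 + sum ?g p2" using sum.union_disjoint[OF fin pp(2), of ?g] unfolding pp(1)[symmetric] by simp
    finally have "norm (f b - f a) \<le> norm (sum ?g p1) + norm (sum ?g p2)" by (simp add: norm_triangle_ineq)
    also have "norm (sum ?g p2) \<le> (M + e) * (b - a)"
    proof -
      have "norm (sum ?g p2) \<le> (\<Sum>(x,k)\<in>p2. (M + e) * measure lborel k)"
      proof (rule sum_norm_le, clarify)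
        fix x k assume xk: "(x, k) \<in> p2"
        then have xp: "(x, k) \<in> p" using pp by blast
        obtain c d' where k: "c \<le> d'" "k = {c..d'}" using pD[OF xp] by blast
        have x: "x \<in> {a..b} - ?N" "x \<in> k" using pD[OF xp] xk by (auto simp: p2_def)
        have "k \<subseteq> \<gamma> x" using p(2) xp by (auto simp: fine_def)
        then have kb: "k \<subseteq> ball x (d x)" using x by (auto simp: \<gamma>_def)
        have "norm (f d' - f x) \<le> (M + e) * (d' - x)" "norm (f x - f c) \<le> (M + e) * (x - c)"
        proof -
          have "norm (d' - x) < d x" "norm (c - x) < d x"
            using kb k by (auto simp: dist_real_def abs_minus_commute)
          then show "norm (f d' - f x) \<le> (M + e) * (d' - x)" "norm (f x - f c) \<le> (M + e) * (x - c)"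
            using d(2)[OF x(1), of d'] d(2)[OF x(1), of c] k x(2) by (auto simp: norm_minus_commute)
        qed
        moreover have "norm (f d' - f c) \<le> norm (f d' - f x) + norm (f x - f c)"
          using norm_triangle_ineq[of "f d' - f x" "f x - f c"] by simp
        ultimately show "norm (f (Sup k) - f (Inf k)) \<le> (M + e) * measure lborel k"
          using k by (simp add: algebra_simps)
      qed
      also have "\<dots> \<le> (\<Sum>(x,k)\<in>p. (M + e) * measure lborel k)"
        by (rule sum_mono2[OF fp pp(4)]) (use M0 e in auto)
      also have "\<dots> = (M + e) * (\<Sum>(x,k)\<in>p. measure lborel k)"
        by (simp add: sum_distrib_left case_prod_unfold)
      also have "(\<Sum>(x,k)\<in>p. measure lborel k) = b - a"
        using additive_content_tagged_division[of p a b] p(1) ab by simp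
      finally show ?thesis .
    qed
    also have "norm (sum ?g p1) \<le> e"
    proof -
      have tp: "p1 tagged_partial_division_of {a..b}"
        using p(1) pp(3) tagged_partial_division_subset tagged_division_of_def by blast
      have t1: "p1 tagged_division_of (\<Union>(snd ` p1))" by (rule tagged_partial_division_of_Union_self[OF tp])
      have dv: "(snd ` p1) division_of \<Union>(snd ` p1)" by (rule division_of_tagged_division[OF t1])
      have sub: "\<Union>(snd ` p1) \<subseteq> {a..b}" using pD pp(3) by force
      have subP: "\<Union>(snd ` p1) \<subseteq> P"
      proof -
        have "k \<subseteq> P" if "(x, k) \<in> p1" for x k
        proof -
          have "k \<subseteq> \<gamma> x" using that p(2) pp(3) unfolding fine_def by blast
          moreover have "x \<in> ?N" using that by (simp add: p1_def)
          ultimately show ?thesis by (simp only: \<gamma>_def if_True)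
        qed
        then show ?thesis by force
      qed
      have "(\<Sum>K\<in>snd ` p1. measure lborel K) = (\<Sum>K\<in>snd ` p1. measure lebesgue K)"
      proof (rule sum.cong)
        fix K assume "K \<in> snd ` p1"
        then obtain c d where "K = cbox c d" using division_ofD(4)[OF dv] by metis
        then show "measure lborel K = measure lebesgue K" by simp
      qed simp
      also have "\<dots> = measure lebesgue (\<Union>(snd ` p1))"
        by (rule content_division[OF dv])
      also have "\<dots> \<le> measure lebesgue P"
        by (rule measure_mono_fmeasurable[OF subP _ Pm]) (use dv in \<open>auto intro: fmeasurableD lmeasurable_division\<close>)
      finally have "(\<Sum>K\<in>snd ` p1. norm (f (Sup K) - f (Inf K))) < e"
        using \<eta>(2)[OF dv sub] Pe by linarith
      \<comment> \<open>Passing from tagged intervals to bare intervals requires a summand that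
        vanishes on intervals with empty interior; the case distinction on \<open>K = {}\<close>
        secures this for the empty box as well.\<close>
      moreover have "(\<Sum>(x,K)\<in>p1. if K = {} then 0 else norm (f (Sup K) - f (Inf K)))
          = (\<Sum>K\<in>snd ` p1. if K = {} then 0 else norm (f (Sup K) - f (Inf K)))"
      proof (rule sum.over_tagged_division_lemma[OF t1])
        fix u v :: real assume uv: "box u v = {}"
        show "(if cbox u v = {} then 0 else norm (f (Sup (cbox u v)) - f (Inf (cbox u v)))) = 0"
          by (cases "u = v") (use uv in auto)
      qed
      moreover have "(\<Sum>(x,K)\<in>p1. if K = {} then 0 else norm (f (Sup K) - f (Inf K))) = (\<Sum>(x,K)\<in>p1. norm (f (Sup K) - f (Inf K)))"
        by (rule sum.cong) (use pp(3) in \<open>auto dest!: pD\<close>)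
      moreover have "(\<Sum>K\<in>snd ` p1. if K = {} then 0 else norm (f (Sup K) - f (Inf K))) = (\<Sum>K\<in>snd ` p1. norm (f (Sup K) - f (Inf K)))"
      proof (rule sum.cong)
        fix K assume "K \<in> snd ` p1"
        then have "K \<noteq> {}" using pD pp(3) by fastforce
        then show "(if K = {} then 0 else norm (f (Sup K) - f (Inf K))) = norm (f (Sup K) - f (Inf K))" by simp
      qed simp
      moreover have "norm (sum ?g p1) \<le> (\<Sum>(x,K)\<in>p1. norm (f (Sup K) - f (Inf K)))"
        by (rule order_trans[OF norm_sum]) (auto intro!: sum_mono)
      ultimately show ?thesis by linarith
    qed
    finally show ?thesis by simp
  qed
  show ?thesis
  proof (rule field_le_epsilon)
    fix d :: real assume d: "d > 0"
    define e where "e = d / (b - a + 1)"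
    have e: "e > 0" "e * (b - a + 1) = d" using d ab by (auto simp: e_def)
    show "norm (f b - f a) \<le> M * (b - a) + d"
      using main[OF e(1)] e(2) by (simp add: algebra_simps)
  qed
qed

subsection \<open>Histories\<close>

text \<open>The boundedness demanded by the function space comes for free on a compact
  interval.\<close>

lemma C0_mem:
  fixes x :: "real \<Rightarrow> real ^ 'n"
  shows "x \<in> mspace (C0 r) \<longleftrightarrow> x \<in> extensional {-r..0} \<and> continuous_on {-r..0} x"
proof -
  have "bounded (x ` {-r..0})" if "continuous_on {-r..0} x"
    using compact_continuous_image[OF that] compact_imp_bounded by blast
  then show ?thesis by auto
qed

lemma continuous_on_Tr:
  fixes x :: "real \<Rightarrow> 'a::topological_space"
  assumes "continuous_on {t-r..t} x"
  shows "continuous_on {-r..0} (\<lambda>\<theta>. x (t + \<theta>))"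
proof -
  have "continuous_on {-r..0} (\<lambda>\<theta>. t + \<theta>)" by (intro continuous_intros)
  then show ?thesis by (rule continuous_on_compose2[OF assms]) auto
qed

lemma Tr_mem:
  fixes x :: "real \<Rightarrow> real ^ 'n"
  assumes "continuous_on {t-r..t} x"
  shows "Tr r t x \<in> mspace (C0 r)"
proof -
  have "continuous_on {-r..0} (Tr r t x) = continuous_on {-r..0} (\<lambda>\<theta>. x (t + \<theta>))"
    by (rule continuous_on_cong) (auto simp: Tr_def)
  then show ?thesis using continuous_on_Tr[OF assms] unfolding C0_mem by (simp add: Tr_def)
qed

lemma Tr_apply: "\<theta> \<in> {-r..0} \<Longrightarrow> Tr r t x \<theta> = x (t + \<theta>)"
  by (simp add: Tr_def)

lemma Tr_cong:
  assumes "\<And>s. s \<in> {t-r..t} \<Longrightarrow> x s = y s"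
  shows "Tr r t x = Tr r t y"
  unfolding Tr_def using assms by (auto intro!: restrict_ext)

lemma hnorm_le:
  assumes "0 \<le> r" "\<And>\<theta>. \<theta> \<in> {-r..0} \<Longrightarrow> norm (x \<theta>) \<le> B"
  shows "hnorm r x \<le> B"
  unfolding hnorm_def using assms by (intro cSUP_least) auto

lemma norm_le_hnorm:
  fixes x :: "real \<Rightarrow> real ^ 'n"
  assumes "continuous_on {-r..0} x" "\<theta> \<in> {-r..0}"
  shows "norm (x \<theta>) \<le> hnorm r x"
proof -
  have "compact ((\<lambda>\<theta>. norm (x \<theta>)) ` {-r..0})"
    using assms by (intro compact_continuous_image continuous_intros) auto
  then have "bdd_above ((\<lambda>\<theta>. norm (x \<theta>)) ` {-r..0})"
    by (intro bounded_imp_bdd_above compact_imp_bounded)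
  then show ?thesis unfolding hnorm_def by (rule cSUP_upper2[OF _ assms(2)]) simp
qed

lemma hnorm_nonneg:
  fixes x :: "real \<Rightarrow> real ^ 'n"
  assumes "0 \<le> r" "continuous_on {-r..0} x"
  shows "0 \<le> hnorm r x"
proof -
  have "norm (x 0) \<le> hnorm r x" using norm_le_hnorm[OF assms(2), of 0] assms(1) by simp
  then show ?thesis using norm_ge_zero[of "x 0"] by linarith
qed

lemma hnorm_Tr_le:
  assumes "0 \<le> r" "\<And>s. s \<in> {t-r..t} \<Longrightarrow> norm (x s) \<le> B"
  shows "hnorm r (Tr r t x) \<le> B"
  using assms by (intro hnorm_le) (auto simp: Tr_apply)

lemma norm_le_hnorm_Tr:
  fixes x :: "real \<Rightarrow> real ^ 'n"
  assumes "continuous_on {t-r..t} x" "s \<in> {t-r..t}"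
  shows "norm (x s) \<le> hnorm r (Tr r t x)"
  using norm_le_hnorm[of r "Tr r t x" "s - t"] Tr_mem[OF assms(1)] assms(2)
  by (auto simp: C0_mem Tr_apply)

lemma mdist_C0_le_iff:
  fixes x y :: "real \<Rightarrow> real ^ 'n"
  assumes "0 \<le> r" "x \<in> mspace (C0 r)" "y \<in> mspace (C0 r)"
  shows "mdist (C0 r) x y \<le> a \<longleftrightarrow> (\<forall>\<theta>\<in>{-r..0}. norm (x \<theta> - y \<theta>) \<le> a)"
  using cfunspace_mdist_le[OF assms(2,3), of a] assms(1) by (simp add: dist_norm)

lemma limitin_C0I:
  fixes X :: "'a \<Rightarrow> real \<Rightarrow> real ^ 'n"
  assumes r: "0 \<le> r" and X: "\<And>n. X n \<in> mspace (C0 r)" and x: "x \<in> mspace (C0 r)"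
    and lim: "\<And>e. e > 0 \<Longrightarrow> \<forall>\<^sub>F n in G. \<forall>\<theta>\<in>{-r..0}. norm (X n \<theta> - x \<theta>) \<le> e"
  shows "limitin (C0_top r) X x G"
proof -
  interpret M: Metric_space "mspace (C0 r) :: (real \<Rightarrow> real ^ 'n) set" "mdist (C0 r)" by (rule Metric_space_mspace_mdist)
  have "\<forall>\<^sub>F n in G. X n \<in> mspace (C0 r) \<and> mdist (C0 r) (X n) x < e" if e: "e > 0" for e
  proof -
    have "e/2 > 0" using e by simp
    from lim[OF this] show ?thesis
    proof eventually_elim
      case (elim n)
      then have "mdist (C0 r) (X n) x \<le> e/2" using mdist_C0_le_iff[OF r X x] by blast
      then show ?case using X e by auto
    qed
  qed
  then show ?thesis unfolding mtopology_of_def M.limitin_metric using x by blast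
qed

section \<open>Slopes of squared norms, and primitives of bounded measurable functions\<close>

lemma right_slope_le_derivative:
  assumes "(W has_real_derivative D) (at t)"
  shows "right_slope_le W t D"
proof (rule right_slope_leI)
  fix e :: real assume e: "e > 0"
  obtain d where d: "d > 0" "\<And>s. norm (s - t) < d \<Longrightarrow> norm (W s - W t - D * (s - t)) \<le> e * norm (s - t)"
    using assms e unfolding has_field_derivative_def has_derivative_at_alt by blast
  have "W (t + h) \<le> W t + (D + e) * h" if "0 < h" "h < d" for h
    using d(2)[of "t + h"] that by (auto simp: abs_le_iff algebra_simps)
  then show "\<exists>h0>0. \<forall>h. 0 < h \<and> h < h0 \<longrightarrow> W (t + h) \<le> W t + (D + e) * h" using d(1) by blast
qed

lemma right_slope_le_lipschitz:
  assumes "h0 > 0" "\<And>h. \<lbrakk>0 < h; h < h0\<rbrakk> \<Longrightarrow> W (t + h) \<le> W t + C * h"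
  shows "right_slope_le W t C"
proof (rule right_slope_leI)
  fix e :: real assume e: "e > 0"
  have "W (t + h) \<le> W t + (C + e) * h" if "0 < h" "h < h0" for h
  proof -
    have "C * h \<le> (C + e) * h" using e that by (intro mult_right_mono) auto
    then show ?thesis using assms(2)[OF that] by linarith
  qed
  then show "\<exists>h0>0. \<forall>h. 0 < h \<and> h < h0 \<longrightarrow> W (t + h) \<le> W t + (C + e) * h" using assms(1) by blast
qed

lemma lipschitz_continuous_on:
  fixes z :: "real \<Rightarrow> 'a::real_normed_vector"
  assumes M: "\<And>s t. \<lbrakk>a \<le> s; s \<le> t; t \<le> b\<rbrakk> \<Longrightarrow> norm (z t - z s) \<le> M * (t - s)"
  shows "continuous_on {a..b} z"
proof (rule continuous_onI)
  fix x e :: real assume x: "x \<in> {a..b}" and e: "e > 0"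
  show "\<exists>d>0. \<forall>x'\<in>{a..b}. dist x' x < d \<longrightarrow> dist (z x') (z x) \<le> e"
  proof (intro exI conjI ballI impI)
    show "e / (\<bar>M\<bar> + 1) > 0" using e by (simp add: add_nonneg_pos)
    fix y assume y: "y \<in> {a..b}" "dist y x < e / (\<bar>M\<bar> + 1)"
    have "dist (z y) (z x) \<le> M * \<bar>y - x\<bar>"
      using M[of x y] M[of y x] x y by (cases "x \<le> y") (auto simp: dist_norm norm_minus_commute)
    also have "\<dots> \<le> (\<bar>M\<bar> + 1) * \<bar>y - x\<bar>" by (intro mult_right_mono) auto
    also have "\<dots> \<le> e" using y(2) by (simp add: dist_real_def pos_less_divide_eq add_nonneg_pos mult.commute)
    finally show "dist (z y) (z x) \<le> e" .
  qed
qed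

text \<open>On the interval the squared norm is Lipschitz with constant 2 Z M, which serves as the
  bound at every time, and at almost every time its derivative is twice the inner product of
  \<open>z\<close> and \<open>D\<close>. Such inner products, for a difference of solutions, are
  exactly what a one-sided Lipschitz condition controls.\<close>

lemma norm_sq_growth:
  fixes z :: "real \<Rightarrow> 'a::real_inner"
  assumes ab: "a \<le> b" and M: "\<And>s t. \<lbrakk>a \<le> s; s \<le> t; t \<le> b\<rbrakk> \<Longrightarrow> norm (z t - z s) \<le> M * (t - s)"
    and N: "negligible N"
    and d: "\<And>t. t \<in> {a<..<b} - N \<Longrightarrow> \<exists>D. (z has_vector_derivative D) (at t) \<and> 2 * (z t \<bullet> D) \<le> c"
  shows "(norm (z b))\<^sup>2 \<le> (norm (z a))\<^sup>2 + c * (b - a)"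
proof -
  have cont: "continuous_on {a..b} z" by (rule lipschitz_continuous_on[OF M])
  then have "compact (z ` {a..b})" by (intro compact_continuous_image) auto
  then have "bounded (z ` {a..b})" by (rule compact_imp_bounded)
  then obtain Z where Z: "Z > 0" "\<And>t. t \<in> {a..b} \<Longrightarrow> norm (z t) \<le> Z" unfolding bounded_pos by blast
  show ?thesis
  proof (rule right_slope_growth[where W = "\<lambda>t. (norm (z t))\<^sup>2" and C = "2 * Z * M" and N = "N \<union> {a}"])
    show "a \<le> b" by fact
    show "continuous_on {a..b} (\<lambda>t. (norm (z t))\<^sup>2)" by (intro continuous_intros cont)
    show "negligible (N \<union> {a})" using N by simp
    fix t assume t: "t \<in> {a..<b}"
    show "right_slope_le (\<lambda>t. (norm (z t))\<^sup>2) t (2 * Z * M)"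
    proof (rule right_slope_le_lipschitz[of "b - t"])
      fix h assume h: "0 < h" "h < b - t"
      have "(norm (z (t + h)))\<^sup>2 - (norm (z t))\<^sup>2 = (norm (z (t + h)) + norm (z t)) * (norm (z (t + h)) - norm (z t))"
        by (simp add: power2_eq_square algebra_simps)
      also have "\<dots> \<le> (norm (z (t + h)) + norm (z t)) * norm (z (t + h) - z t)"
        by (intro mult_left_mono norm_triangle_ineq2) auto
      also have "\<dots> \<le> (Z + Z) * (M * h)"
        using M[of t "t + h"] Z(2)[of t] Z(2)[of "t+h"] Z(1) h t by (intro mult_mono) auto
      finally show "(norm (z (t + h)))\<^sup>2 \<le> (norm (z t))\<^sup>2 + 2 * Z * M * h" by (simp add: algebra_simps)
    qed (use t in auto)
  next
    fix t assume t: "t \<in> {a..<b} - (N \<union> {a})"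
    then obtain D where D: "(z has_vector_derivative D) (at t)" "2 * (z t \<bullet> D) \<le> c" using d[of t] by auto
    have "((\<lambda>t. z t \<bullet> z t) has_vector_derivative (z t \<bullet> D + D \<bullet> z t)) (at t)"
      by (rule bounded_bilinear.has_vector_derivative[OF bounded_bilinear_inner D(1) D(1)])
    then have "((\<lambda>t. (norm (z t))\<^sup>2) has_real_derivative 2 * (z t \<bullet> D)) (at t)"
      by (simp add: has_real_derivative_iff_has_vector_derivative power2_norm_eq_inner inner_commute)
    then show "right_slope_le (\<lambda>t. (norm (z t))\<^sup>2) t c"
      using right_slope_le_derivative right_slope_le_mono D(2) by blast
  qed
qed

text \<open>\<open>P\<close> is the primitive of \<open>g\<close> from \<open>a\<close>, frozen
  after \<open>c\<close> by the minimum and zero before \<open>a\<close> because the interval is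
  then empty. It is thus Lipschitz on the whole line, which spares case distinctions when histories
  reach back before \<open>a\<close>.\<close>

lemma clipped_integral:
  fixes g :: "real \<Rightarrow> 'a::euclidean_space"
  assumes g: "g \<in> borel_measurable (lebesgue_on {a..c})" and M: "\<And>s. s \<in> {a..c} \<Longrightarrow> norm (g s) \<le> M"
    and ac: "a \<le> c"
  defines "P \<equiv> \<lambda>t. integral {a..min t c} g"
  shows clipped_integral_lipschitz: "norm (P t - P s) \<le> M * \<bar>t - s\<bar>"
    and clipped_integral_left: "t \<le> a \<Longrightarrow> P t = 0"
    and clipped_integral_derivative: "\<exists>N. negligible N \<and> (\<forall>t\<in>{a<..<c} - N. (P has_vector_derivative g t) (at t))"
proof -
  have M0: "0 \<le> M" using order_trans[OF norm_ge_zero M[of a]] ac by simp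
  have int: "g integrable_on {s1..s2}" if "a \<le> s1" "s2 \<le> c" for s1 s2
    by (rule bounded_measurable_integrable_on[OF g M]) (use that in auto)
  show left: "P t = 0" if "t \<le> a" for t
  proof (cases "t < a")
    case False
    then show ?thesis using that ac by (simp add: P_def min_def)
  qed (use ac in \<open>simp add: P_def\<close>)
  have step: "norm (P t - P s) \<le> M * (t - s)" if "s \<le> t" for s t
  proof -
    define s' where "s' = max a (min s c)"
    define t' where "t' = max a (min t c)"
    have st: "a \<le> s'" "s' \<le> t'" "t' \<le> c" "t' - s' \<le> t - s" using that ac by (auto simp: s'_def t'_def)
    have P': "P u = integral {a..max a (min u c)} g" for u
      using left[of u] left[of a] ac by (cases "u \<le> a") (auto simp: P_def max_def min_def)
    have "integral {a..s'} g + integral {s'..t'} g = integral {a..t'} g"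
      using st by (intro Henstock_Kurzweil_Integration.integral_combine int) auto
    then have "P t - P s = integral {s'..t'} g" using P' s'_def t'_def by (simp add: algebra_simps)
    also have "norm \<dots> \<le> integral {s'..t'} (\<lambda>_. M)"
      using st by (intro integral_norm_bound_integral int M) auto
    also have "\<dots> = M * (t' - s')" using st by simp
    also have "\<dots> \<le> M * (t - s)" using st M0 by (intro mult_left_mono) auto
    finally show ?thesis .
  qed
  show "norm (P t - P s) \<le> M * \<bar>t - s\<bar>"
    using step[of s t] step[of t s] by (cases "s \<le> t") (auto simp: norm_minus_commute)
  \<comment> \<open>Extension by zero gives a bounded measurable function on the whole line, as the
    differentiation theorem requires; inside the interval its primitive is \<open>P\<close>.\<close>
  define g' where "g' t = (if t \<in> {a..c} then g t else 0)" for t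
  have "g' \<in> borel_measurable lebesgue"
    using g borel_measurable_if[of "{a..c}" g] by (simp add: g'_def[abs_def])
  moreover have "norm (g' t) \<le> M" for t using M M0 by (simp add: g'_def)
  ultimately have "\<exists>N. negligible N \<and>
      (\<forall>t\<in>{a<..<c} - N. ((\<lambda>s. integral {a..s} g') has_vector_derivative g' t) (at t))"
    by (rule AE_indefinite_integral_has_vector_derivative[of g' M a c]) blast
  then obtain N where N: "negligible N"
    "\<And>t. t \<in> {a<..<c} - N \<Longrightarrow> ((\<lambda>s. integral {a..s} g') has_vector_derivative g' t) (at t)" by blast
  have "(P has_vector_derivative g t) (at t)" if t: "t \<in> {a<..<c} - N" for t
  proof -
    have "((\<lambda>s. integral {a..s} g') has_vector_derivative g t) (at t)"
      using N(2)[OF t] t by (simp add: g'_def)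
    then show ?thesis
    proof (rule has_vector_derivative_transform_within_open[of _ _ _ "{a<..<c}"])
      fix s assume "s \<in> {a<..<c}"
      then show "integral {a..s} g' = P s"
        unfolding P_def by (simp add: min_def) (rule Henstock_Kurzweil_Integration.integral_cong, simp add: g'_def)
    qed (use t in auto)
  qed
  then show "\<exists>N. negligible N \<and> (\<forall>t\<in>{a<..<c} - N. (P has_vector_derivative g t) (at t))" using N(1) by blast
qed

subsection \<open>Functional differential equations with Caratheodory right-hand side\<close>

declare mspace_cfunspace [simp del]

text \<open>The inputs are absorbed into \<open>F\<close>, which leaves a time dependence that is
  only measurable. Measurability is required along continuous curves, since \<open>F\<close> acts on
  a space of functions, and the one-sided condition accepts any uniform bound \<open>B\<close> in
  place of the supremum.\<close>

locale functional_ode =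
  fixes r t0 :: real and F :: "real \<Rightarrow> (real \<Rightarrow> real ^ 'n) \<Rightarrow> real ^ 'n"
  assumes r: "0 \<le> r"
    and F_bounded: "\<exists>M\<ge>0. \<forall>s\<in>{t0..T}. \<forall>\<xi>\<in>mspace (C0 r). hnorm r \<xi> \<le> K \<longrightarrow> norm (F s \<xi>) \<le> M"
    and F_continuous: "\<lbrakk>t0 \<le> s; limitin (C0_top r) X \<xi> sequentially; \<And>n. X n \<in> mspace (C0 r); \<xi> \<in> mspace (C0 r)\<rbrakk>
      \<Longrightarrow> (\<lambda>n :: nat. F s (X n)) \<longlonglongrightarrow> F s \<xi>"
    and F_one_sided: "\<exists>L\<ge>0. \<forall>s\<in>{t0..T}. \<forall>\<xi>\<in>mspace (C0 r). \<forall>\<eta>\<in>mspace (C0 r).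
      hnorm r \<xi> \<le> K \<longrightarrow> hnorm r \<eta> \<le> K \<longrightarrow>
      (\<forall>B. (\<forall>\<theta>\<in>{-r..0}. norm (\<xi> \<theta> - \<eta> \<theta>) \<le> B) \<longrightarrow> (\<xi> 0 - \<eta> 0) \<bullet> (F s \<xi> - F s \<eta>) \<le> L * B\<^sup>2)"
    and F_measurable: "continuous_on UNIV y \<Longrightarrow> (\<lambda>s. F s (Tr r s y)) \<in> borel_measurable (lebesgue_on {t0..T})"
begin

text \<open>A Lipschitz bound on [t0, b] stands in for absolute continuity: it is what the slope
  lemmas use, and solutions have it because \<open>F\<close> is bounded on bounded sets. The
  derivative is asked for in the open interval only, so that for b = t0 the initial history itself
  is a solution.\<close>

definition sol :: "real \<Rightarrow> (real \<Rightarrow> real ^ 'n) \<Rightarrow> bool" where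
  "sol b x \<longleftrightarrow> continuous_on {t0 - r..b} x \<and>
     (\<exists>M. \<forall>s t. t0 \<le> s \<and> s \<le> t \<and> t \<le> b \<longrightarrow> norm (x t - x s) \<le> M * (t - s)) \<and>
     (\<exists>N. negligible N \<and> (\<forall>t\<in>{t0<..<b} - N. (x has_vector_derivative F t (Tr r t x)) (at t)))"

lemma sol_mono:
  assumes "sol b x" "c \<le> b"
  shows "sol c x"
proof -
  have "continuous_on {t0 - r..c} x"
    using assms unfolding sol_def by (auto intro: continuous_on_subset)
  moreover obtain M where "\<forall>s t. t0 \<le> s \<and> s \<le> t \<and> t \<le> b \<longrightarrow> norm (x t - x s) \<le> M * (t - s)"
    using assms unfolding sol_def by blast
  then have "\<forall>s t. t0 \<le> s \<and> s \<le> t \<and> t \<le> c \<longrightarrow> norm (x t - x s) \<le> M * (t - s)" using assms(2) by auto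
  moreover obtain N where "negligible N" "\<forall>t\<in>{t0<..<b} - N. (x has_vector_derivative F t (Tr r t x)) (at t)"
    using assms unfolding sol_def by blast
  then have "negligible N" "\<forall>t\<in>{t0<..<c} - N. (x has_vector_derivative F t (Tr r t x)) (at t)" using assms(2) by auto
  ultimately show ?thesis unfolding sol_def by blast
qed

lemma sol_bounded:
  assumes "sol b x"
  obtains B where "B > 0" "\<And>t. t \<in> {t0 - r..b} \<Longrightarrow> norm (x t) \<le> B"
proof -
  have "bounded (x ` {t0 - r..b})"
    using assms unfolding sol_def by (intro compact_imp_bounded compact_continuous_image) auto
  then show ?thesis using that unfolding bounded_pos by blast
qed

text \<open>The one-sided condition bounds the inner product of \<open>z\<close> with its derivative
  by L S^2, where S is the maximum of |z| up to the end of the current step, histories included. On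
  steps so short that S^2 <= 2 L \<delta> S^2 with 2 L \<delta> < 1 this forces S = 0. One \<delta>
  works for all steps because both solutions stay in one ball.\<close>

lemma sol_unique:
  assumes x: "sol b x" and y: "sol b y" and init: "\<And>t. t \<in> {t0 - r..t0} \<Longrightarrow> x t = y t"
    and t: "t \<in> {t0 - r..b}"
  shows "x t = y t"
proof -
  obtain B1 where B1: "B1 > 0" "\<And>t. t \<in> {t0 - r..b} \<Longrightarrow> norm (x t) \<le> B1" by (rule sol_bounded[OF x]) blast
  obtain B2 where B2: "B2 > 0" "\<And>t. t \<in> {t0 - r..b} \<Longrightarrow> norm (y t) \<le> B2" by (rule sol_bounded[OF y]) blast
  define K where "K = max B1 B2"
  have K: "norm (x t) \<le> K" "norm (y t) \<le> K" if "t \<in> {t0 - r..b}" for t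
    using B1(2)[OF that] B2(2)[OF that] by (auto simp: K_def)
  obtain L where L: "L \<ge> 0" "\<And>s \<xi> \<eta> B. \<lbrakk>s \<in> {t0..b}; \<xi> \<in> mspace (C0 r); \<eta> \<in> mspace (C0 r);
      hnorm r \<xi> \<le> K; hnorm r \<eta> \<le> K; \<forall>\<theta>\<in>{-r..0}. norm (\<xi> \<theta> - \<eta> \<theta>) \<le> B\<rbrakk>
      \<Longrightarrow> (\<xi> 0 - \<eta> 0) \<bullet> (F s \<xi> - F s \<eta>) \<le> L * B\<^sup>2"
    using F_one_sided[of b K] by blast
  obtain Mx where Mx: "\<And>s t. \<lbrakk>t0 \<le> s; s \<le> t; t \<le> b\<rbrakk> \<Longrightarrow> norm (x t - x s) \<le> Mx * (t - s)"
    using x unfolding sol_def by blast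
  obtain My where My: "\<And>s t. \<lbrakk>t0 \<le> s; s \<le> t; t \<le> b\<rbrakk> \<Longrightarrow> norm (y t - y s) \<le> My * (t - s)"
    using y unfolding sol_def by blast
  obtain Nx where Nx: "negligible Nx" "\<And>t. t\<in>{t0<..<b} - Nx \<Longrightarrow> (x has_vector_derivative F t (Tr r t x)) (at t)"
    using x unfolding sol_def by blast
  obtain Ny where Ny: "negligible Ny" "\<And>t. t\<in>{t0<..<b} - Ny \<Longrightarrow> (y has_vector_derivative F t (Tr r t y)) (at t)"
    using y unfolding sol_def by blast
  have cx: "continuous_on {t0 - r..b} x" and cy: "continuous_on {t0 - r..b} y" using x y by (auto simp: sol_def)
  \<comment> \<open>Any positive \<delta> with 2 L \<delta> < 1 would do; the 1 in L + 1 covers L =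
    0.\<close>
  define \<delta> where "\<delta> = 1 / (4 * (L + 1))"
  have \<delta>: "\<delta> > 0" "2 * L * \<delta> < 1" using L(1) by (auto simp: \<delta>_def field_simps)
  define z where "z t = x t - y t" for t
  have eq: "\<forall>t\<in>{t0 - r..min b (t0 + real n * \<delta>)}. z t = 0" for n
  proof (induction n)
    case 0
    then show ?case using init by (auto simp: z_def)
  next
    case (Suc n)
    define a where "a = min b (t0 + real n * \<delta>)"
    define c where "c = min b (t0 + real (Suc n) * \<delta>)"
    have IH: "\<And>t. t\<in>{t0 - r..a} \<Longrightarrow> z t = 0" using Suc unfolding a_def by blast
    show ?case
    proof (cases "t0 \<le> b")
      case False
      then show ?thesis using init by (auto simp: z_def)
    next
      case True
      have ac: "a \<le> c" "c \<le> b" "t0 \<le> a" "c - a \<le> \<delta>"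
        using \<delta>(1) True by (auto simp: a_def c_def algebra_simps min_def)
      have cz: "continuous_on {t0 - r..b} z" unfolding z_def by (intro continuous_intros cx cy)
      then have "continuous_on {a..c} (\<lambda>t. norm (z t))"
        using ac r by (intro continuous_intros) (auto intro: continuous_on_subset)
      then obtain \<tau> where \<tau>: "\<tau> \<in> {a..c}" "\<And>t. t \<in> {a..c} \<Longrightarrow> norm (z t) \<le> norm (z \<tau>)"
        using continuous_attains_sup[of "{a..c}" "\<lambda>t. norm (z t)"] ac(1) by auto
      define S where "S = norm (z \<tau>)"
      have S: "norm (z t) \<le> S" if "t \<in> {t0 - r..c}" for t
        using that IH[of t] \<tau>(2)[of t] by (cases "t \<le> a") (auto simp: S_def)
      have "(norm (z \<tau>))\<^sup>2 \<le> (norm (z a))\<^sup>2 + 2 * (L * S\<^sup>2) * (\<tau> - a)"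
      proof (rule norm_sq_growth[of a \<tau> z "Mx + My" "Nx \<union> Ny"])
        show "a \<le> \<tau>" using \<tau> by simp
        show "negligible (Nx \<union> Ny)" by (rule negligible_Un[OF Nx(1) Ny(1)])
        fix s t assume st: "a \<le> s" "s \<le> t" "t \<le> \<tau>"
        have "norm (z t - z s) \<le> norm (x t - x s) + norm (y t - y s)"
          unfolding z_def using norm_triangle_ineq4[of "x t - x s" "y t - y s"] by (simp add: algebra_simps)
        also have "\<dots> \<le> Mx * (t - s) + My * (t - s)" using Mx[of s t] My[of s t] st ac \<tau>(1) by auto
        finally show "norm (z t - z s) \<le> (Mx + My) * (t - s)" by (simp add: algebra_simps)
      next
        fix t assume t: "t \<in> {a<..<\<tau>} - (Nx \<union> Ny)"
        then have t': "t \<in> {t0<..<b}" "t \<in> {a..c}" using ac \<tau>(1) by auto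
        have m: "Tr r t x \<in> mspace (C0 r)" "Tr r t y \<in> mspace (C0 r)"
          using t' by (auto intro!: Tr_mem continuous_on_subset[OF cx] continuous_on_subset[OF cy])
        have "(Tr r t x 0 - Tr r t y 0) \<bullet> (F t (Tr r t x) - F t (Tr r t y)) \<le> L * S\<^sup>2"
        proof (rule L(2)[OF _ m])
          show "hnorm r (Tr r t x) \<le> K" "hnorm r (Tr r t y) \<le> K" using t' by (auto intro!: hnorm_Tr_le r K)
          show "\<forall>\<theta>\<in>{- r..0}. norm (Tr r t x \<theta> - Tr r t y \<theta>) \<le> S"
            using S t' ac by (auto simp: Tr_apply z_def[symmetric])
        qed (use t' in auto)
        then have "2 * (z t \<bullet> (F t (Tr r t x) - F t (Tr r t y))) \<le> 2 * (L * S\<^sup>2)"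
          using r by (simp add: Tr_apply z_def)
        moreover have "(z has_vector_derivative F t (Tr r t x) - F t (Tr r t y)) (at t)"
          unfolding z_def using t t' by (intro has_vector_derivative_diff Nx(2) Ny(2)) auto
        ultimately show "\<exists>D. (z has_vector_derivative D) (at t) \<and> 2 * (z t \<bullet> D) \<le> 2 * (L * S\<^sup>2)" by blast
      qed
      also have "norm (z a) = 0" using IH[of a] ac r by simp
      also have "2 * (L * S\<^sup>2) * (\<tau> - a) \<le> 2 * (L * S\<^sup>2) * \<delta>"
        using \<tau>(1) ac L(1) by (intro mult_left_mono) auto
      finally have "S\<^sup>2 \<le> (2 * L * \<delta>) * S\<^sup>2" by (simp add: S_def algebra_simps)
      then have "S\<^sup>2 = 0" using \<delta>(2) zero_le_power2[of S] by (meson mult_le_cancel_right1 not_le order.antisym)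
      then show ?thesis using S unfolding c_def[symmetric] by simp
    qed
  qed
  obtain n where "(b - t0) / \<delta> < real n" using reals_Archimedean2 by blast
  then have "b \<le> t0 + real n * \<delta>" using \<delta>(1) by (simp add: field_simps)
  then show ?thesis using eq[of n] t by (simp add: z_def)
qed

section \<open>Local existence from equations with an additional delay\<close>

lemma F_Tr_measurable:
  assumes y: "continuous_on UNIV y" and ab: "t0 \<le> a"
  shows "(\<lambda>s. F s (Tr r (s - h) y)) \<in> borel_measurable (lebesgue_on {a..c})"
proof -
  have "continuous_on UNIV (\<lambda>t. y (t - h))"
    using continuous_on_compose2[OF y, of UNIV "\<lambda>t. t - h"] by (simp add: continuous_on_diff)
  then have "(\<lambda>s. F s (Tr r s (\<lambda>t. y (t - h)))) \<in> borel_measurable (lebesgue_on {t0..c})"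
    by (rule F_measurable)
  moreover have "Tr r s (\<lambda>t. y (t - h)) = Tr r (s - h) y" for s
    by (auto simp: Tr_def algebra_simps intro!: restrict_ext)
  ultimately have "(\<lambda>s. F s (Tr r (s - h) y)) \<in> borel_measurable (lebesgue_on {t0..c})" by simp
  then show ?thesis by (rule measurable_restrict_mono) (use ab in auto)
qed

text \<open>Method of steps: with delay \<open>h\<close> the right-hand side at \<open>s\<close>
  reads \<open>y\<close> only up to s - h, so each iteration of \<open>G\<close> fixes the solution
  on a further stretch of length \<open>h\<close>, and finitely many iterations are exact up to
  \<open>c\<close>. The condition M (c - a) <= 1 keeps every iterate within B + 1, where the bound
  \<open>M\<close> on \<open>F\<close> is valid.\<close>

lemma delayed_solution:
  assumes z: "continuous_on UNIV z" "\<And>t. norm (z t) \<le> B" "\<And>t. t \<ge> a \<Longrightarrow> z t = z a"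
    and M: "\<And>s \<xi>. \<lbrakk>s \<in> {t0..c}; \<xi> \<in> mspace (C0 r); hnorm r \<xi> \<le> B + 1\<rbrakk> \<Longrightarrow> norm (F s \<xi>) \<le> M"
    and ac: "t0 \<le> a" "a \<le> c" "M * (c - a) \<le> 1" and h: "h > 0"
  obtains y where "continuous_on UNIV y" "\<And>t. norm (y t) \<le> B + 1"
    "\<And>t. y t = z t + integral {a..min t c} (\<lambda>s. F s (Tr r (s - h) y))"
proof -
  define G where "G y = (\<lambda>t. z t + integral {a..min t c} (\<lambda>s. F s (Tr r (s - h) y)))" for y
  define Y where "Y n = (G ^^ n) z" for n
  have Y0: "Y 0 = z" and YS: "Y (Suc n) = G (Y n)" for n by (auto simp: Y_def)
  have G: "continuous_on UNIV (G y) \<and> (\<forall>t. norm (G y t) \<le> B + 1)"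
    if y: "continuous_on UNIV y" "\<And>t. norm (y t) \<le> B + 1" for y
  proof -
    let ?g = "\<lambda>s. F s (Tr r (s - h) y)"
    let ?P = "\<lambda>t. integral {a..min t c} ?g"
    have g: "?g \<in> borel_measurable (lebesgue_on {a..c})" by (rule F_Tr_measurable[OF y(1) ac(1)])
    have bd: "norm (?g s) \<le> M" if "s \<in> {a..c}" for s
      using that ac by (intro M Tr_mem hnorm_Tr_le r y(2)) (auto intro: continuous_on_subset[OF y(1)])
    have M0: "0 \<le> M" using order_trans[OF norm_ge_zero bd[of a]] ac by simp
    have lip: "norm (?P t - ?P s) \<le> M * \<bar>t - s\<bar>" for s t by (rule clipped_integral_lipschitz[OF g bd ac(2)])
    have left: "?P t = 0" if "t \<le> a" for t by (rule clipped_integral_left[OF g bd ac(2) that])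
    have "continuous_on UNIV ?P"
    proof (rule continuous_onI)
      fix x e :: real assume e: "e > 0"
      show "\<exists>d>0. \<forall>x'\<in>UNIV. dist x' x < d \<longrightarrow> dist (?P x') (?P x) \<le> e"
      proof (intro exI conjI ballI impI)
        show "e / (M + 1) > 0" using e M0 by simp
        fix x' assume "dist x' x < e / (M + 1)"
        then have "\<bar>x' - x\<bar> * (M + 1) < e" using M0 by (simp add: dist_real_def pos_less_divide_eq)
        moreover have "M * \<bar>x' - x\<bar> \<le> \<bar>x' - x\<bar> * (M + 1)" by (simp add: algebra_simps)
        ultimately show "dist (?P x') (?P x) \<le> e" using lip[of x' x] by (simp add: dist_norm)
      qed
    qed
    then have "continuous_on UNIV (G y)" unfolding G_def by (intro continuous_intros z(1))
    moreover have "norm (G y t) \<le> B + 1" for t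
    proof -
      have "norm (?P t) \<le> 1"
      proof (cases "t \<le> a")
        case False
        have "?P t = ?P (min t c)" by simp
        then have "norm (?P t) \<le> M * \<bar>min t c - a\<bar>" using lip[of "min t c" a] left[of a] by simp
        also have "\<dots> \<le> M * (c - a)" using False ac M0 by (intro mult_left_mono) auto
        finally show ?thesis using ac by simp
      qed (use left in simp)
      then show ?thesis unfolding G_def using z(2)[of t] norm_triangle_ineq[of "z t" "?P t"] by linarith
    qed
    ultimately show ?thesis by blast
  qed
  have Y: "continuous_on UNIV (Y n) \<and> (\<forall>t. norm (Y n t) \<le> B + 1)" for n
  proof (induction n)
    case 0 then show ?case using z(1,2) by (auto simp: Y0 intro!: order_trans[OF z(2)])
  next
    case (Suc n) then show ?case unfolding YS using G by blast
  qed
  have stable: "Y (Suc n) t = Y n t" if "t \<le> a + real n * h" for n t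
    using that
  proof (induction n arbitrary: t)
    case 0
    then have "integral {a..min t c} (\<lambda>s. F s (Tr r (s - h) (Y 0))) = 0"
    proof (cases "t = a")
      case True
      then have "min t c = a" using ac by simp
      then show ?thesis by simp
    next
      case False
      then have "{a..min t c} = {}" using 0 by auto
      then show ?thesis by simp
    qed
    then show ?case unfolding YS by (simp add: G_def Y0)
  next
    case (Suc n)
    have "integral {a..min t c} (\<lambda>s. F s (Tr r (s - h) (Y (Suc n)))) = integral {a..min t c} (\<lambda>s. F s (Tr r (s - h) (Y n)))"
    proof (rule Henstock_Kurzweil_Integration.integral_cong)
      fix s assume s: "s \<in> {a..min t c}"
      have "Tr r (s - h) (Y (Suc n)) = Tr r (s - h) (Y n)"
      proof (rule Tr_cong)
        fix s' assume "s' \<in> {s - h - r..s - h}"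
        then show "Y (Suc n) s' = Y n s'" using s Suc(2) by (intro Suc(1)) (auto simp: algebra_simps)
      qed
      then show "F s (Tr r (s - h) (Y (Suc n))) = F s (Tr r (s - h) (Y n))" by simp
    qed
    then show ?case unfolding YS[of "Suc n"] unfolding G_def[of "Y (Suc n)"] by (simp only: YS[of n] G_def)
  qed
  obtain n where "(c - a) / h < real n" using reals_Archimedean2 by blast
  then have n: "c \<le> a + real n * h" using h by (simp add: field_simps)
  have "Y (Suc n) t = Y n t" for t
  proof (cases "t \<le> c")
    case True then show ?thesis using n by (intro stable) auto
  next
    case False
    \<comment> \<open>Beyond \<open>c\<close> every iterate is constant, \<open>z\<close> by
      assumption and the integral by clipping.\<close>
    have const: "Y m t = Y m c" for m
      using False z(3)[of t] z(3)[of c] ac by (cases m) (auto simp: Y0 YS G_def min_def)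
    show ?thesis using stable[of c n] n const by simp
  qed
  then have "Y n t = z t + integral {a..min t c} (\<lambda>s. F s (Tr r (s - h) (Y n)))" for t
    unfolding YS G_def by metis
  then show ?thesis using that[of "Y n"] Y by blast
qed

end

lemma mult_half_divide: "k \<noteq> 0 \<Longrightarrow> k * (e / (2 * k)) = e / (2 :: real)"
  by simp

context functional_ode
begin

text \<open>The one-sided condition applies to the delayed difference y1(t - h1) - y2(t - h2),
  whereas the derivative of |w|^2 pairs the right-hand sides with w(t) itself. The two differ by at
  most 2 e, at a cost of 2 e times 2 M. The remaining quadratic term in S = max |w| is absorbed on
  the left because 8 L (c - a) <= 1.\<close>

lemma delayed_solutions_close:
  assumes ac: "t0 \<le> a" "a \<le> c" "c - a \<le> 1"
    and M: "\<And>s \<xi>. \<lbrakk>s \<in> {t0..c}; \<xi> \<in> mspace (C0 r); hnorm r \<xi> \<le> K\<rbrakk> \<Longrightarrow> norm (F s \<xi>) \<le> M"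
    and L: "L \<ge> 0" "8 * L * (c - a) \<le> 1" "\<And>s \<xi> \<eta> B. \<lbrakk>s \<in> {t0..c}; \<xi> \<in> mspace (C0 r); \<eta> \<in> mspace (C0 r);
      hnorm r \<xi> \<le> K; hnorm r \<eta> \<le> K; \<forall>\<theta>\<in>{-r..0}. norm (\<xi> \<theta> - \<eta> \<theta>) \<le> B\<rbrakk>
      \<Longrightarrow> (\<xi> 0 - \<eta> 0) \<bullet> (F s \<xi> - F s \<eta>) \<le> L * B\<^sup>2"
    and z: "\<And>t. t \<ge> a \<Longrightarrow> z t = z a"
    and y1: "continuous_on UNIV y1" "\<And>t. norm (y1 t) \<le> K"
      "\<And>t. y1 t = z t + integral {a..min t c} (\<lambda>s. F s (Tr r (s - h1) y1))"
    and y2: "continuous_on UNIV y2" "\<And>t. norm (y2 t) \<le> K"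
      "\<And>t. y2 t = z t + integral {a..min t c} (\<lambda>s. F s (Tr r (s - h2) y2))"
    and e: "0 \<le> e" "\<And>t. norm (y1 t - y1 (t - h1)) \<le> e" "\<And>t. norm (y2 t - y2 (t - h2)) \<le> e"
  shows "(norm (y1 t - y2 t))\<^sup>2 \<le> 32 * L * e\<^sup>2 + 16 * M * e"
proof -
  define g1 where "g1 s = F s (Tr r (s - h1) y1)" for s
  define g2 where "g2 s = F s (Tr r (s - h2) y2)" for s
  have mem: "Tr r s y1 \<in> mspace (C0 r)" "Tr r s y2 \<in> mspace (C0 r)" for s
    using y1(1) y2(1) by (auto intro!: Tr_mem intro: continuous_on_subset)
  have hn: "hnorm r (Tr r s y1) \<le> K" "hnorm r (Tr r s y2) \<le> K" for s
    by (auto intro!: hnorm_Tr_le r y1(2) y2(2))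
  have gm: "g1 \<in> borel_measurable (lebesgue_on {a..c})" "g2 \<in> borel_measurable (lebesgue_on {a..c})"
    unfolding g1_def g2_def by (intro F_Tr_measurable y1(1) y2(1) ac(1))+
  have gM: "norm (g1 s) \<le> M" "norm (g2 s) \<le> M" if "s \<in> {a..c}" for s
    unfolding g1_def g2_def using that ac by (intro M mem hn; simp)+
  have M0: "0 \<le> M" using order_trans[OF norm_ge_zero gM(1)[of a]] ac by simp
  let ?P = "\<lambda>g t. integral {a..min t c} g"
  obtain N1 where N1: "negligible N1" "\<And>t. t\<in>{a<..<c} - N1 \<Longrightarrow> (?P g1 has_vector_derivative g1 t) (at t)"
    using clipped_integral_derivative[OF gm(1) gM(1) ac(2)] by blast
  obtain N2 where N2: "negligible N2" "\<And>t. t\<in>{a<..<c} - N2 \<Longrightarrow> (?P g2 has_vector_derivative g2 t) (at t)"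
    using clipped_integral_derivative[OF gm(2) gM(2) ac(2)] by blast
  define w where "w t = y1 t - y2 t" for t
  have w: "w t = ?P g1 t - ?P g2 t" for t
    unfolding w_def g1_def g2_def using y1(3)[of t] y2(3)[of t] by simp
  have w_left: "w t = 0" if "t \<le> a" for t
    unfolding w using clipped_integral_left[OF gm(1) gM(1) ac(2) that] clipped_integral_left[OF gm(2) gM(2) ac(2) that] by simp
  have w_right: "w t = w c" if "t \<ge> c" for t unfolding w using that by (simp add: min_def)
  have w_lip: "norm (w t - w s) \<le> (2 * M) * (t - s)" if "s \<le> t" for s t
  proof -
    have "norm (w t - w s) \<le> norm (?P g1 t - ?P g1 s) + norm (?P g2 t - ?P g2 s)"
      unfolding w using norm_triangle_ineq4[of "?P g1 t - ?P g1 s" "?P g2 t - ?P g2 s"] by (simp add: algebra_simps)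
    also have "\<dots> \<le> M * \<bar>t - s\<bar> + M * \<bar>t - s\<bar>"
      by (intro add_mono clipped_integral_lipschitz gm gM ac)
    finally show ?thesis using that by simp
  qed
  have "continuous_on {a..c} (\<lambda>t. norm (w t))"
    unfolding w_def by (intro continuous_intros continuous_on_subset[OF y1(1)] continuous_on_subset[OF y2(1)]) auto
  then obtain \<tau> where \<tau>: "\<tau> \<in> {a..c}" "\<And>t. t \<in> {a..c} \<Longrightarrow> norm (w t) \<le> norm (w \<tau>)"
    using continuous_attains_sup[of "{a..c}" "\<lambda>t. norm (w t)"] ac(2) by auto
  define S where "S = norm (w \<tau>)"
  have S0: "S \<ge> 0" by (simp add: S_def)
  have S: "norm (w t) \<le> S" for t
    using w_left[of t] w_right[of t] \<tau>(2)[of t] \<tau>(2)[of c] ac(2)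
    by (cases "t \<le> a"; cases "t \<ge> c") (auto simp: S_def)
  define Q where "Q = L * (S + 2 * e)\<^sup>2 + 2 * e * (2 * M)"
  have Q0: "Q \<ge> 0" using L(1) e(1) M0 by (simp add: Q_def)
  have "(norm (w \<tau>))\<^sup>2 \<le> (norm (w a))\<^sup>2 + 2 * Q * (\<tau> - a)"
  proof (rule norm_sq_growth[of a \<tau> w "2 * M" "N1 \<union> N2"])
    show "a \<le> \<tau>" using \<tau> by simp
    show "negligible (N1 \<union> N2)" by (rule negligible_Un[OF N1(1) N2(1)])
    show "norm (w t - w s) \<le> 2 * M * (t - s)" if "s \<le> t" for s t by (rule w_lip[OF that])
    fix t assume t: "t \<in> {a<..<\<tau>} - (N1 \<union> N2)"
    then have t': "t \<in> {a<..<c} - N1" "t \<in> {a<..<c} - N2" "t \<in> {t0..c}" "t \<in> {a..c}" using \<tau>(1) ac by auto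
    have wd: "(w has_vector_derivative g1 t - g2 t) (at t)"
      unfolding w[abs_def] by (intro has_vector_derivative_diff N1(2) N2(2) t')
    let ?\<xi> = "Tr r (t - h1) y1" let ?\<eta> = "Tr r (t - h2) y2"
    have near: "norm (w s - (y1 (s - h1) - y2 (s - h2))) \<le> 2 * e" for s
    proof -
      have eq: "w s - (y1 (s - h1) - y2 (s - h2)) = (y1 s - y1 (s - h1)) - (y2 s - y2 (s - h2))"
        by (simp add: w_def)
      show ?thesis unfolding eq
        using norm_triangle_ineq4[of "y1 s - y1 (s - h1)" "y2 s - y2 (s - h2)"] e(2,3)[of s] by linarith
    qed
    have diff: "norm (y1 (s - h1) - y2 (s - h2)) \<le> S + 2 * e" for s
      using near[of s] S[of s] norm_triangle_ineq2[of "y1 (s - h1) - y2 (s - h2)" "w s"]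
      by (simp add: norm_minus_commute)
    have "\<forall>\<theta>\<in>{-r..0}. norm (?\<xi> \<theta> - ?\<eta> \<theta>) \<le> S + 2 * e"
    proof
      fix \<theta> assume "\<theta> \<in> {-r..0}"
      then show "norm (?\<xi> \<theta> - ?\<eta> \<theta>) \<le> S + 2 * e" using diff[of "t + \<theta>"] by (simp add: Tr_apply algebra_simps)
    qed
    then have "(?\<xi> 0 - ?\<eta> 0) \<bullet> (g1 t - g2 t) \<le> L * (S + 2 * e)\<^sup>2"
      unfolding g1_def g2_def by (intro L(3) t' mem hn)
    then have 1: "(y1 (t - h1) - y2 (t - h2)) \<bullet> (g1 t - g2 t) \<le> L * (S + 2 * e)\<^sup>2"
      using r by (simp add: Tr_apply)
    have "(w t - (y1 (t - h1) - y2 (t - h2))) \<bullet> (g1 t - g2 t) \<le> norm (w t - (y1 (t - h1) - y2 (t - h2))) * norm (g1 t - g2 t)"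
      by (rule norm_cauchy_schwarz)
    also have "\<dots> \<le> (2 * e) * (2 * M)"
      using near[of t] e(1) gM[OF t'(4)] norm_triangle_ineq4[of "g1 t" "g2 t"] by (intro mult_mono) auto
    finally have "w t \<bullet> (g1 t - g2 t) \<le> Q" using 1 unfolding Q_def by (simp add: inner_diff_left)
    then show "\<exists>D. (w has_vector_derivative D) (at t) \<and> 2 * (w t \<bullet> D) \<le> 2 * Q" using wd by auto
  qed
  also have "norm (w a) = 0" using w_left[of a] by simp
  also have "2 * Q * (\<tau> - a) \<le> 2 * Q * (c - a)" using \<tau>(1) Q0 by (intro mult_left_mono) auto
  finally have "S\<^sup>2 \<le> 2 * Q * (c - a)" by (simp add: S_def)
  \<comment> \<open>By (S + 2 e)^2 <= 2 S^2 + 8 e^2 the coefficient of S^2 becomes 4 L (c - a) <=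
    1/2; moving that half to the left doubles the rest, whence the constants 32 and 16.\<close>
  also have "\<dots> \<le> 2 * (c - a) * (L * (2 * S\<^sup>2 + 8 * e\<^sup>2) + 4 * e * M)"
  proof -
    have "(S + 2 * e)\<^sup>2 \<le> 2 * S\<^sup>2 + 8 * e\<^sup>2"
      using zero_le_power2[of "S - 2 * e"] by (simp add: power2_eq_square algebra_simps)
    then have "Q \<le> L * (2 * S\<^sup>2 + 8 * e\<^sup>2) + 4 * e * M"
      unfolding Q_def using L(1) by (intro add_mono mult_left_mono) auto
    then have "2 * (c - a) * Q \<le> 2 * (c - a) * (L * (2 * S\<^sup>2 + 8 * e\<^sup>2) + 4 * e * M)"
      using ac by (intro mult_left_mono) auto
    then show ?thesis by (simp only: mult.commute mult.left_commute)
  qed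
  also have "\<dots> = (8 * L * (c - a)) * (S\<^sup>2 / 2) + (c - a) * (16 * L * e\<^sup>2 + 8 * e * M)"
    by (simp add: algebra_simps)
  also have "\<dots> \<le> 1 * (S\<^sup>2 / 2) + 1 * (16 * L * e\<^sup>2 + 8 * e * M)"
    using L(1,2) ac e(1) M0 by (intro add_mono mult_right_mono) auto
  finally have "S\<^sup>2 \<le> 32 * L * e\<^sup>2 + 16 * M * e" by (simp add: algebra_simps)
  moreover have "(norm (w t))\<^sup>2 \<le> S\<^sup>2" using S[of t] by (intro power_mono) auto
  ultimately show ?thesis by (simp add: w_def)
qed

text \<open>The solutions for delays 1/(n+1) are equicontinuous, so their oscillation over one delay
  tends to 0 and the preceding estimate makes them uniformly Cauchy. \<open>F\<close> is one-sided
  Lipschitz but not Lipschitz in norm, so the limit is taken under the integral by continuity in the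
  history and dominated convergence.\<close>

lemma integral_equation_solvable:
  assumes z: "continuous_on UNIV z" "\<And>t. norm (z t) \<le> B" "\<And>t. t \<ge> a \<Longrightarrow> z t = z a"
    and zu: "\<And>e. e > 0 \<Longrightarrow> \<exists>d>0. \<forall>s t. \<bar>s - t\<bar> < d \<longrightarrow> norm (z s - z t) \<le> e"
    and M: "\<And>s \<xi>. \<lbrakk>s \<in> {t0..c}; \<xi> \<in> mspace (C0 r); hnorm r \<xi> \<le> B + 1\<rbrakk> \<Longrightarrow> norm (F s \<xi>) \<le> M"
    and L: "L \<ge> 0" "8 * L * (c - a) \<le> 1" "\<And>s \<xi> \<eta> B'. \<lbrakk>s \<in> {t0..c}; \<xi> \<in> mspace (C0 r); \<eta> \<in> mspace (C0 r);
      hnorm r \<xi> \<le> B + 1; hnorm r \<eta> \<le> B + 1; \<forall>\<theta>\<in>{-r..0}. norm (\<xi> \<theta> - \<eta> \<theta>) \<le> B'\<rbrakk>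
      \<Longrightarrow> (\<xi> 0 - \<eta> 0) \<bullet> (F s \<xi> - F s \<eta>) \<le> L * B'\<^sup>2"
    and ac: "t0 \<le> a" "a \<le> c" "M * (c - a) \<le> 1" "c - a \<le> 1"
  obtains y where "continuous_on UNIV y" "\<And>t. norm (y t) \<le> B + 1"
    "\<And>t. y t = z t + integral {a..min t c} (\<lambda>s. F s (Tr r s y))"
proof -
  define h where "h n = 1 / (real n + 1)" for n :: nat
  have hpos: "h n > 0" for n by (simp add: h_def)
  have h0: "h \<longlonglongrightarrow> 0" unfolding h_def using LIMSEQ_inverse_real_of_nat by (simp add: inverse_eq_divide add.commute)
  have "\<exists>y. continuous_on UNIV y \<and> (\<forall>t. norm (y t) \<le> B + 1) \<and>
      (\<forall>t. y t = z t + integral {a..min t c} (\<lambda>s. F s (Tr r (s - h n) y)))" for n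
    by (rule delayed_solution[OF z M ac(1-3) hpos[of n]]) blast+
  then have "\<forall>n. \<exists>y. continuous_on UNIV y \<and> (\<forall>t. norm (y t) \<le> B + 1) \<and>
      (\<forall>t. y t = z t + integral {a..min t c} (\<lambda>s. F s (Tr r (s - h n) y)))" ..
  from choice[OF this] obtain Y where Y: "\<And>n. continuous_on UNIV (Y n)" "\<And>n t. norm (Y n t) \<le> B + 1"
    "\<And>n t. Y n t = z t + integral {a..min t c} (\<lambda>s. F s (Tr r (s - h n) (Y n)))"
    by blast
  define g where "g n s = F s (Tr r (s - h n) (Y n))" for n s
  have gm: "g n \<in> borel_measurable (lebesgue_on {a..c})" for n
    unfolding g_def by (intro F_Tr_measurable Y(1) ac(1))
  have mem: "Tr r s (Y n) \<in> mspace (C0 r)" for n s by (intro Tr_mem continuous_on_subset[OF Y(1)]) simp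
  have gM: "norm (g n s) \<le> M" if "s \<in> {a..c}" for n s
    unfolding g_def using that ac by (intro M mem hnorm_Tr_le r Y(2)) auto
  have M0: "0 \<le> M" using order_trans[OF norm_ge_zero gM[of a 0]] ac by simp
  have equi: "\<exists>d>0. \<forall>n s t. \<bar>s - t\<bar> < d \<longrightarrow> norm (Y n s - Y n t) \<le> e" if e: "e > 0" for e
  proof -
    obtain d where d: "d > 0" "\<And>s t. \<bar>s - t\<bar> < d \<Longrightarrow> norm (z s - z t) \<le> e / 2" using zu[of "e/2"] e by auto
    have "norm (Y n s - Y n t) \<le> e" if st: "\<bar>s - t\<bar> < min d (e / (2 * (M + 1)))" for n s t
    proof -
      have "Y n s - Y n t = (z s - z t) + (integral {a..min s c} (g n) - integral {a..min t c} (g n))"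
        using Y(3)[of n s] Y(3)[of n t] unfolding g_def by simp
      then have "norm (Y n s - Y n t) \<le> norm (z s - z t) + norm (integral {a..min s c} (g n) - integral {a..min t c} (g n))"
        using norm_triangle_ineq by metis
      also have "\<dots> \<le> e / 2 + M * \<bar>s - t\<bar>"
        using d(2)[of s t] st clipped_integral_lipschitz[OF gm[of n] gM ac(2), of s t] by auto
      also have "M * \<bar>s - t\<bar> \<le> e / 2"
      proof -
        have "M * \<bar>s - t\<bar> \<le> (M + 1) * \<bar>s - t\<bar>" by (intro mult_right_mono) auto
        also have "\<dots> \<le> (M + 1) * (e / (2 * (M + 1)))" using st M0 by (intro mult_left_mono) auto
        also have "\<dots> = e / 2"
        proof -
          have "M + 1 \<noteq> 0" using M0 by simp
          then show ?thesis by (rule mult_half_divide)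
        qed
        finally show ?thesis .
      qed
      finally show ?thesis by simp
    qed
    then show ?thesis using d(1) e M0 by (intro exI[of _ "min d (e / (2 * (M + 1)))"]) auto
  qed
  have "uniformly_convergent_on UNIV Y"
    unfolding uniformly_convergent_eq_Cauchy uniformly_Cauchy_on_def
  proof (intro allI impI)
    fix \<epsilon> :: real assume \<epsilon>: "\<epsilon> > 0"
    \<comment> \<open>Since e <= 1, the bound 32 L e^2 + 16 M e is at most (32 L + 16 M + 1) e <=
      \<epsilon>^2 / 2; the 1 keeps the denominator positive.\<close>
    define e where "e = min 1 (\<epsilon>\<^sup>2 / (2 * (32 * L + 16 * M + 1)))"
    have e: "e > 0" "e \<le> 1" using \<epsilon> L(1) M0 by (auto simp: e_def)
    have "(32 * L + 16 * M + 1) * e \<le> (32 * L + 16 * M + 1) * (\<epsilon>\<^sup>2 / (2 * (32 * L + 16 * M + 1)))"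
      using L(1) M0 by (intro mult_left_mono) (auto simp: e_def)
    also have "\<dots> = \<epsilon>\<^sup>2 / 2"
    proof -
      have "32 * L + 16 * M + 1 \<noteq> 0" using L(1) M0 by simp
      then show ?thesis by (rule mult_half_divide)
    qed
    also have "\<dots> < \<epsilon>\<^sup>2" using \<epsilon> by simp
    finally have e2: "(32 * L + 16 * M + 1) * e < \<epsilon>\<^sup>2" .
    obtain d where d: "d > 0" "\<And>n s t. \<bar>s - t\<bar> < d \<Longrightarrow> norm (Y n s - Y n t) \<le> e" using equi[OF e(1)] by blast
    have "\<forall>\<^sub>F n in sequentially. h n < d" using order_tendstoD(2)[OF h0 d(1)] .
    then obtain n0 where n0: "\<And>n. n \<ge> n0 \<Longrightarrow> h n < d" unfolding eventually_sequentially by blast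
    have "dist (Y m t) (Y n t) < \<epsilon>" if mn: "m \<ge> n0" "n \<ge> n0" for m n t
    proof -
      have "(norm (Y m t - Y n t))\<^sup>2 \<le> 32 * L * e\<^sup>2 + 16 * M * e"
      proof (rule delayed_solutions_close[OF ac(1,2,4) M L z(3) Y(1) Y(2) Y(3) Y(1) Y(2) Y(3)])
        show "norm (Y m t - Y m (t - h m)) \<le> e" for t using d(2)[of t "t - h m" m] n0[OF mn(1)] hpos[of m] by simp
        show "norm (Y n t - Y n (t - h n)) \<le> e" for t using d(2)[of t "t - h n" n] n0[OF mn(2)] hpos[of n] by simp
      qed (use e in auto)
      also have "\<dots> \<le> (32 * L + 16 * M + 1) * e"
      proof -
        have "e\<^sup>2 \<le> e" using e by (simp add: power2_eq_square mult_left_le)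
        then have "32 * L * e\<^sup>2 \<le> 32 * L * e" using L(1) by (intro mult_left_mono) auto
        then show ?thesis using e by (simp add: algebra_simps)
      qed
      also have "\<dots> < \<epsilon>\<^sup>2" by (rule e2)
      finally show ?thesis using \<epsilon> by (simp add: dist_norm power2_less_imp_less)
    qed
    then show "\<exists>M. \<forall>x\<in>UNIV. \<forall>m\<ge>M. \<forall>n\<ge>M. dist (Y m x) (Y n x) < \<epsilon>" by blast
  qed
  then obtain y where yl: "uniform_limit UNIV Y y sequentially" unfolding uniformly_convergent_on_def by blast
  have yc: "continuous_on UNIV y"
    by (rule uniform_limit_theorem[OF _ yl]) (simp_all add: Y(1))
  have ypt: "(\<lambda>n. Y n t) \<longlonglongrightarrow> y t" for t by (rule tendsto_uniform_limitI[OF yl]) simp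
  have yB: "norm (y t) \<le> B + 1" for t
    by (rule Lim_bounded[OF tendsto_norm[OF ypt], of 0]) (simp add: Y(2))
  have memy: "Tr r s y \<in> mspace (C0 r)" for s by (intro Tr_mem continuous_on_subset[OF yc]) simp
  have gl: "(\<lambda>n. g n s) \<longlonglongrightarrow> F s (Tr r s y)" if s: "s \<in> {a..c}" for s
    unfolding g_def
  proof (rule F_continuous[OF _ _ mem memy])
    show "t0 \<le> s" using s ac by auto
    \<comment> \<open>Two sources of error: the shift by \<open>h n\<close>, controlled by
      equicontinuity, and the distance of \<open>Y n\<close> from \<open>y\<close>, controlled by
      uniform convergence.\<close>
    show "limitin (C0_top r) (\<lambda>n. Tr r (s - h n) (Y n)) (Tr r s y) sequentially"
    proof (rule limitin_C0I[OF r mem memy])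
      fix e :: real assume e: "e > 0"
      obtain d where d: "d > 0" "\<And>n s t. \<bar>s - t\<bar> < d \<Longrightarrow> norm (Y n s - Y n t) \<le> e/2" using equi[of "e/2"] e by auto
      have "\<forall>\<^sub>F n in sequentially. h n < d" using order_tendstoD(2)[OF h0 d(1)] .
      moreover have "\<forall>\<^sub>F n in sequentially. \<forall>t\<in>UNIV. dist (Y n t) (y t) < e/2"
        using uniform_limitD[OF yl, of "e/2"] e by simp
      ultimately show "\<forall>\<^sub>F n in sequentially. \<forall>\<theta>\<in>{- r..0}. norm (Tr r (s - h n) (Y n) \<theta> - Tr r s y \<theta>) \<le> e"
      proof eventually_elim
        case (elim n)
        have "norm (Y n (s - h n + \<theta>) - y (s + \<theta>)) \<le> e" for \<theta>
        proof -
          have "norm (Y n (s - h n + \<theta>) - Y n (s + \<theta>)) \<le> e/2" using hpos[of n] elim(1) by (intro d(2)) auto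
          moreover have "norm (Y n (s + \<theta>) - y (s + \<theta>)) < e/2" using elim(2) by (simp add: dist_norm)
          ultimately show ?thesis
            using norm_triangle_ineq[of "Y n (s - h n + \<theta>) - Y n (s + \<theta>)" "Y n (s + \<theta>) - y (s + \<theta>)"] by simp
        qed
        then show ?case by (simp add: Tr_apply)
      qed
    qed
  qed
  have "y t = z t + integral {a..min t c} (\<lambda>s. F s (Tr r s y))" for t
  proof -
    have "(\<lambda>n. integral {a..min t c} (g n)) \<longlonglongrightarrow> integral {a..min t c} (\<lambda>s. F s (Tr r s y))"
    proof (rule dominated_convergence(2))
      show "g n integrable_on {a..min t c}" for n
        by (rule bounded_measurable_integrable_on[OF gm gM]) auto
      show "(\<lambda>_. M) integrable_on {a..min t c}" by (rule integrable_const_ivl)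
      show "norm (g n s) \<le> M" if "s \<in> {a..min t c}" for n s using that by (intro gM) auto
      show "(\<lambda>n. g n s) \<longlonglongrightarrow> F s (Tr r s y)" if "s \<in> {a..min t c}" for s using that by (intro gl) auto
    qed
    then have "(\<lambda>n. z t + integral {a..min t c} (g n)) \<longlonglongrightarrow> z t + integral {a..min t c} (\<lambda>s. F s (Tr r s y))"
      by (intro tendsto_intros)
    then have "(\<lambda>n. Y n t) \<longlonglongrightarrow> z t + integral {a..min t c} (\<lambda>s. F s (Tr r s y))"
      unfolding g_def using Y(3)[of _ t] by simp
    then show ?thesis using ypt LIMSEQ_unique by blast
  qed
  then show ?thesis using that yc yB by blast
qed

end

section \<open>Continuation and global existence\<close>

context functional_ode
begin

text \<open>The admissible step length depends only on \<open>M\<close> and \<open>L\<close> for the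
  radius B + 1, not on the solution to be continued. This is what makes an a priori bound sufficient
  for existence on a given interval.\<close>

lemma sol_extend:
  assumes x: "sol a x" and xB: "\<And>t. t \<in> {t0 - r..a} \<Longrightarrow> norm (x t) \<le> B" and B: "0 \<le> B"
    and M: "\<And>s \<xi>. \<lbrakk>s \<in> {t0..c}; \<xi> \<in> mspace (C0 r); hnorm r \<xi> \<le> B + 1\<rbrakk> \<Longrightarrow> norm (F s \<xi>) \<le> M"
    and L: "L \<ge> 0" "8 * L * (c - a) \<le> 1" "\<And>s \<xi> \<eta> B'. \<lbrakk>s \<in> {t0..c}; \<xi> \<in> mspace (C0 r); \<eta> \<in> mspace (C0 r);
      hnorm r \<xi> \<le> B + 1; hnorm r \<eta> \<le> B + 1; \<forall>\<theta>\<in>{-r..0}. norm (\<xi> \<theta> - \<eta> \<theta>) \<le> B'\<rbrakk>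
      \<Longrightarrow> (\<xi> 0 - \<eta> 0) \<bullet> (F s \<xi> - F s \<eta>) \<le> L * B'\<^sup>2"
    and ac: "t0 \<le> a" "a \<le> c" "M * (c - a) \<le> 1" "c - a \<le> 1"
  obtains y where "sol c y" "\<And>t. t \<in> {t0 - r..a} \<Longrightarrow> y t = x t"
proof -
  \<comment> \<open>\<open>x\<close> extended by its end values to the whole line; adding the
    clipped integral leaves it unchanged up to \<open>a\<close>.\<close>
  define z where "z t = x (max (t0 - r) (min t a))" for t
  have cx: "continuous_on {t0 - r..a} x" using x by (simp add: sol_def)
  have clamp: "max (t0 - r) (min t a) \<in> {t0 - r..a}" for t using ac r by auto
  have zc: "continuous_on UNIV z"
    unfolding z_def by (rule continuous_on_compose2[OF cx]) (use clamp in \<open>auto intro!: continuous_intros\<close>)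
  have zB: "norm (z t) \<le> B" for t unfolding z_def by (rule xB[OF clamp])
  have zconst: "z t = z a" if "t \<ge> a" for t using that by (simp add: z_def)
  have zx: "z t = x t" if "t \<in> {t0 - r..a}" for t using that by (simp add: z_def)
  have zu: "\<exists>d>0. \<forall>s t. \<bar>s - t\<bar> < d \<longrightarrow> norm (z s - z t) \<le> e" if e: "e > 0" for e
  proof -
    have "uniformly_continuous_on {t0 - r..a} x" by (rule compact_uniformly_continuous[OF cx]) simp
    then obtain d where d: "d > 0" "\<And>s t. \<lbrakk>s \<in> {t0 - r..a}; t \<in> {t0 - r..a}; dist t s < d\<rbrakk> \<Longrightarrow> dist (x t) (x s) < e"
      using e unfolding uniformly_continuous_on_def by blast
    have "norm (z s - z t) \<le> e" if "\<bar>s - t\<bar> < d" for s t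
    proof -
      have "dist (max (t0 - r) (min s a)) (max (t0 - r) (min t a)) \<le> \<bar>s - t\<bar>" by (auto simp: dist_real_def)
      then have "dist (x (max (t0 - r) (min s a))) (x (max (t0 - r) (min t a))) < e"
        using that by (intro d(2) clamp) auto
      then show ?thesis by (simp add: z_def dist_norm)
    qed
    then show ?thesis using d(1) by blast
  qed
  have "\<exists>y. continuous_on UNIV y \<and> (\<forall>t. norm (y t) \<le> B + 1) \<and>
      (\<forall>t. y t = z t + integral {a..min t c} (\<lambda>s. F s (Tr r s y)))"
    by (rule integral_equation_solvable[OF zc zB zconst zu M L ac]) blast+
  then obtain y where y: "continuous_on UNIV y" "\<And>t. norm (y t) \<le> B + 1"
    "\<And>t. y t = z t + integral {a..min t c} (\<lambda>s. F s (Tr r s y))" by blast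
  define g where "g s = F s (Tr r s y)" for s
  let ?P = "\<lambda>t. integral {a..min t c} g"
  have gm: "g \<in> borel_measurable (lebesgue_on {a..c})"
    using F_Tr_measurable[OF y(1) ac(1), of 0 c] by (simp add: g_def[abs_def])
  have gM: "norm (g s) \<le> M" if "s \<in> {a..c}" for s
    unfolding g_def using that ac by (intro M Tr_mem continuous_on_subset[OF y(1)] hnorm_Tr_le r y(2)) auto
  have yP: "y t = z t + ?P t" for t using y(3)[of t] by (simp add: g_def[abs_def])
  have Pleft: "?P t = 0" if "t \<le> a" for t by (rule clipped_integral_left[OF gm gM ac(2) that])
  have yx: "y t = x t" if "t \<in> {t0 - r..a}" for t using yP[of t] Pleft[of t] zx[OF that] that by simp
  obtain N1 where N1: "negligible N1" "\<And>t. t\<in>{a<..<c} - N1 \<Longrightarrow> (?P has_vector_derivative g t) (at t)"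
    using clipped_integral_derivative[OF gm gM ac(2)] by blast
  obtain N2 where N2: "negligible N2" "\<And>t. t\<in>{t0<..<a} - N2 \<Longrightarrow> (x has_vector_derivative F t (Tr r t x)) (at t)"
    using x unfolding sol_def by blast
  obtain Mx where Mx: "\<And>s t. \<lbrakk>t0 \<le> s; s \<le> t; t \<le> a\<rbrakk> \<Longrightarrow> norm (x t - x s) \<le> Mx * (t - s)"
    using x unfolding sol_def by blast
  have "norm (y t - y s) \<le> (\<bar>Mx\<bar> + M) * (t - s)" if st: "t0 \<le> s" "s \<le> t" "t \<le> c" for s t
  proof -
    have n1: "norm (z t - z s) \<le> \<bar>Mx\<bar> * (t - s)"
    proof -
      have "z t = x (min t a)" "z s = x (min s a)" using st r ac by (auto simp: z_def)
      then have "norm (z t - z s) \<le> Mx * (min t a - min s a)" using Mx[of "min s a" "min t a"] st ac by auto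
      also have "\<dots> \<le> \<bar>Mx\<bar> * (min t a - min s a)" using st by (intro mult_right_mono) auto
      also have "\<dots> \<le> \<bar>Mx\<bar> * (t - s)" using st by (intro mult_left_mono) auto
      finally show ?thesis .
    qed
    have n2: "norm (?P t - ?P s) \<le> M * (t - s)"
      using clipped_integral_lipschitz[OF gm gM ac(2), of t s] st by simp
    have eq: "y t - y s = (z t - z s) + (?P t - ?P s)" using yP[of t] yP[of s] by simp
    show ?thesis unfolding eq distrib_right by (rule order_trans[OF norm_triangle_ineq add_mono[OF n1 n2]])
  qed
  \<comment> \<open>The old and the new piece may meet at \<open>a\<close> with different one-sided
    derivatives, hence the extra exceptional point.\<close>
  moreover have "(y has_vector_derivative F t (Tr r t y)) (at t)" if t: "t \<in> {t0<..<c} - (N1 \<union> N2 \<union> {a})" for t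
  proof (cases "t < a")
    case True
    have "(x has_vector_derivative F t (Tr r t x)) (at t)" using N2(2)[of t] t True by auto
    then have "(y has_vector_derivative F t (Tr r t x)) (at t)"
      by (rule has_vector_derivative_transform_within_open[of _ _ _ "{t0<..<a}"]) (use t True yx r in auto)
    moreover have "Tr r t x = Tr r t y" by (rule Tr_cong) (use yx t True in auto)
    ultimately show ?thesis by simp
  next
    case False
    have "((\<lambda>t. z a + ?P t) has_vector_derivative 0 + g t) (at t)"
      using t False by (intro derivative_intros N1(2)) auto
    then have "(y has_vector_derivative 0 + g t) (at t)"
    proof (rule has_vector_derivative_transform_within_open[of _ _ _ "{a<..<c}"])
      fix s assume "s \<in> {a<..<c}"
      then show "z a + ?P s = y s" using yP[of s] zconst[of s] by simp
    qed (use t False in auto)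
    then show ?thesis by (simp add: g_def)
  qed
  moreover have "negligible (N1 \<union> N2 \<union> {a})" by (intro negligible_Un N1(1) N2(1)) simp
  moreover have "continuous_on {t0 - r..c} y" by (rule continuous_on_subset[OF y(1)]) simp
  ultimately have "sol c y" unfolding sol_def by blast
  then show ?thesis using that yx by blast
qed

text \<open>In place of a blow-up argument on a maximal interval: the bound \<open>B\<close> holds
  for every solution on every shorter interval, so \<open>M\<close> and \<open>L\<close> for the
  radius B + 1 are fixed once and the step \<delta> never shrinks.\<close>

lemma sol_exists_bounded_interval:
  assumes init: "continuous_on {t0 - r..t0} \<phi>" and T: "t0 \<le> T"
    and apriori: "\<And>b x t. \<lbrakk>b \<in> {t0..T}; sol b x; \<forall>s\<in>{t0 - r..t0}. x s = \<phi> s; t \<in> {t0 - r..b}\<rbrakk>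
      \<Longrightarrow> norm (x t) \<le> B"
  obtains x where "sol T x" "\<And>s. s \<in> {t0 - r..t0} \<Longrightarrow> x s = \<phi> s"
proof -
  have base: "sol t0 \<phi>" unfolding sol_def
  proof (intro conjI)
    show "\<exists>M. \<forall>s t. t0 \<le> s \<and> s \<le> t \<and> t \<le> t0 \<longrightarrow> norm (\<phi> t - \<phi> s) \<le> M * (t - s)"
    proof (intro exI allI impI)
      fix s t assume "t0 \<le> s \<and> s \<le> t \<and> t \<le> t0"
      then have "s = t" by linarith
      then show "norm (\<phi> t - \<phi> s) \<le> 0 * (t - s)" by simp
    qed
    show "\<exists>N. negligible N \<and> (\<forall>t\<in>{t0<..<t0} - N. (\<phi> has_vector_derivative F t (Tr r t \<phi>)) (at t))"
      by (rule exI[of _ "{}"]) simp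
  qed (rule init)
  have B0: "0 \<le> B" using order_trans[OF norm_ge_zero apriori[OF _ base, of t0]] T r by auto
  obtain M where M: "M \<ge> 0" "\<And>s \<xi>. \<lbrakk>s \<in> {t0..T}; \<xi> \<in> mspace (C0 r); hnorm r \<xi> \<le> B + 1\<rbrakk> \<Longrightarrow> norm (F s \<xi>) \<le> M"
    using F_bounded[of T "B + 1"] by blast
  obtain L where L: "L \<ge> 0" "\<And>s \<xi> \<eta> B'. \<lbrakk>s \<in> {t0..T}; \<xi> \<in> mspace (C0 r); \<eta> \<in> mspace (C0 r);
      hnorm r \<xi> \<le> B + 1; hnorm r \<eta> \<le> B + 1; \<forall>\<theta>\<in>{-r..0}. norm (\<xi> \<theta> - \<eta> \<theta>) \<le> B'\<rbrakk>
      \<Longrightarrow> (\<xi> 0 - \<eta> 0) \<bullet> (F s \<xi> - F s \<eta>) \<le> L * B'\<^sup>2"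
    using F_one_sided[of T "B + 1"] by blast
  \<comment> \<open>One choice meets the three requirements of a continuation step: \<delta> <= 1, M
    \<delta> <= 1 and 8 L \<delta> <= 1.\<close>
  define \<delta> where "\<delta> = 1 / (1 + M + 8 * L)"
  have pos: "1 + M + 8 * L > 0" using M(1) L(1) by linarith
  have \<delta>: "\<delta> > 0" "M * \<delta> \<le> 1" "8 * L * \<delta> \<le> 1" "\<delta> \<le> 1"
    using pos M(1) L(1) by (auto simp: \<delta>_def pos_divide_le_eq)
  have "\<exists>x. sol (min T (t0 + real n * \<delta>)) x \<and> (\<forall>s\<in>{t0 - r..t0}. x s = \<phi> s)" for n
  proof (induction n)
    case 0
    then show ?case using base T by (auto simp: min_def)
  next
    case (Suc n)
    define a where "a = min T (t0 + real n * \<delta>)"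
    define c where "c = min T (t0 + real (Suc n) * \<delta>)"
    have ac: "t0 \<le> a" "a \<le> c" "c - a \<le> \<delta>" "c \<le> T" using T \<delta>(1) by (auto simp: a_def c_def algebra_simps min_def)
    obtain x where x: "sol a x" "\<forall>s\<in>{t0 - r..t0}. x s = \<phi> s" using Suc a_def by auto
    have scale: "k * (c - a) \<le> k * \<delta>" if "k \<ge> 0" for k using ac that by (intro mult_left_mono)
    have "\<exists>y. sol c y \<and> (\<forall>t\<in>{t0 - r..a}. y t = x t)"
    proof (rule sol_extend[OF x(1) _ B0 _ L(1), of c M])
      show "norm (x t) \<le> B" if "t \<in> {t0 - r..a}" for t
        by (rule apriori[OF _ x(1) _ that]) (use x(2) ac in auto)
      show "8 * L * (c - a) \<le> 1" using scale[of "8 * L"] \<delta>(3) L(1) by linarith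
      show "M * (c - a) \<le> 1" using scale[of M] \<delta>(2) M(1) by linarith
      show "norm (F s \<xi>) \<le> M" if "s \<in> {t0..c}" "\<xi> \<in> mspace (C0 r)" "hnorm r \<xi> \<le> B + 1" for s \<xi>
        using that ac by (intro M(2)) auto
      show "(\<xi> 0 - \<eta> 0) \<bullet> (F s \<xi> - F s \<eta>) \<le> L * B'\<^sup>2"
        if "s \<in> {t0..c}" "\<xi> \<in> mspace (C0 r)" "\<eta> \<in> mspace (C0 r)" "hnorm r \<xi> \<le> B + 1" "hnorm r \<eta> \<le> B + 1"
          "\<forall>\<theta>\<in>{-r..0}. norm (\<xi> \<theta> - \<eta> \<theta>) \<le> B'" for s \<xi> \<eta> B'
        using that ac by (intro L(2)) auto
    qed (use ac \<delta>(4) in auto)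
    then show ?case using x(2) ac unfolding c_def[symmetric] by fastforce
  qed
  moreover obtain n where "(T - t0) / \<delta> < real n" using reals_Archimedean2 by blast
  then have "T \<le> t0 + real n * \<delta>" using \<delta>(1) by (simp add: field_simps)
  then have "min T (t0 + real n * \<delta>) = T" by simp
  ultimately show ?thesis using that by metis
qed

text \<open>The a priori bound may depend on the horizon \<open>T\<close>; solutions on growing
  intervals are glued by uniqueness.\<close>

lemma sol_exists_global:
  assumes init: "continuous_on {t0 - r..t0} \<phi>"
    and apriori: "\<And>T. \<exists>B. \<forall>b\<in>{t0..T}. \<forall>x. sol b x \<longrightarrow> (\<forall>s\<in>{t0 - r..t0}. x s = \<phi> s) \<longrightarrow>
      (\<forall>t\<in>{t0 - r..b}. norm (x t) \<le> B)"
  obtains x where "\<And>T. sol T x" "\<And>s. s \<in> {t0 - r..t0} \<Longrightarrow> x s = \<phi> s"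
proof -
  have "\<exists>x. sol (t0 + real n) x \<and> (\<forall>s\<in>{t0 - r..t0}. x s = \<phi> s)" for n
  proof -
    obtain B where B: "\<And>b x t. \<lbrakk>b \<in> {t0..t0 + real n}; sol b x; \<forall>s\<in>{t0 - r..t0}. x s = \<phi> s; t \<in> {t0 - r..b}\<rbrakk>
      \<Longrightarrow> norm (x t) \<le> B" using apriori[of "t0 + real n"] by blast
    have "t0 \<le> t0 + real n" by simp
    then show ?thesis
    proof (rule sol_exists_bounded_interval[OF init])
      show "norm (x t) \<le> B" if "b \<in> {t0..t0 + real n}" "sol b x" "\<forall>s\<in>{t0 - r..t0}. x s = \<phi> s"
        "t \<in> {t0 - r..b}" for b x t using B that by blast
    qed blast
  qed
  then have "\<forall>n. \<exists>x. sol (t0 + real n) x \<and> (\<forall>s\<in>{t0 - r..t0}. x s = \<phi> s)" ..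
  from choice[OF this] obtain X where X: "\<And>n. sol (t0 + real n) (X n)" "\<And>n s. s \<in> {t0 - r..t0} \<Longrightarrow> X n s = \<phi> s"
    by blast
  have agree: "X n t = X m t" if "t \<in> {t0 - r..t0 + real n}" "n \<le> m" for n m t
    by (rule sol_unique[OF X(1) sol_mono[OF X(1)]]) (use that X(2) in auto)
  \<comment> \<open>By uniqueness any solution whose interval reaches \<open>t\<close> may be used.
    The ceiling picks the first one, and \<open>nat\<close> sends the initial history to index
    0.\<close>
  define x where "x t = X (nat \<lceil>t - t0\<rceil>) t" for t
  have xX: "x t = X n t" if t: "t \<in> {t0 - r..t0 + real n}" for n t
  proof -
    have "nat \<lceil>t - t0\<rceil> \<le> n" using t by (simp add: nat_le_iff ceiling_le_iff)
    moreover have "t \<le> t0 + real (nat \<lceil>t - t0\<rceil>)" by linarith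
    ultimately show ?thesis unfolding x_def using t by (intro agree) auto
  qed
  have sn: "sol (t0 + real n) x" for n
    unfolding sol_def
  proof (intro conjI)
    show "continuous_on {t0 - r..t0 + real n} x"
      using X(1)[of n] xX[of _ n] unfolding sol_def by (metis (no_types, lifting) continuous_on_cong)
    obtain M where "\<And>s t. \<lbrakk>t0 \<le> s; s \<le> t; t \<le> t0 + real n\<rbrakk> \<Longrightarrow> norm (X n t - X n s) \<le> M * (t - s)"
      using X(1)[of n] unfolding sol_def by blast
    then have "\<forall>s t. t0 \<le> s \<and> s \<le> t \<and> t \<le> t0 + real n \<longrightarrow> norm (x t - x s) \<le> M * (t - s)"
      using xX[of _ n] r by auto
    then show "\<exists>M. \<forall>s t. t0 \<le> s \<and> s \<le> t \<and> t \<le> t0 + real n \<longrightarrow> norm (x t - x s) \<le> M * (t - s)" ..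
    obtain N where N: "negligible N" "\<And>t. t\<in>{t0<..<t0 + real n} - N \<Longrightarrow> (X n has_vector_derivative F t (Tr r t (X n))) (at t)"
      using X(1)[of n] unfolding sol_def by blast
    have "(x has_vector_derivative F t (Tr r t x)) (at t)" if t: "t\<in>{t0<..<t0 + real n} - N" for t
    proof -
      have "(x has_vector_derivative F t (Tr r t (X n))) (at t)"
        by (rule has_vector_derivative_transform_within_open[OF N(2)[OF t], of "{t0<..<t0 + real n}"])
           (use t xX[of _ n] r in auto)
      moreover have "Tr r t (X n) = Tr r t x" by (rule Tr_cong) (use t xX[of _ n] in auto)
      ultimately show ?thesis by simp
    qed
    then show "\<exists>N. negligible N \<and> (\<forall>t\<in>{t0<..<t0 + real n} - N. (x has_vector_derivative F t (Tr r t x)) (at t))"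
      using N(1) by blast
  qed
  have "sol T x" for T
  proof -
    obtain n where "T - t0 \<le> real n" using real_arch_simple by blast
    then show ?thesis by (intro sol_mono[OF sn[of n]]) simp
  qed
  moreover have "x s = \<phi> s" if "s \<in> {t0 - r..t0}" for s using xX[of s 0] X(2)[OF that, of 0] that by simp
  ultimately show ?thesis using that by blast
qed

end

subsection \<open>The delay system with fixed inputs\<close>

text \<open>The dense sequence is taken inside \<Omega>, since the right-hand side is known to be
  continuous in the inputs only there.\<close>

lemma countable_valued_approximation:
  fixes \<Omega> :: "'a::euclidean_space set"
  assumes "\<Omega> \<noteq> {}"
  shows "\<exists>e :: nat \<Rightarrow> 'a. range e \<subseteq> \<Omega> \<and> (\<forall>w\<in>\<Omega>. \<forall>\<delta>>0. \<exists>i. dist w (e i) < \<delta>)"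
proof -
  obtain C where C: "countable C" "C \<subseteq> \<Omega>" "\<Omega> \<subseteq> closure C" using separable by blast
  have "C \<noteq> {}" using C assms by auto
  show ?thesis
  proof (intro exI[of _ "from_nat_into C"] conjI ballI allI impI)
    show "range (from_nat_into C) \<subseteq> \<Omega>" using C from_nat_into[OF \<open>C \<noteq> {}\<close>] by auto
    fix w \<delta> assume "w \<in> \<Omega>" and "\<delta> > (0::real)"
    then obtain c where "c \<in> C" "dist c w < \<delta>" using C(3) closure_approachable by blast
    then show "\<exists>i. dist w (from_nat_into C i) < \<delta>"
      using from_nat_into_surj[OF C(1)] by (metis dist_commute)
  qed
qed

text \<open>Uniform continuity on a compact interval that contains all histories near
  \<open>s\<close> bounds all values of \<theta> at once.\<close>

lemma continuous_map_Tr: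
  fixes y :: "real \<Rightarrow> real ^ 'n"
  assumes r: "0 \<le> r" and y: "continuous_on UNIV y"
  shows "continuous_map (top_of_set E) (C0_top r) (\<lambda>s. Tr r s y)"
  unfolding continuous_map_atin
proof
  fix s assume s: "s \<in> topspace (top_of_set E)"
  have mem: "Tr r s y \<in> mspace (C0 r)" for s by (intro Tr_mem continuous_on_subset[OF y]) simp
  show "limitin (C0_top r) (\<lambda>s. Tr r s y) (Tr r s y) (atin (top_of_set E) s)"
  proof (rule limitin_C0I[OF r mem mem])
    fix e :: real assume e: "e > 0"
    have "uniformly_continuous_on {s - r - 1..s + 1} y"
      by (rule compact_uniformly_continuous[OF continuous_on_subset[OF y]]) auto
    then obtain d where d: "d > 0" "\<And>t t'. \<lbrakk>t \<in> {s - r - 1..s + 1}; t' \<in> {s - r - 1..s + 1}; dist t' t < d\<rbrakk> \<Longrightarrow> dist (y t') (y t) < e"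
      using e unfolding uniformly_continuous_on_def by blast
    define \<delta> where "\<delta> = min d 1"
    have "norm (Tr r t y \<theta> - Tr r s y \<theta>) \<le> e" if t: "t \<in> ball s \<delta>" and \<theta>: "\<theta> \<in> {-r..0}" for t \<theta>
    proof -
      have "dist (y (t + \<theta>)) (y (s + \<theta>)) < e"
        using t \<theta> by (intro d(2)) (auto simp: \<delta>_def dist_real_def)
      then show ?thesis using \<theta> by (simp add: Tr_apply dist_norm)
    qed
    moreover have "openin (top_of_set E) (E \<inter> ball s \<delta>)" by (simp add: openin_open_Int)
    moreover have "s \<in> E \<inter> ball s \<delta>" using s d(1) by (auto simp: \<delta>_def)
    ultimately show "\<forall>\<^sub>F t in atin (top_of_set E) s. \<forall>\<theta>\<in>{- r..0}. norm (Tr r t y \<theta> - Tr r s y \<theta>) \<le> e"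
      unfolding eventually_atin by blast
  qed
qed

context delay_system
begin

lemma f_seq_continuous:
  assumes t: "0 \<le> t" and X: "limitin (C0_top r) X x sequentially" and W: "W \<longlonglongrightarrow> (u, v, d)"
    and mem: "\<And>n :: nat. W n \<in> U \<times> S2 \<times> D" "(u, v, d) \<in> U \<times> S2 \<times> D"
  shows "(\<lambda>n. case W n of (u, v, d) \<Rightarrow> f t d (X n) u v) \<longlonglongrightarrow> f t d x u v"
proof -
  let ?X = "prod_topology (C0_top r) (top_of_set (U \<times> S2 \<times> D))"
  have "limitin (top_of_set (U \<times> S2 \<times> D)) W (u, v, d) sequentially"
    unfolding limitin_subtopology using W mem by simp
  then have "limitin ?X (\<lambda>n. (X n, W n)) (x, (u, v, d)) sequentially"
    using X by (simp add: limitin_pairwise o_def)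
  from continuous_map_limit[OF f_continuous[rule_format, OF t] this]
  show ?thesis by (simp add: o_def case_prod_unfold)
qed

lemma inputs:
  assumes "admissible_data r D U S2 t0 x0 v u d"
  shows "0 \<le> t0" "x0 \<in> mspace (C0 r)"
    and "0 \<le> t \<Longrightarrow> v t \<in> S2" "0 \<le> t \<Longrightarrow> u t \<in> U" "0 \<le> t \<Longrightarrow> d t \<in> D"
    and "\<exists>B>0. \<forall>t\<in>{0..T}. norm (v t) \<le> B \<and> norm (u t) \<le> B"
    and "(\<lambda>t. (u t, v t, d t)) \<in> borel_measurable (lebesgue_on {0..})"
proof -
  from assms have *: "0 \<le> t0" "x0 \<in> mspace (C0 r)" "(\<lambda>t. (v t, u t, d t)) \<in> Linf_loc {0..} (S2 \<times> U \<times> D)"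
    by (auto simp: admissible_data_def)
  show "0 \<le> t0" "x0 \<in> mspace (C0 r)" using * by auto
  have "(v t, u t, d t) \<in> S2 \<times> U \<times> D" if "0 \<le> t" for t
    using *(3) that unfolding Linf_loc_def by (auto simp: image_subset_iff)
  then show "0 \<le> t \<Longrightarrow> v t \<in> S2" "0 \<le> t \<Longrightarrow> u t \<in> U" "0 \<le> t \<Longrightarrow> d t \<in> D" by auto
  have "bounded ((\<lambda>t. (v t, u t, d t)) ` {0..T})" using *(3) unfolding Linf_loc_def by auto
  then obtain B where B: "B > 0" "\<And>t. t \<in> {0..T} \<Longrightarrow> norm (v t, u t, d t) \<le> B" unfolding bounded_pos by auto
  have "norm (v t) \<le> B \<and> norm (u t) \<le> B" if "t \<in> {0..T}" for t
    using B(2)[OF that] norm_fst_le[of "v t" "(u t, d t)"] norm_snd_le[of "(u t, d t)" "v t"] norm_fst_le[of "u t" "d t"]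
    by linarith
  then show "\<exists>B>0. \<forall>t\<in>{0..T}. norm (v t) \<le> B \<and> norm (u t) \<le> B" using B(1) by blast
  have "(\<lambda>t. (v t, u t, d t)) \<in> borel_measurable (lebesgue_on {0..})" using *(3) unfolding Linf_loc_def by auto
  then have "(\<lambda>t. (v t, u t, d t)) \<in> lebesgue_on {0..} \<rightarrow>\<^sub>M borel \<Otimes>\<^sub>M (borel \<Otimes>\<^sub>M borel)" by (simp add: borel_prod)
  then have "(\<lambda>t. (u t, v t, d t)) \<in> lebesgue_on {0..} \<rightarrow>\<^sub>M borel \<Otimes>\<^sub>M (borel \<Otimes>\<^sub>M borel)"
    by (auto simp: measurable_pair_iff o_def)
  then show "(\<lambda>t. (u t, v t, d t)) \<in> borel_measurable (lebesgue_on {0..})" by (simp add: borel_prod)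
qed

text \<open>With frozen inputs the right-hand side along a continuous curve is continuous in time
  away from the countable set \<open>A\<close>. Measurable inputs are approximated by functions with
  countably many values; substituting these keeps measurability, and continuity in the inputs passes
  it to the limit.\<close>

lemma rhs_measurable:
  assumes adm: "admissible_data r D U S2 t0 x0 v u d" and y: "continuous_on UNIV y"
  shows "(\<lambda>s. f s (d s) (Tr r s y) (u s) (v s)) \<in> borel_measurable (lebesgue_on {t0..T})"
proof -
  note inp = inputs[OF adm]
  let ?\<Omega> = "U \<times> S2 \<times> D"
  have "?\<Omega> \<noteq> {}" using zero_mem D_nonempty by auto
  from countable_valued_approximation[OF this]
  obtain e where e: "range e \<subseteq> ?\<Omega>" "\<And>w \<delta>. w \<in> ?\<Omega> \<Longrightarrow> \<delta> > 0 \<Longrightarrow> \<exists>i :: nat. dist w (e i) < \<delta>"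
    by auto
  obtain A where A: "A \<subseteq> {0..}" "finite A \<or> (\<exists>\<tau> :: nat \<Rightarrow> real. A = range \<tau> \<and> strict_mono \<tau> \<and> (\<forall>k. 0 < \<tau> k) \<and>
              filterlim \<tau> at_top sequentially)"
    and Ac: "continuous_map (prod_topology (top_of_set ({0..} - A))
             (prod_topology (C0_top r) (top_of_set ?\<Omega>))) euclidean
           (\<lambda>(t, x, u, v, d). f t d x u v)"
    using f_time_regular by blast
  have "countable A" using A(2) by (auto intro: countable_finite)
  then have nA: "A \<in> null_sets lebesgue" by (intro null_sets_completionI countable_imp_null_set_lborel)
  define E where "E = {t0..T} - A \<inter> {t0..T}"
  have Es: "E \<in> sets lebesgue" unfolding E_def using null_setsD2[OF nA] by (intro sets.Diff sets.Int) auto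
  have E0: "E \<subseteq> {0..} - A" using inp(1) by (auto simp: E_def)
  define w where "w t = (u t, v t, d t)" for t
  have wm: "w \<in> borel_measurable (lebesgue_on E)"
    unfolding w_def using inp(7) by (rule measurable_restrict_mono) (use E0 in auto)
  have w\<Omega>: "w s \<in> ?\<Omega>" if "s \<in> E" for s using that E0 inp(3,4,5)[of s] by (auto simp: w_def)
  \<comment> \<open>Taking the least index makes the choice of an approximating value measurable in
    \<open>s\<close>.\<close>
  define i where "i k s = (LEAST j. dist (w s) (e j) < 1 / (real k + 1))" for k s
  have im: "i k \<in> measurable (lebesgue_on E) (count_space UNIV)" for k
  proof -
    have "(\<lambda>s. dist (w s) (e j) < 1 / (real k + 1)) \<in> measurable (lebesgue_on E) (count_space UNIV)" for j
      using wm by measurable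
    then show ?thesis unfolding i_def[abs_def] by (rule measurable_Least)
  qed
  have i: "dist (w s) (e (i k s)) < 1 / (real k + 1)" if "s \<in> E" for k s
    unfolding i_def by (rule LeastI_ex) (rule e(2)[OF w\<Omega>[OF that]], simp)
  define h where "h j s = (case e j of (u, v, d) \<Rightarrow> f s d (Tr r s y) u v)" for j s
  have hm: "h j \<in> borel_measurable (lebesgue_on E)" for j
  proof (rule continuous_imp_measurable_on_sets_lebesgue[OF _ Es])
    have "continuous_map (top_of_set E) (prod_topology (top_of_set ({0..} - A)) (prod_topology (C0_top r) (top_of_set ?\<Omega>)))
        (\<lambda>s. (s, Tr r s y, e j))"
      using e(1) E0 by (intro continuous_map_pairedI continuous_map_Tr r_nonneg y) (auto simp: continuous_map_in_subtopology)
    from continuous_map_compose[OF this Ac]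
    show "continuous_on E (h j)" by (simp add: o_def h_def[abs_def] case_prod_unfold)
  qed
  have "(\<lambda>s. f s (d s) (Tr r s y) (u s) (v s)) \<in> borel_measurable (lebesgue_on E)"
  proof (rule borel_measurable_LIMSEQ_metric)
    show "(\<lambda>s. h (i k s) s) \<in> borel_measurable (lebesgue_on E)" for k
      by (rule measurable_compose_countable[OF hm im])
    fix s assume "s \<in> space (lebesgue_on E)"
    then have s: "s \<in> E" by simp
    have "(\<lambda>k. e (i k s)) \<longlonglongrightarrow> w s"
    proof (rule metric_tendsto_imp_tendsto)
      show "(\<lambda>k. 1 / (real k + 1)) \<longlonglongrightarrow> 0"
        using LIMSEQ_inverse_real_of_nat by (simp add: inverse_eq_divide add.commute)
      show "\<forall>\<^sub>F k in sequentially. dist (e (i k s)) (w s) \<le> dist (1 / (real k + 1)) 0"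
      proof (rule always_eventually, rule allI)
        fix k show "dist (e (i k s)) (w s) \<le> dist (1 / (real k + 1)) 0"
          using i[OF s, of k] by (simp add: dist_commute)
      qed
    qed
    then have "(\<lambda>k. case e (i k s) of (u, v, d) \<Rightarrow> f s d (Tr r s y) u v) \<longlonglongrightarrow> f s (d s) (Tr r s y) (u s) (v s)"
      unfolding w_def
      using e(1) w\<Omega>[OF s] s E0 Tr_mem[of s r y] continuous_on_subset[OF y]
      by (intro f_seq_continuous) (auto simp: w_def topspace_mtopology_of)
    then show "(\<lambda>k. h (i k s) s) \<longlonglongrightarrow> f s (d s) (Tr r s y) (u s) (v s)" by (simp add: h_def)
  qed
  \<comment> \<open>Restoring a null set is harmless for Lebesgue measurability.\<close>
  moreover have "A \<inter> {t0..T} \<in> null_sets (lebesgue_on {t0..T})"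
    using nA by (auto simp: null_sets_restrict_space null_set_Int2)
  ultimately show ?thesis unfolding E_def by (subst (asm) borel_measurable_diff_null) auto
qed

lemma functional_ode_inputs:
  assumes adm: "admissible_data r D U S2 t0 x0 v u d"
  shows "functional_ode r t0 (\<lambda>t \<xi>. f t (d t) \<xi> (u t) (v t))"
proof
  note inp = inputs[OF adm]
  show "0 \<le> r" by (rule r_nonneg)
  fix T K :: real
  obtain b where b: "b > 0" "\<And>t. t \<in> {0..T} \<Longrightarrow> norm (v t) \<le> b" "\<And>t. t \<in> {0..T} \<Longrightarrow> norm (u t) \<le> b"
    using inp(6)[of T] by blast
  show "\<exists>M\<ge>0. \<forall>s\<in>{t0..T}. \<forall>\<xi>\<in>mspace (C0 r). hnorm r \<xi> \<le> K \<longrightarrow> norm (f s (d s) \<xi> (u s) (v s)) \<le> M"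
  proof -
    obtain \<beta> a where \<beta>: "\<beta> \<in> class_Kplus" and a: "a \<in> class_Kinf" and
      g: "\<And>t x u v d. \<lbrakk>t\<ge>0; x\<in>mspace (C0 r); u\<in>U; v\<in>S2; d\<in>D\<rbrakk> \<Longrightarrow>
           norm (f t d x u v) \<le> a (\<beta> t * hnorm r x) + a (\<beta> t * norm u) + a (\<beta> t * norm v)"
      using f_growth by blast
    have amono: "a x \<le> a y" if "0 \<le> x" "x \<le> y" for x y
      using a that unfolding class_Kinf_def class_K_def by (auto simp: strict_mono_on_def le_less)
    have a0: "0 \<le> a x" if "0 \<le> x" for x
      using amono[of 0 x] a that unfolding class_Kinf_def class_K_def pos_def_fun_def by auto
    have "bounded (\<beta> ` {0..T})"
      using \<beta> unfolding class_Kplus_def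
      by (intro compact_imp_bounded compact_continuous_image) (auto intro: continuous_on_subset)
    then obtain c where c: "c > 0" "\<And>t. t \<in> {0..T} \<Longrightarrow> \<bar>\<beta> t\<bar> \<le> c" unfolding bounded_pos by auto
    have \<beta>pos: "0 < \<beta> t" if "0 \<le> t" for t using \<beta> that by (auto simp: class_Kplus_def)
    \<comment> \<open>All three arguments in the growth bound are at most \<open>k\<close>:
      \<open>c\<close> bounds \<beta> on [0, T], while |K| and \<open>b\<close> bound the history
      and the inputs.\<close>
    define k where "k = c * max \<bar>K\<bar> b"
    have k0: "k \<ge> 0" using c b by (auto simp: k_def)
    have ak: "a (\<beta> s * z) \<le> a k" if "s \<in> {t0..T}" "0 \<le> z" "z \<le> max \<bar>K\<bar> b" for s z
    proof (rule amono)
      have s: "s \<in> {0..T}" using that inp(1) by auto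
      show "0 \<le> \<beta> s * z" using \<beta>pos[of s] s that by auto
      show "\<beta> s * z \<le> k" unfolding k_def using c(2)[OF s] c(1) that by (intro mult_mono) auto
    qed
    have "norm (f s (d s) \<xi> (u s) (v s)) \<le> 3 * a k"
      if s: "s \<in> {t0..T}" and \<xi>: "\<xi> \<in> mspace (C0 r)" "hnorm r \<xi> \<le> K" for s \<xi>
    proof -
      have s0: "0 \<le> s" "s \<in> {0..T}" using s inp(1) by auto
      have "0 \<le> hnorm r \<xi>" using \<xi>(1) r_nonneg by (intro hnorm_nonneg) (auto simp: C0_mem)
      then have "a (\<beta> s * hnorm r \<xi>) \<le> a k" using \<xi>(2) by (intro ak[OF s]) auto
      moreover have "a (\<beta> s * norm (u s)) \<le> a k" "a (\<beta> s * norm (v s)) \<le> a k"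
        using b(2,3)[OF s0(2)] by (auto intro!: ak[OF s])
      ultimately show ?thesis using g[OF s0(1) \<xi>(1) inp(4)[OF s0(1)] inp(3)[OF s0(1)] inp(5)[OF s0(1)]] by linarith
    qed
    then show ?thesis using a0[OF k0] by (intro exI[of _ "3 * a k"]) auto
  qed
  show "\<exists>L\<ge>0. \<forall>s\<in>{t0..T}. \<forall>\<xi>\<in>mspace (C0 r). \<forall>\<eta>\<in>mspace (C0 r). hnorm r \<xi> \<le> K \<longrightarrow> hnorm r \<eta> \<le> K \<longrightarrow>
      (\<forall>B. (\<forall>\<theta>\<in>{-r..0}. norm (\<xi> \<theta> - \<eta> \<theta>) \<le> B) \<longrightarrow>
        (\<xi> 0 - \<eta> 0) \<bullet> (f s (d s) \<xi> (u s) (v s) - f s (d s) \<eta> (u s) (v s)) \<le> L * B\<^sup>2)"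
  proof -
    \<comment> \<open>The bounded set on which the one-sided condition is invoked; \<open>b\<close>
      bounds \<open>u\<close> and \<open>v\<close>, while \<open>d\<close> ranges over all of
      \<open>D\<close>.\<close>
    define \<Omega> :: "((real \<Rightarrow> real ^ 'n) \<times> (real ^ 'm) \<times> (real ^ 'k2)) set"
      where "\<Omega> = {(\<xi>, u, v). \<xi> \<in> mspace (C0 r) \<and> hnorm r \<xi> \<le> K \<and> u \<in> U \<and> v \<in> S2 \<and> norm u \<le> b \<and> norm v \<le> b}"
    let ?m = "prod_metric (C0 r) (submetric euclidean_metric (U \<times> S2)) :: ((real \<Rightarrow> real ^ 'n) \<times> (real ^ 'm) \<times> (real ^ 'k2)) metric"
    interpret m: Metric_space "mspace ?m" "mdist ?m" by (rule Metric_space_mspace_mdist)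
    have "mdist ?m p q \<le> 2 * \<bar>K\<bar> + 4 * b" if pq: "p \<in> \<Omega>" "q \<in> \<Omega>" for p q
    proof -
      obtain \<xi> u v \<eta> u' v' where p: "p = (\<xi>, u, v)" and q: "q = (\<eta>, u', v')" by (metis prod.exhaust)
      have *: "\<xi> \<in> mspace (C0 r)" "hnorm r \<xi> \<le> K" "norm u \<le> b" "norm v \<le> b"
        "\<eta> \<in> mspace (C0 r)" "hnorm r \<eta> \<le> K" "norm u' \<le> b" "norm v' \<le> b"
        using pq unfolding p q \<Omega>_def by auto
      have d1: "mdist (C0 r) \<xi> \<eta> \<le> 2 * \<bar>K\<bar>"
        unfolding mdist_C0_le_iff[OF r_nonneg *(1) *(5)]
      proof
        fix \<theta> assume \<theta>: "\<theta> \<in> {-r..0}"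
        have "norm (\<xi> \<theta>) \<le> K" "norm (\<eta> \<theta>) \<le> K"
          using norm_le_hnorm[of r \<xi> \<theta>] norm_le_hnorm[of r \<eta> \<theta>] * \<theta> by (auto simp: C0_mem)
        then show "norm (\<xi> \<theta> - \<eta> \<theta>) \<le> 2 * \<bar>K\<bar>" using norm_triangle_ineq4[of "\<xi> \<theta>" "\<eta> \<theta>"] by linarith
      qed
      have "dist (u, v) (u', v') \<le> dist u u' + dist v v'"
        unfolding dist_Pair_Pair by (rule sqrt_sum_squares_le_sum) auto
      then have d2: "dist (u, v) (u', v') \<le> 4 * b"
        using * norm_triangle_ineq4[of u u'] norm_triangle_ineq4[of v v'] unfolding dist_norm by linarith
      have "mdist ?m p q = sqrt ((mdist (C0 r) \<xi> \<eta>)\<^sup>2 + (dist (u, v) (u', v'))\<^sup>2)"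
        by (simp add: p q prod_dist_def)
      also have "\<dots> \<le> mdist (C0 r) \<xi> \<eta> + dist (u, v) (u', v')"
        by (rule sqrt_sum_squares_le_sum) auto
      finally show ?thesis using d1 d2 by linarith
    qed
    moreover have "\<Omega> \<subseteq> mspace ?m" by (auto simp: \<Omega>_def)
    ultimately have "mbounded_of ?m \<Omega>" unfolding m.mbounded_alt by blast
    moreover have "{t0..T} \<subseteq> {0..}" "bounded {t0..T}" using inp(1) by auto
    ultimately obtain L where L: "L \<ge> 0" "\<And>t x y u v d. \<lbrakk>t \<in> {t0..T}; d \<in> D; (x, u, v) \<in> \<Omega>; (y, u, v) \<in> \<Omega>\<rbrakk> \<Longrightarrow>
        (x 0 - y 0) \<bullet> (f t d x u v - f t d y u v) \<le> L * (SUP s\<in>{-r..0}. (norm (x s - y s))\<^sup>2)"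
      using f_one_sided_Lipschitz[rule_format, of "{t0..T}" \<Omega>] by blast
    have "(\<xi> 0 - \<eta> 0) \<bullet> (f s (d s) \<xi> (u s) (v s) - f s (d s) \<eta> (u s) (v s)) \<le> L * B\<^sup>2"
      if s: "s \<in> {t0..T}" and \<xi>: "\<xi> \<in> mspace (C0 r)" "\<eta> \<in> mspace (C0 r)" "hnorm r \<xi> \<le> K" "hnorm r \<eta> \<le> K"
        and B: "\<forall>\<theta>\<in>{-r..0}. norm (\<xi> \<theta> - \<eta> \<theta>) \<le> B" for s \<xi> \<eta> B
    proof -
      have s0: "0 \<le> s" "s \<in> {0..T}" using s inp(1) by auto
      have "(SUP s\<in>{-r..0}. (norm (\<xi> s - \<eta> s))\<^sup>2) \<le> B\<^sup>2"
        using B r_nonneg by (intro cSUP_least power_mono) auto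
      moreover have "(\<xi>, u s, v s) \<in> \<Omega>" "(\<eta>, u s, v s) \<in> \<Omega>"
        using \<xi> inp(3,4)[OF s0(1)] b(2,3)[OF s0(2)] by (auto simp: \<Omega>_def)
      ultimately show ?thesis
        using L(2)[OF s inp(5)[OF s0(1)], of \<xi> "u s" "v s" \<eta>] mult_left_mono[OF _ L(1)] order_trans by blast
    qed
    then show ?thesis using L(1) by blast
  qed
  show "(\<lambda>n. f s (d s) (X n) (u s) (v s)) \<longlonglongrightarrow> f s (d s) \<xi> (u s) (v s)"
    if "t0 \<le> s" "limitin (C0_top r) X \<xi> sequentially" for s \<xi> and X :: "nat \<Rightarrow> real \<Rightarrow> real ^ 'n"
    using f_seq_continuous[of s X \<xi> "\<lambda>_. (u s, v s, d s)" "u s" "v s" "d s"] that inp(1) inp(3,4,5)[of s] by auto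
  show "(\<lambda>s. f s (d s) (Tr r s y) (u s) (v s)) \<in> borel_measurable (lebesgue_on {t0..T})"
    if "continuous_on UNIV y" for y by (rule rhs_measurable[OF adm that])
qed

end

section \<open>From Lipschitz solutions to maximal solutions of the system\<close>

lemma Tr_eq_iff:
  fixes x0 :: "real \<Rightarrow> real ^ 'n"
  assumes "x0 \<in> mspace (C0 r)"
  shows "Tr r t x = x0 \<longleftrightarrow> (\<forall>s\<in>{t - r..t}. x s = x0 (s - t))"
proof
  assume "Tr r t x = x0"
  then show "\<forall>s\<in>{t - r..t}. x s = x0 (s - t)" by (auto simp: Tr_def)
next
  assume *: "\<forall>s\<in>{t - r..t}. x s = x0 (s - t)"
  have "x0 \<in> extensional {-r..0}" using assms by (simp add: C0_mem)
  then show "Tr r t x = x0" using * by (auto simp: Tr_def restrict_def extensional_def fun_eq_iff)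
qed

context delay_system
begin

text \<open>On [t0, b] the histories of a solution are bounded, hence so is its derivative at almost
  every time; the mean value inequality for absolutely continuous functions turns this into a
  Lipschitz bound.\<close>

lemma is_solution_imp_sol:
  assumes adm: "admissible_data r D U S2 t0 x0 v u d" and x: "is_solution r f t0 x0 v u d T x"
    and b: "t0 \<le> b" "ereal b < T"
  shows "functional_ode.sol r t0 (\<lambda>t \<xi>. f t (d t) \<xi> (u t) (v t)) b x"
proof -
  interpret functional_ode r t0 "\<lambda>t \<xi>. f t (d t) \<xi> (u t) (v t)" by (rule functional_ode_inputs[OF adm])
  have below: "ereal t < T" if "t \<le> b" for t using b(2) that by (meson ereal_less_eq(3) le_less_trans)
  have cont: "continuous_on {t0 - r..b} x"
    using x below unfolding is_solution_def by (auto elim!: continuous_on_subset)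
  have ac: "abs_cont_on {t0..b} x" using x b unfolding is_solution_def by auto
  have "AE t in lebesgue. t0 < t \<and> ereal t < T \<longrightarrow> (x has_vector_derivative f t (d t) (Tr r t x) (u t) (v t)) (at t)"
    using x unfolding is_solution_def by blast
  then obtain N where N: "N \<in> null_sets lebesgue"
    "{t. \<not> (t0 < t \<and> ereal t < T \<longrightarrow> (x has_vector_derivative f t (d t) (Tr r t x) (u t) (v t)) (at t))} \<subseteq> N"
    unfolding eventually_ae_filter by auto
  have Nd: "(x has_vector_derivative f t (d t) (Tr r t x) (u t) (v t)) (at t)" if "t \<in> {t0<..<b} - N" for t
    using N(2) that below[of t] by auto
  have nN: "negligible N" using N(1) negligible_iff_null_sets by blast
  have "bounded (x ` {t0 - r..b})" using cont by (intro compact_imp_bounded compact_continuous_image) auto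
  then obtain K where K: "\<And>t. t \<in> {t0 - r..b} \<Longrightarrow> norm (x t) \<le> K" unfolding bounded_pos by blast
  obtain M where M: "M \<ge> 0" "\<And>s \<xi>. \<lbrakk>s \<in> {t0..b}; \<xi> \<in> mspace (C0 r); hnorm r \<xi> \<le> K\<rbrakk> \<Longrightarrow>
      norm (f s (d s) \<xi> (u s) (v s)) \<le> M" using F_bounded[of b K] by blast
  have "norm (x t - x s) \<le> M * (t - s)" if st: "t0 \<le> s" "s \<le> t" "t \<le> b" for s t
  proof (rule abs_cont_on_AE_deriv_bound[OF st(2) abs_cont_on_subset[OF ac] nN M(1)])
    fix \<tau> assume \<tau>: "\<tau> \<in> {s<..<t} - N"
    then have "norm (f \<tau> (d \<tau>) (Tr r \<tau> x) (u \<tau>) (v \<tau>)) \<le> M"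
      using st by (intro M(2) Tr_mem continuous_on_subset[OF cont] hnorm_Tr_le r K) auto
    then show "\<exists>D. norm D \<le> M \<and> (x has_vector_derivative D) (at \<tau>)" using Nd[of \<tau>] \<tau> st by auto
  qed (use st in auto)
  then show ?thesis unfolding sol_def using cont Nd nN by blast
qed

text \<open>With an infinite end time nothing can be continued, so maximality reduces to uniqueness
  on the interval where a competitor lives.\<close>

lemma sol_imp_maximal_solution:
  assumes adm: "admissible_data r D U S2 t0 x0 v u d"
    and x: "\<And>T. functional_ode.sol r t0 (\<lambda>t \<xi>. f t (d t) \<xi> (u t) (v t)) T x" and init: "Tr r t0 x = x0"
  shows "maximal_solution r f t0 x0 v u d \<infinity> x"
proof -
  interpret functional_ode r t0 "\<lambda>t \<xi>. f t (d t) \<xi> (u t) (v t)" by (rule functional_ode_inputs[OF adm])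
  note x0 = inputs(2)[OF adm]
  have cont: "continuous_on {t0 - r..T} x" for T using x[of T] by (simp add: sol_def)
  have "continuous_on {t. t0 - r \<le> t} x"
    unfolding continuous_on_eq_continuous_within
  proof
    fix t assume t: "t \<in> {t. t0 - r \<le> t}"
    have "continuous (at t within {t0 - r..t + 1}) x"
      using cont[of "t + 1"] t by (simp add: continuous_on_eq_continuous_within)
    moreover have "at t within {t. t0 - r \<le> t} = at t within {t0 - r..t + 1}"
      by (rule at_within_nhd[of t "{..<t+1}"]) auto
    ultimately show "continuous (at t within {t. t0 - r \<le> t}) x" by simp
  qed
  moreover have "abs_cont_on {t0..b} x" for b
  proof -
    obtain M where "\<And>s t. \<lbrakk>t0 \<le> s; s \<le> t; t \<le> b\<rbrakk> \<Longrightarrow> norm (x t - x s) \<le> M * (t - s)"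
      using x[of b] unfolding sol_def by blast
    then show ?thesis by (rule lipschitz_imp_abs_cont_on)
  qed
  moreover have "AE t in lebesgue. t0 < t \<longrightarrow> (x has_vector_derivative f t (d t) (Tr r t x) (u t) (v t)) (at t)"
  proof -
    have "\<forall>n :: nat. \<exists>N. negligible N \<and> (\<forall>t\<in>{t0<..<t0 + real n} - N. (x has_vector_derivative f t (d t) (Tr r t x) (u t) (v t)) (at t))"
      using x unfolding sol_def by blast
    from choice[OF this] obtain N where N: "\<And>n :: nat. negligible (N n)"
      "\<And>n t. t\<in>{t0<..<t0 + real n} - N n \<Longrightarrow> (x has_vector_derivative f t (d t) (Tr r t x) (u t) (v t)) (at t)"
      by blast
    have "negligible (\<Union>n. N n)" by (intro negligible_Union_nat N(1))
    then have "(\<Union>n. N n) \<in> null_sets lebesgue" by (simp add: negligible_iff_null_sets)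
    then show ?thesis
    proof (rule AE_I')
      show "{t \<in> space lebesgue. \<not> (t0 < t \<longrightarrow> (x has_vector_derivative f t (d t) (Tr r t x) (u t) (v t)) (at t))} \<subseteq> (\<Union>n. N n)"
      proof
        fix t assume t: "t \<in> {t \<in> space lebesgue. \<not> (t0 < t \<longrightarrow> (x has_vector_derivative f t (d t) (Tr r t x) (u t) (v t)) (at t))}"
        obtain n where "t - t0 < real n" using reals_Archimedean2 by blast
        then show "t \<in> (\<Union>n. N n)" using N(2)[of t n] t by auto
      qed
    qed
  qed
  ultimately have xs: "is_solution r f t0 x0 v u d \<infinity> x"
    unfolding is_solution_def using init by simp
  have "y t = x t" if y: "is_solution r f t0 x0 v u d T' y" and t: "t0 - r \<le> t" "ereal t < T'" for T' y t
  proof -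
    have "ereal t0 < T'" using y by (simp add: is_solution_def)
    \<comment> \<open>\<open>t\<close> may lie in the initial history, whereas the conversion of
      solutions needs an end time not before \<open>t0\<close>.\<close>
    then have m: "ereal (max t0 t) < T'" using t by (simp add: max_def)
    have sy: "sol (max t0 t) y" by (rule is_solution_imp_sol[OF adm y _ m]) simp
    have "Tr r t0 y = x0" using y by (simp add: is_solution_def)
    then have "y s = x s" if "s \<in> {t0 - r..t0}" for s
      using init that unfolding Tr_eq_iff[OF x0] by simp
    then show ?thesis by (rule sol_unique[OF sy x[of "max t0 t"]]) (use t in auto)
  qed
  then show ?thesis unfolding maximal_solution_def using xs by simp
qed

lemma maximal_solution_exists:
  assumes adm: "admissible_data r D U S2 t0 x0 v u d"
    and apriori: "\<And>T. \<exists>B. \<forall>b\<in>{t0..T}. \<forall>x. functional_ode.sol r t0 (\<lambda>t \<xi>. f t (d t) \<xi> (u t) (v t)) b x \<longrightarrow>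
      Tr r t0 x = x0 \<longrightarrow> (\<forall>t\<in>{t0 - r..b}. norm (x t) \<le> B)"
  shows "\<exists>x. maximal_solution r f t0 x0 v u d \<infinity> x"
proof -
  interpret functional_ode r t0 "\<lambda>t \<xi>. f t (d t) \<xi> (u t) (v t)" by (rule functional_ode_inputs[OF adm])
  note x0 = inputs(2)[OF adm]
  have c: "continuous_on {t0 - r..t0} (\<lambda>s. x0 (s - t0))"
  proof -
    have c0: "continuous_on {-r..0} x0" using x0 by (simp add: C0_mem)
    have c1: "continuous_on {t0 - r..t0} (\<lambda>s. s - t0)" by (intro continuous_intros)
    show ?thesis by (rule continuous_on_compose2[OF c0 c1]) auto
  qed
  have ap: "\<exists>B. \<forall>b\<in>{t0..T}. \<forall>x. sol b x \<longrightarrow> (\<forall>s\<in>{t0 - r..t0}. x s = x0 (s - t0)) \<longrightarrow>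
      (\<forall>t\<in>{t0 - r..b}. norm (x t) \<le> B)" for T
    using apriori[of T] by (simp only: Tr_eq_iff[OF x0])
  have "\<exists>x. (\<forall>T. sol T x) \<and> (\<forall>s\<in>{t0 - r..t0}. x s = x0 (s - t0))"
  proof (rule sol_exists_global[OF c ap])
    fix x assume "\<And>T. sol T x" "\<And>s. s \<in> {t0 - r..t0} \<Longrightarrow> x s = x0 (s - t0)"
    then show ?thesis by blast
  qed
  then obtain x where "\<And>T. sol T x" "Tr r t0 x = x0" unfolding Tr_eq_iff[OF x0] by blast
  then show ?thesis using sol_imp_maximal_solution[OF adm] by blast
qed

end

subsection \<open>Lyapunov functionals along solutions\<close>

lemma restrict_mem_C0:
  fixes x :: "real \<Rightarrow> real ^ 'n"
  assumes "continuous_on {-r..0} x"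
  shows "restrict x {-r..0} \<in> mspace (C0 r)"
proof -
  have "continuous_on {-r..0} (restrict x {-r..0}) = continuous_on {-r..0} x"
    by (rule continuous_on_cong) auto
  then show ?thesis using assms unfolding C0_mem by simp
qed

text \<open>The joint limit superior in (h, y) becomes a rectangle: all small \<open>h\<close>
  combined with all \<open>y\<close> in a fixed ball. This independence is what later allows
  \<open>y\<close> to be chosen depending on \<open>h\<close>.\<close>

lemma V0_upper_bound:
  fixes V :: "real \<Rightarrow> (real \<Rightarrow> real ^ 'n) \<Rightarrow> real"
  assumes r: "0 \<le> r" and V0: "V0 r V t x w \<le> ereal c" and e: "e > 0"
  obtains h0 \<eta> where "h0 > 0" "\<eta> > 0"
    "\<And>h y. \<lbrakk>0 < h; h < h0; y \<in> mspace (C0 r); \<And>\<theta>. \<theta> \<in> {-r..0} \<Longrightarrow> norm (y \<theta>) \<le> \<eta>\<rbrakk>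
      \<Longrightarrow> V (t + h) (restrict (\<lambda>\<theta>. Eh h x w \<theta> + h *\<^sub>R y \<theta>) {-r..0}) \<le> V t x + (c + e) * h"
proof -
  interpret M: Metric_space "mspace (C0 r) :: (real \<Rightarrow> real ^ 'n) set" "mdist (C0 r)" by (rule Metric_space_mspace_mdist)
  let ?z = "C0_zero r :: real \<Rightarrow> real ^ 'n"
  let ?q = "\<lambda>(h, y). ereal ((V (t + h) (restrict (\<lambda>\<theta>. Eh h x w \<theta> + h *\<^sub>R y \<theta>) {-r..0}) - V t x) / h)"
  have z: "?z \<in> mspace (C0 r)" by (intro restrict_mem_C0 continuous_intros)
  have "\<forall>\<^sub>F p in at_right 0 \<times>\<^sub>F nhdsin (C0_top r) ?z. ?q p < ereal (c + e)"
    using V0 e unfolding V0_def Limsup_le_iff by simp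
  then obtain Pf Pg where P: "\<forall>\<^sub>F h in at_right 0. Pf h" "\<forall>\<^sub>F y in nhdsin (C0_top r) ?z. Pg y"
    "\<And>h y. Pf h \<Longrightarrow> Pg y \<Longrightarrow> ?q (h, y) < ereal (c + e)"
    unfolding eventually_prod_filter by blast
  obtain h0 where h0: "h0 > 0" "\<And>h. \<lbrakk>0 < h; h < h0\<rbrakk> \<Longrightarrow> Pf h"
    using P(1) unfolding eventually_at_right_field by auto
  obtain S where S: "openin (C0_top r) S" "?z \<in> S" "\<And>y. y \<in> S \<Longrightarrow> Pg y"
    using P(2) z unfolding eventually_nhdsin by auto
  obtain \<epsilon> where \<epsilon>: "\<epsilon> > 0" "M.mball ?z \<epsilon> \<subseteq> S"
    using S(1,2) unfolding mtopology_of_def M.openin_mtopology by blast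
  show ?thesis
  \<comment> \<open>Half the radius, because the bound on \<open>y\<close> is not strict.\<close>
  proof (rule that[of h0 "\<epsilon> / 2"])
    fix h :: real and y :: "real \<Rightarrow> real ^ 'n"
    assume h: "0 < h" "h < h0" and y: "y \<in> mspace (C0 r)" "\<And>\<theta>. \<theta> \<in> {-r..0} \<Longrightarrow> norm (y \<theta>) \<le> \<epsilon> / 2"
    have "mdist (C0 r) ?z y \<le> \<epsilon> / 2"
      unfolding mdist_C0_le_iff[OF r z y(1)] using y(2) by simp
    then have "y \<in> M.mball ?z \<epsilon>" using y(1) z \<epsilon>(1) by simp
    then have "?q (h, y) < ereal (c + e)" using \<epsilon>(2) S(3) h0(2)[OF h] P(3) by blast
    then show "V (t + h) (restrict (\<lambda>\<theta>. Eh h x w \<theta> + h *\<^sub>R y \<theta>) {-r..0}) \<le> V t x + (c + e) * h"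
      using h(1) by (simp add: pos_divide_less_eq)
  qed (use h0 \<epsilon> in auto)
qed

text \<open>The perturbation is the exact error between the true history and the extension with
  slope \<open>w\<close>, divided by \<open>h\<close>. It vanishes for \<theta> <= -h, where both
  are the shifted old history; the maximum encodes this.\<close>

lemma Tr_eq_Eh:
  fixes x :: "real \<Rightarrow> real ^ 'n"
  assumes r: "0 \<le> r" and h: "h > 0"
  shows "Tr r (t + h) x = restrict (\<lambda>\<theta>. Eh h (Tr r t x) w \<theta> +
    h *\<^sub>R restrict (\<lambda>\<theta>. (1 / h) *\<^sub>R (x (t + max (\<theta> + h) 0) - x t - max (\<theta> + h) 0 *\<^sub>R w)) {-r..0} \<theta>) {-r..0}"
  unfolding Tr_def
proof (rule restrict_ext)
  fix \<theta> assume "\<theta> \<in> {-r..0}"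
  then show "x (t + h + \<theta>) = Eh h (restrict (\<lambda>\<theta>. x (t + \<theta>)) {- r..0}) w \<theta> +
      h *\<^sub>R restrict (\<lambda>\<theta>. (1 / h) *\<^sub>R (x (t + max (\<theta> + h) 0) - x t - max (\<theta> + h) 0 *\<^sub>R w)) {-r..0} \<theta>"
    using h r by (auto simp: Eh_def max_def algebra_simps)
qed

locale lyapunov_system = delay_system r D U S1 S2 f H
  for r :: real
    and D :: "(real ^ 'l) set" and U :: "(real ^ 'm) set"
    and S1 :: "(real ^ 'k1) set" and S2 :: "(real ^ 'k2) set"
    and f :: "real \<Rightarrow> real ^ 'l \<Rightarrow> (real \<Rightarrow> real ^ 'n) \<Rightarrow> real ^ 'm \<Rightarrow> real ^ 'k2 \<Rightarrow> real ^ 'n"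
    and H :: "real \<Rightarrow> (real \<Rightarrow> real ^ 'n) \<Rightarrow> real ^ 'k1" +
  fixes V :: "real \<Rightarrow> (real \<Rightarrow> real ^ 'n) \<Rightarrow> real"
    and \<zeta> \<zeta>u \<delta>1 \<delta>1u \<rho> :: "real \<Rightarrow> real"
  assumes V: "almost_Lipschitz r V"
    and rho: "continuous_on {0..} \<rho>" "pos_def_fun \<rho>"
    and V_decay: "\<forall>t\<ge>0. \<forall>x\<in>mspace (C0 r). \<forall>u\<in>U. \<forall>v\<in>S2. \<forall>d\<in>D.
      max (\<zeta> (\<delta>1 t * norm v)) (\<zeta>u (\<delta>1u t * norm u)) \<le> V t x \<longrightarrow>
      V0 r V t x (f t d x u v) \<le> ereal (- \<rho> (V t x))"
begin

lemma V_nonneg: "0 \<le> t \<Longrightarrow> x \<in> mspace (C0 r) \<Longrightarrow> 0 \<le> V t x"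
  using V unfolding almost_Lipschitz_def by blast

lemma V_Lipschitz:
  assumes "R \<ge> 0"
  obtains M where "M \<ge> 0" "\<And>t x y. \<lbrakk>t \<in> {0..R}; x \<in> mspace (C0 r); y \<in> mspace (C0 r); hnorm r x \<le> R; hnorm r y \<le> R\<rbrakk>
    \<Longrightarrow> \<bar>V t y - V t x\<bar> \<le> M * hnorm r (\<lambda>\<theta>. y \<theta> - x \<theta>)"
proof -
  from V[unfolded almost_Lipschitz_def, THEN conjunct2, THEN conjunct2]
  obtain M P G :: "real \<Rightarrow> real" where "\<forall>R\<ge>0. 0 \<le> M R \<and> 0 \<le> P R \<and> 1 \<le> G R"
    and *: "\<forall>R\<ge>0.
          (\<forall>x\<in>mspace (C0 r). \<forall>y\<in>mspace (C0 r). \<forall>t\<in>{0..R}. hnorm r x \<le> R \<and> hnorm r y \<le> R \<longrightarrow>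
             \<bar>V t y - V t x\<bar> \<le> M R * hnorm r (\<lambda>\<theta>. y \<theta> - x \<theta>)) \<and>
          (\<forall>x\<in>mspace (C0 r). abs_cont_on {-r..0} x \<and> deriv_esssup r x < \<infinity> \<and> hnorm r x \<le> R \<longrightarrow>
             (\<forall>t\<in>{0..R}. \<forall>h. 0 \<le> h \<and> h \<le> 1 / G (R + real_of_ereal (deriv_esssup r x)) \<longrightarrow>
                \<bar>V (t + h) x - V t x\<bar> \<le> h * P R * (1 + real_of_ereal (deriv_esssup r x))))"
    by (elim exE conjE) (rule that)
  then have "0 \<le> M R" using assms by blast
  moreover note *[rule_format, OF assms, THEN conjunct1]
  ultimately show ?thesis using that[of "M R"] by blast
qed

lemma rho_nonneg: "0 \<le> s \<Longrightarrow> 0 \<le> \<rho> s"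
  using rho(2) unfolding pos_def_fun_def by (cases "s = 0") (auto simp: less_imp_le)

lemma continuous_V_along:
  assumes t0: "0 \<le> t0" and x: "continuous_on {t0 - r..b} x"
  shows "continuous_on {t0..b} (\<lambda>t. V t (Tr r t x))"
proof (cases "t0 \<le> b")
  case True
  \<comment> \<open>Clamping the time gives a curve that is continuous on the whole line and has the
    same histories.\<close>
  define x' where "x' t = x (max (t0 - r) (min t b))" for t
  have x': "continuous_on UNIV x'"
    unfolding x'_def by (rule continuous_on_compose2[OF x]) (use True r_nonneg in \<open>auto intro!: continuous_intros\<close>)
  have "continuous_map (top_of_set {t0..b}) (prod_topology (top_of_set {0..}) (C0_top r)) (\<lambda>t. (t, Tr r t x'))"
    using t0 by (intro continuous_map_pairedI continuous_map_Tr r_nonneg x') (auto simp: continuous_map_in_subtopology)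
  moreover have "continuous_map (prod_topology (top_of_set {0..}) (C0_top r)) euclidean (\<lambda>(t, x). V t x)"
    using V unfolding almost_Lipschitz_def by blast
  ultimately have "continuous_map (top_of_set {t0..b}) euclidean ((\<lambda>(t, x). V t x) \<circ> (\<lambda>t. (t, Tr r t x')))"
    by (rule continuous_map_compose)
  then have "continuous_on {t0..b} (\<lambda>t. V t (Tr r t x'))" by (simp add: o_def)
  moreover have "Tr r t x' = Tr r t x" if "t \<in> {t0..b}" for t
    by (rule Tr_cong) (use that in \<open>auto simp: x'_def max_def\<close>)
  ultimately show ?thesis
    using continuous_on_cong[of "{t0..b}" "{t0..b}" "\<lambda>t. V t (Tr r t x')" "\<lambda>t. V t (Tr r t x)"] by simp
qed simp

lemma V_slopes:
  assumes adm: "admissible_data r D U S2 t0 x0 v u d"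
    and x: "functional_ode.sol r t0 (\<lambda>t \<xi>. f t (d t) \<xi> (u t) (v t)) b x" and tb: "t0 \<le> b"
  defines "W \<equiv> \<lambda>t. V t (Tr r t x)"
  obtains C N where "negligible N"
    "\<And>t. \<lbrakk>t \<in> {t0..<b}; max (\<zeta> (\<delta>1 t * norm (v t))) (\<zeta>u (\<delta>1u t * norm (u t))) \<le> W t\<rbrakk> \<Longrightarrow> right_slope_le W t C"
    "\<And>t. \<lbrakk>t \<in> {t0..<b} - N; max (\<zeta> (\<delta>1 t * norm (v t))) (\<zeta>u (\<delta>1u t * norm (u t))) \<le> W t\<rbrakk>
      \<Longrightarrow> right_slope_le W t (- \<rho> (W t))"
proof -
  interpret functional_ode r t0 "\<lambda>t \<xi>. f t (d t) \<xi> (u t) (v t)" by (rule functional_ode_inputs[OF adm])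
  note inp = inputs[OF adm]
  have cx: "continuous_on {t0 - r..b} x" using x by (simp add: sol_def)
  obtain K where K: "K > 0" "\<And>t. t \<in> {t0 - r..b} \<Longrightarrow> norm (x t) \<le> K" by (rule sol_bounded[OF x]) blast
  have mem: "Tr r t x \<in> mspace (C0 r)" if "t \<in> {t0..b}" for t
    using that by (intro Tr_mem continuous_on_subset[OF cx]) auto
  have hK: "hnorm r (Tr r t x) \<le> K" if "t \<in> {t0..b}" for t
    using that by (intro hnorm_Tr_le r K) auto
  define w where "w t = f t (d t) (Tr r t x) (u t) (v t)" for t
  obtain M where M: "M \<ge> 0" "\<And>t. t \<in> {t0..b} \<Longrightarrow> norm (w t) \<le> M"
    unfolding w_def using F_bounded[of b K] mem hK by blast
  obtain Mx where Mx: "\<And>s t. \<lbrakk>t0 \<le> s; s \<le> t; t \<le> b\<rbrakk> \<Longrightarrow> norm (x t - x s) \<le> Mx * (t - s)"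
    using x unfolding sol_def by blast
  obtain N where N: "negligible N" "\<And>t. t\<in>{t0<..<b} - N \<Longrightarrow> (x has_vector_derivative w t) (at t)"
    using x unfolding sol_def w_def by blast
  define y where "y t h = restrict (\<lambda>\<theta>. (1 / h) *\<^sub>R (x (t + max (\<theta> + h) 0) - x t - max (\<theta> + h) 0 *\<^sub>R w t)) {-r..0}" for t h
  have ymem: "y t h \<in> mspace (C0 r)" if "t \<in> {t0..<b}" "0 < h" "t + h \<le> b" for t h
  proof -
    have "continuous_on {-r..0} (\<lambda>\<theta>. x (t + max (\<theta> + h) 0))"
      by (rule continuous_on_compose2[OF cx]) (use that r_nonneg in \<open>auto intro!: continuous_intros\<close>)
    then have "continuous_on {-r..0} (\<lambda>\<theta>. (1 / h) *\<^sub>R (x (t + max (\<theta> + h) 0) - x t - max (\<theta> + h) 0 *\<^sub>R w t))"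
      by (intro continuous_intros)
    then show ?thesis unfolding y_def by (rule restrict_mem_C0)
  qed
  have V0: "V0 r V t (Tr r t x) (w t) \<le> ereal (- \<rho> (W t))"
    if "t \<in> {t0..<b}" "max (\<zeta> (\<delta>1 t * norm (v t))) (\<zeta>u (\<delta>1u t * norm (u t))) \<le> W t" for t
    using V_decay[rule_format, of t "Tr r t x" "u t" "v t" "d t"] that inp(1) inp(3,4,5)[of t] mem[of t]
    by (auto simp: W_def w_def)
  \<comment> \<open>Large enough for all times up to \<open>b\<close>, for the histories (bounded by
    \<open>K\<close>) and, when h <= 1, for the extensions with slope \<open>w t\<close> (bounded by
    K + M).\<close>
  define R where "R = b + K + M"
  have R: "R \<ge> 0" "K + M \<le> R" "b \<le> R" using tb inp(1) K(1) M(1) by (auto simp: R_def)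
  obtain LV where LV: "LV \<ge> 0" "\<And>t x y. \<lbrakk>t \<in> {0..R}; x \<in> mspace (C0 r); y \<in> mspace (C0 r); hnorm r x \<le> R; hnorm r y \<le> R\<rbrakk>
    \<Longrightarrow> \<bar>V t y - V t x\<bar> \<le> LV * hnorm r (\<lambda>\<theta>. y \<theta> - x \<theta>)" by (rule V_Lipschitz[OF R(1)]) blast
  have Mx0: "0 \<le> \<bar>Mx\<bar>" by simp
  \<comment> \<open>Obtained with the perturbation y = 0: the generalized derivative with slack 1
    gives slope at most 1 along the extension, as -\<rho> <= 0. Replacing the extension by the true
    history costs \<open>LV\<close> times their distance, which is at most (|Mx| + M) h whether or
    not \<open>x\<close> is differentiable at \<open>t\<close>.\<close>
  have "right_slope_le W t (1 + LV * (\<bar>Mx\<bar> + M))"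
    if t: "t \<in> {t0..<b}" and c: "max (\<zeta> (\<delta>1 t * norm (v t))) (\<zeta>u (\<delta>1u t * norm (u t))) \<le> W t" for t
  proof -
    obtain h0 \<eta> where h0: "h0 > 0" "\<eta> > 0"
      "\<And>h y. \<lbrakk>0 < h; h < h0; y \<in> mspace (C0 r); \<And>\<theta>. \<theta> \<in> {-r..0} \<Longrightarrow> norm (y \<theta>) \<le> \<eta>\<rbrakk>
      \<Longrightarrow> V (t + h) (restrict (\<lambda>\<theta>. Eh h (Tr r t x) (w t) \<theta> + h *\<^sub>R y \<theta>) {-r..0}) \<le> V t (Tr r t x) + (- \<rho> (W t) + 1) * h"
      by (rule V0_upper_bound[OF r V0[OF t c], of 1]) auto
    show ?thesis
    proof (rule right_slope_le_lipschitz[of "min (min h0 1) (b - t)"])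
      show "0 < min (min h0 1) (b - t)" using h0 t by auto
      fix h assume h: "0 < h" "h < min (min h0 1) (b - t)"
      then have th: "t + h \<in> {t0..b}" using t by auto
      let ?E = "restrict (\<lambda>\<theta>. Eh h (Tr r t x) (w t) \<theta> + h *\<^sub>R C0_zero r \<theta>) {-r..0}"
      have E: "?E = restrict (\<lambda>\<theta>. Tr r (t + h) x \<theta> - h *\<^sub>R y t h \<theta>) {-r..0}"
        unfolding Tr_eq_Eh[OF r h(1), of t x "w t"] y_def by (rule restrict_ext) auto
      have cT: "continuous_on {-r..0} (Tr r (t + h) x)" "continuous_on {-r..0} (y t h)"
        using mem[OF th] ymem[OF t h(1)] h by (auto simp: C0_mem)
      have Emem: "?E \<in> mspace (C0 r)"
      proof -
        have "continuous_on {-r..0} (\<lambda>\<theta>. Tr r (t + h) x \<theta> - h *\<^sub>R y t h \<theta>)" by (intro continuous_intros cT)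
        then show ?thesis unfolding E by (rule restrict_mem_C0)
      qed
      have zmem: "C0_zero r \<in> mspace (C0 r)" by (intro restrict_mem_C0 continuous_intros)
      have "V (t + h) ?E \<le> V t (Tr r t x) + (- \<rho> (W t) + 1) * h"
        by (rule h0(3)[OF h(1) _ zmem]) (use h h0 in auto)
      also have "\<dots> \<le> W t + 1 * h"
        using rho_nonneg[of "W t"] V_nonneg[of t "Tr r t x"] mem[of t] t inp(1) h(1)
        unfolding W_def by (intro add_mono mult_right_mono) auto
      finally have 1: "V (t + h) ?E \<le> W t + h" by simp
      have Ebd: "hnorm r ?E \<le> R"
      proof (rule hnorm_le[OF r])
        fix \<theta> assume \<theta>: "\<theta> \<in> {-r..0}"
        have "norm (Eh h (Tr r t x) (w t) \<theta>) \<le> K + M"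
        proof (cases "- h < \<theta>")
          case True
          have "norm (x t + (\<theta> + h) *\<^sub>R w t) \<le> norm (x t) + \<bar>\<theta> + h\<bar> * norm (w t)"
            using norm_triangle_ineq[of "x t" "(\<theta> + h) *\<^sub>R w t"] by simp
          also have "\<dots> \<le> K + 1 * M" using True \<theta> h t M K(2)[of t] r by (intro add_mono mult_mono) auto
          finally show ?thesis using True r by (simp add: Eh_def Tr_apply)
        next
          case False
          then have "norm (x (t + (\<theta> + h))) \<le> K" using \<theta> h t by (intro K(2)) auto
          then show ?thesis using False \<theta> h(1) M(1) by (simp add: Eh_def Tr_apply)
        qed
        then show "norm (?E \<theta>) \<le> R" using R(2) \<theta> by simp
      qed
      have "\<bar>V (t + h) (Tr r (t + h) x) - V (t + h) ?E\<bar> \<le> LV * hnorm r (\<lambda>\<theta>. Tr r (t + h) x \<theta> - ?E \<theta>)"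
        using th inp(1) R hK[OF th] M(1) by (intro LV(2) Emem mem Ebd) auto
      also have "hnorm r (\<lambda>\<theta>. Tr r (t + h) x \<theta> - ?E \<theta>) \<le> (\<bar>Mx\<bar> + M) * h"
      proof (rule hnorm_le[OF r])
        fix \<theta> assume \<theta>: "\<theta> \<in> {-r..0}"
        define s where "s = max (\<theta> + h) 0"
        have s: "0 \<le> s" "s \<le> h" using \<theta> h by (auto simp: s_def)
        have "Tr r (t + h) x \<theta> - ?E \<theta> = h *\<^sub>R y t h \<theta>" unfolding E using \<theta> by simp
        also have "\<dots> = x (t + s) - x t - s *\<^sub>R w t" using \<theta> h(1) by (simp add: y_def s_def)
        finally have eq: "Tr r (t + h) x \<theta> - ?E \<theta> = x (t + s) - x t - s *\<^sub>R w t" .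
        have "norm (x (t + s) - x t) \<le> Mx * s" using Mx[of t "t + s"] s h t by auto
        also have "\<dots> \<le> \<bar>Mx\<bar> * h" using s by (intro mult_mono) auto
        finally have n1: "norm (x (t + s) - x t) \<le> \<bar>Mx\<bar> * h" .
        have "s * norm (w t) \<le> h * M" using s M(2)[of t] t by (intro mult_mono) auto
        then have n2: "norm (s *\<^sub>R w t) \<le> M * h" using s by (simp add: mult.commute)
        show "norm (Tr r (t + h) x \<theta> - ?E \<theta>) \<le> (\<bar>Mx\<bar> + M) * h"
          unfolding eq distrib_right by (rule order_trans[OF norm_triangle_ineq4 add_mono[OF n1 n2]])
      qed
      finally have "\<bar>V (t + h) (Tr r (t + h) x) - V (t + h) ?E\<bar> \<le> LV * ((\<bar>Mx\<bar> + M) * h)"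
        using LV(1) by (simp add: mult_left_mono)
      then show "W (t + h) \<le> W t + (1 + LV * (\<bar>Mx\<bar> + M)) * h"
        using 1 by (simp add: W_def algebra_simps abs_le_iff)
    qed
  qed
  \<comment> \<open>At a point of differentiability the normalised error tends to 0 uniformly in
    \<theta>, so it is itself an admissible perturbation and the decay rate survives without
    loss.\<close>
  moreover have "right_slope_le W t (- \<rho> (W t))"
    if t: "t \<in> {t0..<b} - (N \<union> {t0})" and c: "max (\<zeta> (\<delta>1 t * norm (v t))) (\<zeta>u (\<delta>1u t * norm (u t))) \<le> W t" for t
  proof (rule right_slope_leI)
    fix e :: real assume e: "e > 0"
    have t': "t \<in> {t0..<b}" using t by auto
    obtain h0 \<eta> where h0: "h0 > 0" "\<eta> > 0"
      "\<And>h y. \<lbrakk>0 < h; h < h0; y \<in> mspace (C0 r); \<And>\<theta>. \<theta> \<in> {-r..0} \<Longrightarrow> norm (y \<theta>) \<le> \<eta>\<rbrakk>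
      \<Longrightarrow> V (t + h) (restrict (\<lambda>\<theta>. Eh h (Tr r t x) (w t) \<theta> + h *\<^sub>R y \<theta>) {-r..0}) \<le> V t (Tr r t x) + (- \<rho> (W t) + e) * h"
      by (rule V0_upper_bound[OF r V0[OF t' c] e]) blast
    have "(x has_vector_derivative w t) (at t)" using N(2)[of t] t by auto
    then obtain \<delta> where \<delta>: "\<delta> > 0" "\<And>s. norm (s - t) < \<delta> \<Longrightarrow> norm (x s - x t - (s - t) *\<^sub>R w t) \<le> \<eta> * norm (s - t)"
      using h0(2) unfolding has_vector_derivative_def has_derivative_at_alt by blast
    have "W (t + h) \<le> W t + (- \<rho> (W t) + e) * h" if h: "0 < h" "h < min (min h0 \<delta>) (b - t)" for h
    proof -
      have "V (t + h) (restrict (\<lambda>\<theta>. Eh h (Tr r t x) (w t) \<theta> + h *\<^sub>R y t h \<theta>) {-r..0}) \<le> V t (Tr r t x) + (- \<rho> (W t) + e) * h"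
      proof (rule h0(3)[OF h(1) _ ymem[OF t' h(1)]])
        fix \<theta> assume \<theta>: "\<theta> \<in> {-r..0}"
        define s where "s = max (\<theta> + h) 0"
        have s: "0 \<le> s" "s \<le> h" using \<theta> h by (auto simp: s_def)
        have "norm (x (t + s) - x t - s *\<^sub>R w t) \<le> \<eta> * s" using \<delta>(2)[of "t + s"] s h by simp
        also have "\<dots> \<le> \<eta> * h" using s h0(2) by (intro mult_left_mono) auto
        finally have "(1 / h) * norm (x (t + s) - x t - s *\<^sub>R w t) \<le> \<eta>" using h(1) by (simp add: field_simps)
        then show "norm (y t h \<theta>) \<le> \<eta>" using \<theta> h(1) by (simp add: y_def s_def)
      qed (use h in auto)
      then show ?thesis unfolding W_def y_def Tr_eq_Eh[OF r h(1), of t x "w t", symmetric] by simp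
    qed
    then show "\<exists>h0>0. \<forall>h. 0 < h \<and> h < h0 \<longrightarrow> W (t + h) \<le> W t + (- \<rho> (W t) + e) * h"
      using h0(1) \<delta>(1) t by (intro exI[of _ "min (min h0 \<delta>) (b - t)"]) auto
  qed
  moreover have "negligible (N \<union> {t0})" using N(1) by simp
  ultimately show ?thesis using that[of "N \<union> {t0}"] by blast
qed

end

subsection \<open>Scalar comparison\<close>

text \<open>Chain rule from one side. Only an upper bound for W(t + h) is available and
  \<open>W\<close> may drop far below it, so \<phi> has to be monotone; its derivative is then used
  at the bound W t + k h.\<close>

lemma right_slope_le_compose:
  fixes \<phi> W :: "real \<Rightarrow> real"
  assumes W: "right_slope_le W t c" and \<phi>: "(\<phi> has_real_derivative D) (at (W t))" "D \<ge> 0"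
    and mono: "\<And>x y. \<lbrakk>0 < x; x \<le> y\<rbrakk> \<Longrightarrow> \<phi> x \<le> \<phi> y"
    and pos: "h1 > 0" "\<And>h. \<lbrakk>0 < h; h < h1\<rbrakk> \<Longrightarrow> 0 < W (t + h)"
  shows "right_slope_le (\<lambda>s. \<phi> (W s)) t (D * c)"
proof (rule right_slope_leI)
  fix e :: real assume e: "e > 0"
  \<comment> \<open>\<open>e1\<close> and \<open>e2\<close> each use up half of \<open>e\<close>;
    the 1 added in the denominators covers D = 0 and k = 0.\<close>
  define e1 where "e1 = e / (2 * (D + 1))"
  have e1: "e1 > 0" "D * e1 \<le> e / 2" using e \<phi>(2) by (auto simp: e1_def field_simps)
  define k where "k = c + e1"
  define e2 where "e2 = e / (2 * (\<bar>k\<bar> + 1))"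
  have e2: "e2 > 0" "e2 * \<bar>k\<bar> \<le> e / 2"
    using e by (auto simp: e2_def field_simps intro!: divide_pos_pos)
  obtain h0 where h0: "h0 > 0" "\<And>h. \<lbrakk>0 \<le> h; h < h0\<rbrakk> \<Longrightarrow> W (t + h) \<le> W t + k * h"
    using right_slope_leD[OF W e1(1)] unfolding k_def by blast
  obtain d where d: "d > 0" "\<And>s. norm (s - W t) < d \<Longrightarrow> norm (\<phi> s - \<phi> (W t) - D * (s - W t)) \<le> e2 * norm (s - W t)"
    using \<phi>(1) e2(1) unfolding has_field_derivative_def has_derivative_at_alt by blast
  have "\<phi> (W (t + h)) \<le> \<phi> (W t) + (D * c + e) * h"
    if h: "0 < h" "h < min (min h0 h1) (d / (\<bar>k\<bar> + 1))" for h
  proof -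
    have kh: "\<bar>k * h\<bar> < d"
    proof -
      have "\<bar>k * h\<bar> \<le> (\<bar>k\<bar> + 1) * h" using h(1) by (simp add: abs_mult mult_right_mono)
      also have "\<dots> < d" using h(2) by (simp add: pos_less_divide_eq mult.commute)
      finally show ?thesis .
    qed
    have "\<phi> (W (t + h)) \<le> \<phi> (W t + k * h)"
      using h0(2)[of h] pos(2)[of h] h by (intro mono) auto
    also have "\<dots> \<le> \<phi> (W t) + D * (k * h) + e2 * \<bar>k * h\<bar>"
      using d(2)[of "W t + k * h"] kh by (simp add: abs_le_iff)
    also have "\<dots> = \<phi> (W t) + (D * c + D * e1 + e2 * \<bar>k\<bar>) * h"
    proof -
      have "\<bar>k * h\<bar> = \<bar>k\<bar> * h" using h(1) by (simp add: abs_mult)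
      moreover have "D * (k * h) = (D * c + D * e1) * h" by (simp add: k_def algebra_simps)
      ultimately show ?thesis by (simp only: distrib_right mult.assoc add.assoc)
    qed
    also have "\<dots> \<le> \<phi> (W t) + (D * c + e) * h"
      using e1(2) e2(2) h(1) by (intro add_left_mono mult_right_mono) auto
    finally show ?thesis .
  qed
  moreover have "0 < min (min h0 h1) (d / (\<bar>k\<bar> + 1))" using h0(1) pos(1) d(1) by simp
  ultimately show "\<exists>h0>0. \<forall>h. 0 < h \<and> h < h0 \<longrightarrow> \<phi> (W (t + h)) \<le> \<phi> (W t) + (D * c + e) * h"
    by blast
qed

text \<open>After the last time \<open>s\<close> at level \<open>q\<close> the function stays at or
  above \<open>q\<close> if it ends above, so the slope bounds hold throughout [s, b] and
  \<open>W\<close> cannot grow there.\<close>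

lemma right_slope_stays_below:
  fixes W :: "real \<Rightarrow> real"
  assumes cont: "continuous_on {a..b} W" and N: "negligible N" and ab: "a \<le> b"
    and ev: "\<And>t. t \<in> {a..<b} \<Longrightarrow> q \<le> W t \<Longrightarrow> right_slope_le W t C"
    and ae: "\<And>t. t \<in> {a..<b} - N \<Longrightarrow> q \<le> W t \<Longrightarrow> right_slope_le W t 0"
    and start: "W a \<le> q"
  shows "W b \<le> q"
proof (rule ccontr)
  assume "\<not> W b \<le> q"
  then have Wb: "q < W b" by simp
  define S where "S = {a..b} \<inter> W -` {q}"
  have "closed S" unfolding S_def by (rule continuous_closed_preimage[OF cont]) auto
  then have "compact S" unfolding S_def by (metis compact_Icc compact_Int_closed inf.left_idem)
  moreover have "S \<noteq> {}" using IVT'[of W a q b] start Wb ab cont by (auto simp: S_def)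
  ultimately obtain s where s: "s \<in> S" "\<And>t. t \<in> S \<Longrightarrow> t \<le> s" using compact_attains_sup by metis
  have sab: "a \<le> s" "s < b" "W s = q" using s(1) Wb by (auto simp: S_def le_less)
  have above: "q \<le> W t" if t: "t \<in> {s..b}" for t
  proof (rule ccontr)
    assume "\<not> q \<le> W t"
    then have "W t \<le> q" "t \<noteq> s" using sab by auto
    then obtain t' where "t \<le> t'" "t' \<le> b" "W t' = q"
      using IVT'[of W t q b] Wb t sab continuous_on_subset[OF cont, of "{t..b}"] by auto
    then have "t' \<in> S" using t sab by (auto simp: S_def)
    then show False using s(2) \<open>t \<le> t'\<close> t \<open>t \<noteq> s\<close> by fastforce
  qed
  have "W b \<le> W s + 0 * (b - s)"
  proof (rule right_slope_growth[OF _ _ N])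
    show "continuous_on {s..b} W" by (rule continuous_on_subset[OF cont]) (use sab in auto)
    show "right_slope_le W t C" if "t \<in> {s..<b}" for t using that sab above by (intro ev) auto
    show "right_slope_le W t 0" if "t \<in> {s..<b} - N" for t using that sab above by (intro ae) auto
  qed (use sab in auto)
  then show False using sab Wb by simp
qed

text \<open>In the variable x = ln w, differences of \<open>E\<close> are travel times of the flow
  w' = -min(\<rho>(w), w), so subtracting t from \<open>E\<close> advances the flow by time t.
  Because the integrand is at least 1, \<open>E\<close> maps the line onto itself and its inverse
  \<open>I\<close> is Lipschitz with constant 1.\<close>

lemma scalar_flow:
  fixes \<rho> :: "real \<Rightarrow> real"
  assumes cont: "continuous_on {0..} \<rho>" and pd: "pos_def_fun \<rho>"
  obtains E I :: "real \<Rightarrow> real" where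
    "\<And>x. (E has_real_derivative exp x / min (\<rho> (exp x)) (exp x)) (at x)"
    "\<And>x y. x \<le> y \<Longrightarrow> y - x \<le> E y - E x" "\<And>x. I (E x) = x" "\<And>y. E (I y) = y"
    "\<And>x y. x \<le> y \<Longrightarrow> I x \<le> I y" "\<And>x y. x < y \<Longrightarrow> I x < I y" "continuous_on UNIV I" "continuous_on UNIV E"
proof -
  define k where "k x = exp x / min (\<rho> (exp x)) (exp x)" for x
  have \<rho>pos: "\<rho> (exp x) > 0" for x using pd unfolding pos_def_fun_def by simp
  have "continuous_on UNIV (\<lambda>x. \<rho> (exp x))"
    by (rule continuous_on_compose2[OF cont]) (auto intro: continuous_intros)
  moreover have "min (\<rho> (exp x)) (exp x) \<noteq> 0" for x using \<rho>pos[of x] exp_gt_zero[of x] by linarith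
  ultimately have kc: "continuous_on UNIV k" unfolding k_def by (intro continuous_intros) auto
  have k1: "1 \<le> k x" for x unfolding k_def using \<rho>pos[of x] by (simp add: pos_le_divide_eq)
  obtain E where E: "\<And>x. (E has_vector_derivative k x) (at x)"
    using einterval_antiderivative[of "-\<infinity>" "\<infinity>" k] kc by (auto simp: continuous_on_eq_continuous_at)
  have Ed: "(E has_real_derivative k x) (at x)" for x
    using E by (simp add: has_real_derivative_iff_has_vector_derivative)
  have Egrow: "y - x \<le> E y - E x" if "x \<le> y" for x y
  proof -
    have "E x - x \<le> E y - y"
    proof (rule DERIV_nonneg_imp_nondecreasing[OF that])
      fix z show "\<exists>D. ((\<lambda>x. E x - x) has_real_derivative D) (at z) \<and> 0 \<le> D"
        using k1[of z] by (intro exI[of _ "k z - 1"]) (auto intro!: derivative_eq_intros Ed)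
    qed
    then show ?thesis by simp
  qed
  have Ec: "continuous_on UNIV E" by (rule continuous_at_imp_continuous_on) (use Ed DERIV_isCont in blast)
  have "\<exists>x. E x = y" for y
  proof -
    define m where "m = \<bar>y - E 0\<bar>"
    have "E (- m) \<le> y" "y \<le> E m" using Egrow[of "-m" 0] Egrow[of 0 m] by (auto simp: m_def)
    then show ?thesis using IVT'[of E "-m" y m] continuous_on_subset[OF Ec] by (auto simp: m_def)
  qed
  then obtain I where EI: "\<And>y. E (I y) = y" by metis
  have Einj: "x < y \<Longrightarrow> E x < E y" for x y using Egrow[of x y] by simp
  have IE: "I (E x) = x" for x using Einj[of x "I (E x)"] Einj[of "I (E x)" x] EI[of "E x"] by (metis linorder_neqE order_less_irrefl)
  have Istrict: "I x < I y" if "x < y" for x y using Einj[of "I y" "I x"] EI that by (metis linorder_neqE not_less_iff_gr_or_eq)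
  have Imono: "I x \<le> I y" if "x \<le> y" for x y using Istrict[of x y] that by (cases "x = y") auto
  have Ilip: "dist (I x) (I y) \<le> 1 * dist x y" for x y
    using Egrow[of "I x" "I y"] Egrow[of "I y" "I x"] EI by (cases "I x \<le> I y") (auto simp: dist_real_def)
  have "continuous_on UNIV I"
    by (rule lipschitz_on_continuous_on[of 1]) (rule lipschitz_onI, use Ilip in auto)
  then show ?thesis using that[of E I] Ed Egrow IE EI Imono Istrict Ec unfolding k_def by blast
qed

lemma comparison_KL:
  fixes \<rho> :: "real \<Rightarrow> real"
  assumes \<rho>: "continuous_on {0..} \<rho>" "pos_def_fun \<rho>"
  obtains \<sigma> where "\<sigma> \<in> class_KL"
    "\<And>W a b q C N. \<lbrakk>a \<le> b; continuous_on {a..b} W; negligible N; 0 \<le> q;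
      \<And>t. \<lbrakk>t \<in> {a..<b}; q \<le> W t\<rbrakk> \<Longrightarrow> right_slope_le W t C;
      \<And>t. \<lbrakk>t \<in> {a..<b} - N; q \<le> W t\<rbrakk> \<Longrightarrow> right_slope_le W t (- \<rho> (W t))\<rbrakk>
      \<Longrightarrow> W b \<le> max q (\<sigma> (W a) (b - a))"
proof (rule scalar_flow[OF \<rho>])
  fix E I :: "real \<Rightarrow> real"
  assume E: "\<And>x. (E has_real_derivative exp x / min (\<rho> (exp x)) (exp x)) (at x)"
    "\<And>x y. x \<le> y \<Longrightarrow> y - x \<le> E y - E x" and IE: "\<And>x. I (E x) = x" and EI: "\<And>y. E (I y) = y"
    and I: "\<And>x y. x \<le> y \<Longrightarrow> I x \<le> I y" "\<And>x y. x < y \<Longrightarrow> I x < I y" "continuous_on UNIV I"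
    and Ec: "continuous_on UNIV E"
  \<comment> \<open>The state reached from \<open>s\<close> after time \<open>t\<close>. The value 0
    for s <= 0 supplies the equilibrium, where the logarithm is meaningless.\<close>
  define \<sigma> where "\<sigma> s t = (if s \<le> 0 then 0 else exp (I (E (ln s) - t)))" for s t :: real
  have \<sigma>0: "\<sigma> 0 t = 0" for t by (simp add: \<sigma>_def)
  have \<sigma>nn: "0 \<le> \<sigma> s t" for s t by (simp add: \<sigma>_def)
  \<comment> \<open>This bound yields continuity at s = 0, which the formula with the logarithm does
    not reach.\<close>
  have \<sigma>le: "\<sigma> s t \<le> s" if "0 \<le> s" "0 \<le> t" for s t
  proof (cases "s = 0")
    case False
    then have "I (E (ln s) - t) \<le> ln s" using I(1)[of "E (ln s) - t" "E (ln s)"] IE that by simp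
    then have "exp (I (E (ln s) - t)) \<le> exp (ln s)" by simp
    then show ?thesis using False that by (simp add: \<sigma>_def)
  qed (simp add: \<sigma>_def)
  have cpos: "continuous_on ({0<..} \<times> UNIV) (\<lambda>(s, t). \<sigma> s t)"
  proof -
    have "continuous_on ({0<..} \<times> UNIV) (\<lambda>p. exp (I (E (ln (fst p)) - snd p)) :: real)"
      by (intro continuous_intros continuous_on_compose2[OF I(3)] continuous_on_compose2[OF Ec]) auto
    then show ?thesis by (rule continuous_on_eq) (auto simp: \<sigma>_def)
  qed
  have cont: "continuous_on ({0..} \<times> {0..}) (\<lambda>(s, t). \<sigma> s t)"
    unfolding continuous_on_eq_continuous_within
  proof
    fix p assume p: "p \<in> {0::real..} \<times> {0::real..}"
    obtain s t where st: "p = (s, t)" "0 \<le> s" "0 \<le> t" using p by auto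
    show "continuous (at p within {0..} \<times> {0..}) (\<lambda>(s, t). \<sigma> s t)"
    proof (cases "s = 0")
      case False
      have "open ({0<..} \<times> (UNIV :: real set) :: (real \<times> real) set)" by (intro open_Times) auto
      then have "isCont (\<lambda>(s, t). \<sigma> s t) p"
        using cpos st False by (subst (asm) continuous_on_eq_continuous_at) auto
      then show ?thesis by (rule continuous_at_imp_continuous_at_within)
    next
      case True
      have "((\<lambda>(s, t). \<sigma> s t) \<longlongrightarrow> 0) (at p within {0..} \<times> {0..})"
      proof (rule tendsto_sandwich)
        show "((\<lambda>_. 0) \<longlongrightarrow> (0::real)) (at p within {0..} \<times> {0..})" by simp
        have "((\<lambda>q. fst q) \<longlongrightarrow> fst p) (at p within {0..} \<times> {0..})" by (intro tendsto_intros)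
        then show "((\<lambda>q. fst q) \<longlongrightarrow> 0) (at p within {0..} \<times> {0..})" using True st by simp
        show "\<forall>\<^sub>F q in at p within {0..} \<times> {0..}. 0 \<le> (case q of (s, t) \<Rightarrow> \<sigma> s t)"
          using \<sigma>nn by (auto intro!: always_eventually)
        show "\<forall>\<^sub>F q in at p within {0..} \<times> {0..}. (case q of (s, t) \<Rightarrow> \<sigma> s t) \<le> fst q"
          using \<sigma>le by (auto simp: eventually_at_filter intro!: always_eventually)
      qed
      then show ?thesis using True st by (simp add: continuous_within \<sigma>0)
    qed
  qed
  have "\<sigma> \<in> class_KL"
    unfolding class_KL_def
  proof (intro CollectI conjI allI impI)
    show "continuous_on ({0..} \<times> {0..}) (\<lambda>(s, t). \<sigma> s t)" by (rule cont)
    fix t :: real assume t: "0 \<le> t"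
    show "(\<lambda>s. \<sigma> s t) \<in> class_K"
      unfolding class_K_def pos_def_fun_def
    proof (intro CollectI conjI allI impI)
      show "continuous_on {0..} (\<lambda>s. \<sigma> s t)"
        using continuous_on_compose2[OF cont, of "{0..}" "\<lambda>s. (s, t)"] t by (force intro: continuous_intros)
      show "strict_mono_on {0..} (\<lambda>s. \<sigma> s t)"
      proof (rule strict_mono_onI)
        fix s s' :: real assume s: "s \<in> {0..}" "s' \<in> {0..}" "s < s'"
        show "\<sigma> s t < \<sigma> s' t"
        proof (cases "s = 0")
          case False
          then have "ln s < ln s'" using s by simp
          then have "E (ln s) < E (ln s')" using E(2)[of "ln s" "ln s'"] by simp
          then show ?thesis using False s I(2) by (simp add: \<sigma>_def)
        qed (use s in \<open>simp add: \<sigma>_def\<close>)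
      qed
    qed (auto simp: \<sigma>_def)
  next
    fix s :: real assume s: "0 \<le> s"
    show "antimono_on {0..} (\<sigma> s)"
      by (rule monotone_onI) (auto simp: \<sigma>_def intro!: I(1))
    show "(\<sigma> s \<longlongrightarrow> 0) at_top"
    proof (cases "s = 0")
      case False
      have "filterlim (\<lambda>t. I (E (ln s) - t)) at_bot at_top"
        unfolding filterlim_at_bot
      proof
        fix Z
        have "\<forall>\<^sub>F t in at_top. t \<ge> E (ln s) - E Z" by (rule eventually_ge_at_top)
        then show "\<forall>\<^sub>F t in at_top. I (E (ln s) - t) \<le> Z"
        proof eventually_elim
          case (elim t)
          then have "I (E (ln s) - t) \<le> I (E Z)" by (intro I(1)) simp
          then show ?case by (simp add: IE)
        qed
      qed
      then have "((\<lambda>t. exp (I (E (ln s) - t))) \<longlongrightarrow> 0) at_top" by (rule filterlim_compose[OF exp_at_bot])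
      then show ?thesis using False s by (simp add: \<sigma>_def[abs_def])
    qed (simp add: \<sigma>_def[abs_def])
  qed
  moreover have "W b \<le> max q (\<sigma> (W a) (b - a))"
    if ab: "a \<le> b" and Wc: "continuous_on {a..b} W" and N: "negligible N" and q: "0 \<le> q"
      and ev: "\<And>t. \<lbrakk>t \<in> {a..<b}; q \<le> W t\<rbrakk> \<Longrightarrow> right_slope_le W t C"
      and ae: "\<And>t. \<lbrakk>t \<in> {a..<b} - N; q \<le> W t\<rbrakk> \<Longrightarrow> right_slope_le W t (- \<rho> (W t))" for W a b q C N
  \<comment> \<open>Once \<open>W\<close> is at or below level \<open>q\<close> it stays there.
    Otherwise it is positive on the whole interval and the logarithm applies.\<close>
  proof (cases "\<exists>c\<in>{a..b}. W c \<le> q")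
    case True
    then obtain c where c: "c \<in> {a..b}" "W c \<le> q" by blast
    have "W b \<le> q"
    proof (rule right_slope_stays_below[of c b W N q C])
      show "continuous_on {c..b} W" by (rule continuous_on_subset[OF Wc]) (use c in auto)
      show "right_slope_le W t C" if "t \<in> {c..<b}" "q \<le> W t" for t using that c by (intro ev) auto
      show "right_slope_le W t 0" if "t \<in> {c..<b} - N" "q \<le> W t" for t
      proof (rule right_slope_le_mono)
        show "right_slope_le W t (- \<rho> (W t))" using that c by (intro ae) auto
        have "0 \<le> \<rho> (W t)" using \<rho>(2) q that(2) unfolding pos_def_fun_def by (cases "W t = 0") (auto simp: less_imp_le)
        then show "- \<rho> (W t) \<le> 0" by simp
      qed
    qed (use c N in auto)
    then show ?thesis by simp
  next
    case False
    then have Wq: "q < W t" if "t \<in> {a..b}" for t using that by force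
    then have Wpos: "0 < W t" if "t \<in> {a..b}" for t using that q by force
    \<comment> \<open>The speed of the flow along \<open>W\<close>. Its positive minimum over the
      interval turns \<open>C\<close> into a constant slope bound for \<phi>(W) at every
      time.\<close>
    define m where "m t = min (\<rho> (W t)) (W t)" for t
    have \<rho>W: "0 < \<rho> (W t)" if "t \<in> {a..b}" for t using \<rho>(2) Wpos[OF that] by (simp add: pos_def_fun_def)
    have mpos: "0 < m t" if "t \<in> {a..b}" for t using \<rho>W[OF that] Wpos[OF that] by (simp add: m_def)
    have "continuous_on {a..b} m"
      unfolding m_def by (intro continuous_intros Wc continuous_on_compose2[OF \<rho>(1) Wc]) (use Wpos in force)
    then obtain s where s: "s \<in> {a..b}" "\<And>t. t \<in> {a..b} \<Longrightarrow> m s \<le> m t"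
      using continuous_attains_inf[of "{a..b}" m] ab by auto
    define \<phi> where "\<phi> x = E (ln x)" for x
    have \<phi>d: "(\<phi> has_real_derivative 1 / m t) (at (W t))" if "t \<in> {a..b}" for t
    proof -
      have "((\<lambda>x. E (ln x)) has_real_derivative (exp (ln (W t)) / min (\<rho> (exp (ln (W t)))) (exp (ln (W t)))) * (1 / W t)) (at (W t))"
        by (rule DERIV_chain2[OF E(1)]) (use Wpos[OF that] in \<open>auto intro!: derivative_eq_intros\<close>)
      then show ?thesis using Wpos[OF that] by (simp add: \<phi>_def[abs_def] m_def)
    qed
    have \<phi>mono: "\<phi> x \<le> \<phi> y" if "0 < x" "x \<le> y" for x y
    proof -
      have "ln x \<le> ln y" using that by simp
      then show ?thesis using E(2)[of "ln x" "ln y"] by (simp add: \<phi>_def)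
    qed
    have chain: "right_slope_le (\<lambda>s. \<phi> (W s)) t (1 / m t * c)" if "t \<in> {a..<b}" "right_slope_le W t c" for t c
    proof (rule right_slope_le_compose[OF that(2) \<phi>d])
      show "0 < W (t + h)" if "0 < h" "h < b - t" for h using that \<open>t \<in> {a..<b}\<close> by (intro Wpos) auto
    qed (use that(1) mpos[of t] \<phi>mono in auto)
    \<comment> \<open>Since m <= \<rho>(W), the travel-time coordinate of \<open>W\<close> falls at
      rate at least 1; \<open>I\<close> and the exponential turn this back into a bound on
      \<open>W b\<close>.\<close>
    have "\<phi> (W b) \<le> \<phi> (W a) + (- 1) * (b - a)"
    proof (rule right_slope_growth[OF ab _ N])
      have "continuous_on {a..b} (\<lambda>t. ln (W t))"
        by (intro continuous_intros Wc) (use Wpos in force)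
      then show "continuous_on {a..b} (\<lambda>t. \<phi> (W t))"
        unfolding \<phi>_def by (intro continuous_on_compose2[OF Ec]) auto
      show "right_slope_le (\<lambda>t. \<phi> (W t)) t (\<bar>C\<bar> / m s)" if t: "t \<in> {a..<b}" for t
      proof (rule right_slope_le_mono[OF chain[OF t ev[OF t]]])
        have t': "t \<in> {a..b}" using t by auto
        show "q \<le> W t" using Wq[OF t'] by simp
        have "1 / m t * C \<le> 1 / m t * \<bar>C\<bar>" using mpos[OF t'] by (intro mult_left_mono) auto
        also have "\<dots> \<le> 1 / m s * \<bar>C\<bar>" using s(2)[OF t'] mpos[OF s(1)] by (intro mult_right_mono) (auto simp: frac_le)
        finally show "1 / m t * C \<le> \<bar>C\<bar> / m s" by simp
      qed
      show "right_slope_le (\<lambda>t. \<phi> (W t)) t (- 1)" if t: "t \<in> {a..<b} - N" for t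
      proof -
        have t': "t \<in> {a..b}" "t \<in> {a..<b}" using t by auto
        have "q \<le> W t" using Wq[OF t'(1)] by simp
        then have "right_slope_le (\<lambda>t. \<phi> (W t)) t (1 / m t * - \<rho> (W t))" by (rule chain[OF t'(2) ae[OF t]])
        moreover have "1 / m t * - \<rho> (W t) \<le> - 1"
          using mpos[OF t'(1)] by (simp add: m_def pos_le_divide_eq)
        ultimately show ?thesis by (rule right_slope_le_mono)
      qed
    qed
    then have "E (ln (W b)) \<le> E (ln (W a)) - (b - a)" by (simp add: \<phi>_def)
    then have "ln (W b) \<le> I (E (ln (W a)) - (b - a))" using I(1) IE by metis
    then have "exp (ln (W b)) \<le> exp (I (E (ln (W a)) - (b - a)))" by simp
    then have "W b \<le> \<sigma> (W a) (b - a)" using Wpos[of b] Wpos[of a] ab by (simp add: \<sigma>_def)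
    then show ?thesis by simp
  qed
  ultimately show ?thesis by (rule that)
qed

subsection \<open>Comparison functions\<close>

lemma class_KD:
  assumes "a \<in> class_K"
  shows "continuous_on {0..} a" "a 0 = 0" "\<lbrakk>0 \<le> x; x \<le> y\<rbrakk> \<Longrightarrow> a x \<le> a y" "\<lbrakk>0 \<le> x; x < y\<rbrakk> \<Longrightarrow> a x < a y"
    "0 \<le> x \<Longrightarrow> 0 \<le> a x" "0 < x \<Longrightarrow> 0 < a x"
proof -
  show s: "\<And>x y. \<lbrakk>0 \<le> x; x < y\<rbrakk> \<Longrightarrow> a x < a y"
    using assms unfolding class_K_def by (auto simp: strict_mono_on_def)
  show "continuous_on {0..} a" "a 0 = 0" "0 < x \<Longrightarrow> 0 < a x"
    using assms unfolding class_K_def pos_def_fun_def by auto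
  show "\<And>x y. \<lbrakk>0 \<le> x; x \<le> y\<rbrakk> \<Longrightarrow> a x \<le> a y" using s by (auto simp: le_less)
  then show "0 \<le> x \<Longrightarrow> 0 \<le> a x" using \<open>a 0 = 0\<close> by force
qed

lemma class_ND:
  assumes "g \<in> class_N"
  shows "\<lbrakk>0 \<le> x; x \<le> y\<rbrakk> \<Longrightarrow> g x \<le> g y" "0 \<le> x \<Longrightarrow> 0 \<le> g x" "g 0 = 0"
  using assms unfolding class_N_def by (auto simp: monotone_on_def)

text \<open>Continuity of the inverse at \<open>y\<close> is local: on a compact interval whose
  image is [0, y + 1] the inverse of a continuous injection is continuous.\<close>

lemma class_Kinf_inverse:
  assumes a: "a \<in> class_Kinf"
  shows "0 \<le> y \<Longrightarrow> a (inv_into {0..} a y) = y" "0 \<le> x \<Longrightarrow> inv_into {0..} a (a x) = x"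
    "inv_into {0..} a \<in> class_K"
proof -
  have aK: "a \<in> class_K" using a by (simp add: class_Kinf_def)
  note K = class_KD[OF aK]
  have inj: "inj_on a {0..}" using K(4) by (intro inj_onI) (metis atLeast_iff linorder_neqE order_less_irrefl)
  have surj: "\<exists>x\<ge>0. a x = y" if "0 \<le> y" for y
  proof -
    have "filterlim a at_top at_top" using a by (simp add: class_Kinf_def)
    then have "\<forall>\<^sub>F x in at_top. y \<le> a x \<and> 0 \<le> x"
      by (auto simp: filterlim_at_top intro: eventually_conj eventually_ge_at_top)
    then obtain b where "y \<le> a b" "0 \<le> b" by (auto simp: eventually_at_top_linorder)
    then show ?thesis using IVT'[of a 0 y b] K(2) that continuous_on_subset[OF K(1), of "{0..b}"] by auto
  qed
  show ai: "a (inv_into {0..} a y) = y" if "0 \<le> y" for y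
    using surj[OF that] by (intro f_inv_into_f) auto
  show ia: "inv_into {0..} a (a x) = x" if "0 \<le> x" for x using inj that by (simp add: inv_into_f_f)
  have i0: "0 \<le> inv_into {0..} a y" if "0 \<le> y" for y
    using inv_into_into[of y a "{0..}"] surj[OF that] by auto
  have strict: "inv_into {0..} a x < inv_into {0..} a y" if "0 \<le> x" "x < y" for x y
  proof (rule ccontr)
    assume "\<not> inv_into {0..} a x < inv_into {0..} a y"
    then have "a (inv_into {0..} a y) \<le> a (inv_into {0..} a x)" using i0 that by (intro K(3)) auto
    then show False using ai that by simp
  qed
  have zero: "inv_into {0..} a 0 = 0" using ia[of 0] K(2) by simp
  have "continuous_on {0..} (inv_into {0..} a)"
    unfolding continuous_on_eq_continuous_within
  proof
    fix y :: real assume y: "y \<in> {0..}"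
    define b where "b = inv_into {0..} a (y + 1)"
    have b: "0 \<le> b" "a b = y + 1" using y i0 ai by (auto simp: b_def)
    have "continuous_on (a ` {0..b}) (inv_into {0..} a)"
      by (rule continuous_on_inv) (use K(1) ia in \<open>auto intro: continuous_on_subset\<close>)
    moreover have "a ` {0..b} = {0..y + 1}"
    proof
      show "a ` {0..b} \<subseteq> {0..y + 1}"
      proof (rule image_subsetI)
        fix x assume "x \<in> {0..b}"
        then show "a x \<in> {0..y + 1}" using K(3)[of x b] K(5)[of x] b by simp
      qed
      show "{0..y + 1} \<subseteq> a ` {0..b}"
      proof
        fix z assume "z \<in> {0..y + 1}"
        then show "z \<in> a ` {0..b}"
          using IVT'[of a 0 z b] K(2) b continuous_on_subset[OF K(1), of "{0..b}"] by auto
      qed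
    qed
    ultimately have "continuous (at y within {0..y + 1}) (inv_into {0..} a)"
      using y by (simp add: continuous_on_eq_continuous_within)
    moreover have "at y within {0..} = at y within {0..y + 1}"
      by (rule at_within_nhd[of y "{..<y + 1}"]) auto
    ultimately show "continuous (at y within {0..}) (inv_into {0..} a)" by simp
  qed
  then show "inv_into {0..} a \<in> class_K"
    unfolding class_K_def pos_def_fun_def using strict zero strict[of 0] by (auto simp: strict_mono_on_def)
qed

lemma class_K_compose:
  assumes "a \<in> class_K" "b \<in> class_K"
  shows "(\<lambda>s. a (b s)) \<in> class_K"
proof -
  note A = class_KD[OF assms(1)] and B = class_KD[OF assms(2)]
  have "continuous_on {0..} (\<lambda>s. a (b s))" by (rule continuous_on_compose2[OF A(1) B(1)]) (use B(5) in auto)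
  then show ?thesis unfolding class_K_def pos_def_fun_def using A B by (auto simp: strict_mono_on_def)
qed

lemma class_KL_compose:
  assumes s: "\<sigma> \<in> class_KL" and a: "a \<in> class_K" and b: "b \<in> class_K"
  shows "(\<lambda>s t. a (\<sigma> (b s) t)) \<in> class_KL"
proof -
  note A = class_KD[OF a] and B = class_KD[OF b]
  have sc: "continuous_on ({0..} \<times> {0..}) (\<lambda>(s, t). \<sigma> s t)"
    and sK: "\<And>t. 0 \<le> t \<Longrightarrow> (\<lambda>s. \<sigma> s t) \<in> class_K"
    and sm: "\<And>s. 0 \<le> s \<Longrightarrow> antimono_on {0..} (\<sigma> s)" and sl: "\<And>s. 0 \<le> s \<Longrightarrow> (\<sigma> s \<longlongrightarrow> 0) at_top"
    using s unfolding class_KL_def by auto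
  have pos: "0 \<le> \<sigma> s t" if "0 \<le> s" "0 \<le> t" for s t using class_KD(5)[OF sK] that by blast
  show ?thesis
    unfolding class_KL_def
  proof (intro CollectI conjI allI impI)
    have "continuous_on ({0..} \<times> {0..}) (\<lambda>p :: real \<times> real. b (fst p))"
      by (rule continuous_on_compose2[OF B(1) continuous_on_fst[OF continuous_on_id]]) auto
    then have "continuous_on ({0..} \<times> {0..}) (\<lambda>p. (b (fst p), snd p) :: real \<times> real)"
      by (intro continuous_on_Pair continuous_on_snd continuous_on_id)
    then have "continuous_on ({0..} \<times> {0..}) (\<lambda>p. (\<lambda>(s, t). \<sigma> s t) (b (fst p), snd p))"
      by (rule continuous_on_compose2[OF sc]) (auto intro: B(5))
    then have "continuous_on ({0..} \<times> {0..}) (\<lambda>p. a ((\<lambda>(s, t). \<sigma> s t) (b (fst p), snd p)))"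
      by (rule continuous_on_compose2[OF A(1)]) (auto intro!: pos B(5))
    then show "continuous_on ({0..} \<times> {0..}) (\<lambda>(s, t). a (\<sigma> (b s) t))" by (simp add: case_prod_unfold)
    show "(\<lambda>s. a (\<sigma> (b s) t)) \<in> class_K" if "0 \<le> t" for t
      by (rule class_K_compose[OF a class_K_compose[OF sK[OF that] b]])
    fix s :: real assume s: "0 \<le> s"
    show "antimono_on {0..} (\<lambda>t. a (\<sigma> (b s) t))"
      using sm[OF B(5)[OF s]] pos[OF B(5)[OF s]] by (auto simp: monotone_on_def intro!: A(3))
    have "((\<lambda>t. a (\<sigma> (b s) t)) \<longlongrightarrow> a 0) at_top"
    proof (rule continuous_within_tendsto_compose[of 0 "{0..}" a])
      show "continuous (at 0 within {0..}) a" using A(1) by (simp add: continuous_on_eq_continuous_within)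
      show "\<forall>\<^sub>F t in at_top. \<sigma> (b s) t \<in> {0..}"
        using eventually_ge_at_top[of "0 :: real"] by eventually_elim (use pos B(5)[OF s] in simp)
      show "((\<lambda>t. \<sigma> (b s) t) \<longlongrightarrow> 0) at_top" by (rule sl[OF B(5)[OF s]])
    qed
    then show "((\<lambda>t. a (\<sigma> (b s) t)) \<longlongrightarrow> 0) at_top" by (simp add: A(2))
  qed
qed

text \<open>Supplies a monotone continuous majorant of a continuous function, which the growth
  estimate needs for \<phi> and for 1 / \<mu>.\<close>

lemma running_sup:
  fixes g :: "real \<Rightarrow> real"
  assumes g: "continuous_on {0..} g"
  defines "m \<equiv> \<lambda>t. SUP s\<in>{0..t}. g s"
  shows running_sup_upper: "\<lbrakk>0 \<le> s; s \<le> t\<rbrakk> \<Longrightarrow> g s \<le> m t"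
    and running_sup_mono: "\<lbrakk>0 \<le> s; s \<le> t\<rbrakk> \<Longrightarrow> m s \<le> m t"
    and running_sup_continuous: "continuous_on {0..} m"
proof -
  have bdd: "bdd_above (g ` {0..t})" for t
    using g by (intro bounded_imp_bdd_above compact_imp_bounded compact_continuous_image)
      (auto intro: continuous_on_subset)
  show up: "g s \<le> m t" if "0 \<le> s" "s \<le> t" for s t
    unfolding m_def using that bdd by (intro cSUP_upper) auto
  have least: "m t \<le> z" if "0 \<le> t" "\<And>s. \<lbrakk>0 \<le> s; s \<le> t\<rbrakk> \<Longrightarrow> g s \<le> z" for t z
    unfolding m_def using that by (intro cSUP_least) auto
  show mono: "m s \<le> m t" if "0 \<le> s" "s \<le> t" for s t
    using that up by (intro least) auto
  show "continuous_on {0..} m"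
  proof (rule continuous_onI)
    fix t e :: real assume t: "t \<in> {0..}" and e: "e > 0"
    obtain d where d: "d > 0" "\<And>s. s \<in> {0..} \<Longrightarrow> dist s t < d \<Longrightarrow> dist (g s) (g t) < e / 2"
      using g t e unfolding continuous_on_iff by (meson half_gt_zero)
    \<comment> \<open>Values entering the supremum between \<open>t1\<close> and \<open>t2\<close>
      lie within \<open>e\<close> of \<open>g t1\<close>, since all these times are close to
      \<open>t\<close>.\<close>
    have step: "m t2 \<le> m t1 + e" if "0 \<le> t1" "t1 \<le> t2" "dist t1 t < d" "dist t2 t < d" for t1 t2
    proof (rule least)
      fix s assume s: "0 \<le> s" "s \<le> t2"
      show "g s \<le> m t1 + e"
      proof (cases "s \<le> t1")
        case True
        then show ?thesis using up[of s t1] s e by simp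
      next
        case False
        then have "dist s t < d" using that s by (auto simp: dist_real_def)
        then have "dist (g s) (g t) < e / 2" "dist (g t1) (g t) < e / 2"
          using d(2)[of s] d(2)[of t1] that s by auto
        then have "g s < g t1 + e" unfolding dist_real_def by linarith
        then show ?thesis using up[of t1 t1] that by simp
      qed
    qed (use that in auto)
    have "dist (m t') (m t) \<le> e" if "t' \<in> {0..}" "dist t' t < d" for t'
      using step[of t t'] step[of t' t] mono[of t t'] mono[of t' t] that t d(1)
      by (cases "t \<le> t'") (auto simp: dist_real_def)
    then show "\<exists>d>0. \<forall>t'\<in>{0..}. dist t' t < d \<longrightarrow> dist (m t') (m t) \<le> e" using d(1) by blast
  qed
qed

text \<open>A gain of class N may be discontinuous, so compactness alone does not bound it;
  monotonicity does. Boundedness is what gives the real suprema in the estimates their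
  meaning.\<close>

lemma bdd_above_gain:
  fixes w :: "real \<Rightarrow> 'a::real_normed_vector"
  assumes g: "\<And>x y. \<lbrakk>0 \<le> x; x \<le> y\<rbrakk> \<Longrightarrow> g x \<le> (g y :: real)" and \<delta>: "\<delta> \<in> class_Kplus" and t0: "0 \<le> t0"
    and w: "\<And>s. s \<in> {0..t} \<Longrightarrow> norm (w s) \<le> B"
  shows "bdd_above ((\<lambda>s. g (\<delta> s * norm (w s))) ` {t0..t})"
proof -
  have "bounded (\<delta> ` {0..t})"
    using \<delta> unfolding class_Kplus_def
    by (intro compact_imp_bounded compact_continuous_image) (auto intro: continuous_on_subset)
  then obtain c where c: "c > 0" "\<And>s. s \<in> {0..t} \<Longrightarrow> \<bar>\<delta> s\<bar> \<le> c" unfolding bounded_pos by auto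
  have "g (\<delta> s * norm (w s)) \<le> g (c * B)" if "s \<in> {t0..t}" for s
  proof (rule g)
    have s: "s \<in> {0..t}" using that t0 by auto
    have \<delta>s: "0 < \<delta> s" using \<delta> s by (auto simp: class_Kplus_def)
    show "0 \<le> \<delta> s * norm (w s)" using \<delta>s by simp
    show "\<delta> s * norm (w s) \<le> c * B"
      using c(1) c(2)[OF s] w[OF s] \<delta>s by (intro mult_mono) auto
  qed
  then show ?thesis by (intro bdd_aboveI2)
qed

section \<open>A priori bounds for V along solutions\<close>

context lyapunov_system
begin

text \<open>The KL function comes from \<rho> alone and is fixed before data, inputs and times,
  which gives the uniformity required in (i). \<open>q\<close> stands for any bound of the gains on
  [t0, t].\<close>

lemma V_estimate:
  obtains \<sigma> where "\<sigma> \<in> class_KL"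
    "\<And>t0 x0 v u d t x q. \<lbrakk>admissible_data r D U S2 t0 x0 v u d;
       functional_ode.sol r t0 (\<lambda>t \<xi>. f t (d t) \<xi> (u t) (v t)) t x; t0 \<le> t; 0 \<le> q;
       \<And>s. s \<in> {t0..t} \<Longrightarrow> max (\<zeta> (\<delta>1 s * norm (v s))) (\<zeta>u (\<delta>1u s * norm (u s))) \<le> q\<rbrakk>
      \<Longrightarrow> V t (Tr r t x) \<le> max q (\<sigma> (V t0 (Tr r t0 x)) (t - t0))"
proof (rule comparison_KL[OF rho])
  fix \<sigma> assume \<sigma>: "\<sigma> \<in> class_KL"
    "\<And>W a b q C N. \<lbrakk>a \<le> b; continuous_on {a..b} W; negligible N; 0 \<le> q;
      \<And>t. \<lbrakk>t \<in> {a..<b}; q \<le> W t\<rbrakk> \<Longrightarrow> right_slope_le W t C;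
      \<And>t. \<lbrakk>t \<in> {a..<b} - N; q \<le> W t\<rbrakk> \<Longrightarrow> right_slope_le W t (- \<rho> (W t))\<rbrakk>
      \<Longrightarrow> W b \<le> max q (\<sigma> (W a) (b - a))"
  show ?thesis
  proof (rule that[OF \<sigma>(1)])
    fix t0 x0 v u d t x q
    assume adm: "admissible_data r D U S2 t0 x0 v u d"
      and x: "functional_ode.sol r t0 (\<lambda>t \<xi>. f t (d t) \<xi> (u t) (v t)) t x" and t: "t0 \<le> t" and q: "0 \<le> q"
      "\<And>s. s \<in> {t0..t} \<Longrightarrow> max (\<zeta> (\<delta>1 s * norm (v s))) (\<zeta>u (\<delta>1u s * norm (u s))) \<le> q"
    interpret functional_ode r t0 "\<lambda>t \<xi>. f t (d t) \<xi> (u t) (v t)" by (rule functional_ode_inputs[OF adm])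
    let ?W = "\<lambda>t. V t (Tr r t x)"
    show "V t (Tr r t x) \<le> max q (\<sigma> (V t0 (Tr r t0 x)) (t - t0))"
    proof (rule V_slopes[OF adm x t])
      fix C N assume N: "negligible N"
        and C: "\<And>s. \<lbrakk>s \<in> {t0..<t}; max (\<zeta> (\<delta>1 s * norm (v s))) (\<zeta>u (\<delta>1u s * norm (u s))) \<le> ?W s\<rbrakk> \<Longrightarrow> right_slope_le ?W s C"
        and ae: "\<And>s. \<lbrakk>s \<in> {t0..<t} - N; max (\<zeta> (\<delta>1 s * norm (v s))) (\<zeta>u (\<delta>1u s * norm (u s))) \<le> ?W s\<rbrakk>
          \<Longrightarrow> right_slope_le ?W s (- \<rho> (?W s))"
      have "continuous_on {t0..t} ?W"
        by (rule continuous_V_along) (use inputs(1)[OF adm] x in \<open>auto simp: sol_def\<close>)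
      then show ?thesis
      proof (rule \<sigma>(2)[OF t _ N q(1)])
        show "right_slope_le ?W s C" if s: "s \<in> {t0..<t}" and qW: "q \<le> ?W s" for s
        proof (rule C[OF s])
          have "s \<in> {t0..t}" using s by auto
          then show "max (\<zeta> (\<delta>1 s * norm (v s))) (\<zeta>u (\<delta>1u s * norm (u s))) \<le> ?W s" using q(2) qW order_trans by blast
        qed
        show "right_slope_le ?W s (- \<rho> (?W s))" if s: "s \<in> {t0..<t} - N" and qW: "q \<le> ?W s" for s
        proof (rule ae[OF s])
          have "s \<in> {t0..t}" using s by auto
          then show "max (\<zeta> (\<delta>1 s * norm (v s))) (\<zeta>u (\<delta>1u s * norm (u s))) \<le> ?W s" using q(2) qW order_trans by blast
        qed
      qed
    qed
  qed
qed

text \<open>A level above the gains and the initial value is never exceeded: where V is at or above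
  it, the slope is nonpositive at almost every time.\<close>

lemma V_max_bound:
  assumes adm: "admissible_data r D U S2 t0 x0 v u d"
    and x: "functional_ode.sol r t0 (\<lambda>t \<xi>. f t (d t) \<xi> (u t) (v t)) t x" and t: "t0 \<le> t"
    and q: "\<And>s. s \<in> {t0..t} \<Longrightarrow> max (\<zeta> (\<delta>1 s * norm (v s))) (\<zeta>u (\<delta>1u s * norm (u s))) \<le> q"
      "V t0 (Tr r t0 x) \<le> q"
  shows "V t (Tr r t x) \<le> q"
proof -
  interpret functional_ode r t0 "\<lambda>t \<xi>. f t (d t) \<xi> (u t) (v t)" by (rule functional_ode_inputs[OF adm])
  let ?W = "\<lambda>t. V t (Tr r t x)"
  note t0 = inputs(1)[OF adm]
  have cx: "continuous_on {t0 - r..t} x" using x by (simp add: sol_def)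
  have W0: "0 \<le> ?W s" if "s \<in> {t0..t}" for s
    using that t0 by (intro V_nonneg Tr_mem continuous_on_subset[OF cx]) auto
  show ?thesis
  proof (rule V_slopes[OF adm x t])
    fix C N assume N: "negligible N"
      and C: "\<And>s. \<lbrakk>s \<in> {t0..<t}; max (\<zeta> (\<delta>1 s * norm (v s))) (\<zeta>u (\<delta>1u s * norm (u s))) \<le> ?W s\<rbrakk> \<Longrightarrow> right_slope_le ?W s C"
      and ae: "\<And>s. \<lbrakk>s \<in> {t0..<t} - N; max (\<zeta> (\<delta>1 s * norm (v s))) (\<zeta>u (\<delta>1u s * norm (u s))) \<le> ?W s\<rbrakk>
        \<Longrightarrow> right_slope_le ?W s (- \<rho> (?W s))"
    have "continuous_on {t0..t} ?W" by (rule continuous_V_along[OF t0 cx])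
    then show ?thesis
    proof (rule right_slope_stays_below[OF _ N t])
      show "right_slope_le ?W s C" if s: "s \<in> {t0..<t}" and qW: "q \<le> ?W s" for s
      proof (rule C[OF s])
        have "s \<in> {t0..t}" using s by auto
        then show "max (\<zeta> (\<delta>1 s * norm (v s))) (\<zeta>u (\<delta>1u s * norm (u s))) \<le> ?W s" using q(1) qW order_trans by blast
      qed
      show "right_slope_le ?W s 0" if s: "s \<in> {t0..<t} - N" and qW: "q \<le> ?W s" for s
      proof (rule right_slope_le_mono)
        have s': "s \<in> {t0..t}" using s by auto
        then show "right_slope_le ?W s (- \<rho> (?W s))" using q(1) qW order_trans by (intro ae[OF s]) blast
        show "- \<rho> (?W s) \<le> 0" using rho_nonneg[OF W0[OF s']] by simp
      qed
    qed (rule q(2))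
  qed
qed

end

subsection \<open>Output estimate and growth estimate\<close>

context lyapunov_system
begin

lemma maximal_solution_sol:
  assumes adm: "admissible_data r D U S2 t0 x0 v u d" and x: "maximal_solution r f t0 x0 v u d \<infinity> x"
    and t: "t0 \<le> t"
  shows "functional_ode.sol r t0 (\<lambda>t \<xi>. f t (d t) \<xi> (u t) (v t)) t x" "Tr r t0 x = x0"
    "continuous_on {t0 - r..t} x"
proof -
  interpret functional_ode r t0 "\<lambda>t \<xi>. f t (d t) \<xi> (u t) (v t)" by (rule functional_ode_inputs[OF adm])
  have xs: "is_solution r f t0 x0 v u d \<infinity> x" using x by (simp add: maximal_solution_def)
  show "sol t x" by (rule is_solution_imp_sol[OF adm xs t]) simp
  then show "continuous_on {t0 - r..t} x" by (simp add: sol_def)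
  show "Tr r t0 x = x0" using xs by (simp add: is_solution_def)
qed

text \<open>V is compared with the level a1(max c1 c2), where \<open>c1\<close> and
  \<open>c2\<close> are the suprema of the gains already composed with the inverse of
  \<open>a1\<close>. Applying that inverse to the estimate for V returns \<open>c1\<close> and
  \<open>c2\<close> exactly, and a maximum of nonnegative terms is at most their sum.\<close>

lemma output_estimate:
  assumes cl: "a1 \<in> class_Kinf" "a2 \<in> class_Kinf" "\<zeta> \<in> class_N" "\<zeta>u \<in> class_N"
      "\<beta> \<in> class_Kplus" "\<delta>1 \<in> class_Kplus" "\<delta>1u \<in> class_Kplus"
    and V_upper: "\<forall>t\<ge>0. \<forall>x\<in>mspace (C0 r). V t x \<le> a2 (\<beta> t * hnorm r x)"
    and A: "\<forall>t\<ge>0. \<forall>x\<in>mspace (C0 r). a1 (norm (H t x)) \<le> V t x"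
  shows "\<exists>\<sigma>1\<in>class_KL. \<forall>t0 x0 v u d x.
    admissible_data r D U S2 t0 x0 v u d \<and> maximal_solution r f t0 x0 v u d \<infinity> x \<longrightarrow>
         (\<forall>t\<ge>t0. norm (H t (Tr r t x)) \<le>
            \<sigma>1 (\<beta> t0 * hnorm r x0) (t - t0)
            + (SUP s\<in>{t0..t}. inv_into {0..} a1 (\<zeta> (\<delta>1 s * norm (v s))))
            + (SUP s\<in>{t0..t}. inv_into {0..} a1 (\<zeta>u (\<delta>1u s * norm (u s)))))"
proof (rule V_estimate)
  define ai where "ai = inv_into {0..} a1"
  have a1K: "a1 \<in> class_K" and a2K: "a2 \<in> class_K" using cl by (auto simp: class_Kinf_def)
  note a1 = class_KD[OF a1K] and a2 = class_KD[OF a2K]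
  have aiK: "ai \<in> class_K" unfolding ai_def by (rule class_Kinf_inverse[OF cl(1)])
  note ai = class_KD[OF aiK]
  have a1ai: "a1 (ai y) = y" if "0 \<le> y" for y unfolding ai_def by (rule class_Kinf_inverse(1)[OF cl(1) that])
  have aia1: "ai (a1 y) = y" if "0 \<le> y" for y unfolding ai_def by (rule class_Kinf_inverse(2)[OF cl(1) that])
  fix \<sigma> assume \<sigma>: "\<sigma> \<in> class_KL"
    and est: "\<And>t0 x0 v u d t x q. \<lbrakk>admissible_data r D U S2 t0 (x0 :: real \<Rightarrow> real ^ 'n) v u d;
       functional_ode.sol r t0 (\<lambda>t \<xi>. f t (d t) \<xi> (u t) (v t)) t x; t0 \<le> t; 0 \<le> q;
       \<And>s. s \<in> {t0..t} \<Longrightarrow> max (\<zeta> (\<delta>1 s * norm (v s))) (\<zeta>u (\<delta>1u s * norm (u s))) \<le> q\<rbrakk>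
      \<Longrightarrow> V t (Tr r t x) \<le> max q (\<sigma> (V t0 (Tr r t0 x)) (t - t0))"
  \<comment> \<open>The upper bound on V at the initial time enters through the first argument, the
    inverse of \<open>a1\<close> through the value.\<close>
  define \<sigma>1 where "\<sigma>1 s t = ai (\<sigma> (a2 s) t)" for s t
  have "\<sigma>1 \<in> class_KL" unfolding \<sigma>1_def[abs_def] by (rule class_KL_compose[OF \<sigma> aiK a2K])
  moreover have "norm (H t (Tr r t x)) \<le> \<sigma>1 (\<beta> t0 * hnorm r x0) (t - t0)
            + (SUP s\<in>{t0..t}. ai (\<zeta> (\<delta>1 s * norm (v s)))) + (SUP s\<in>{t0..t}. ai (\<zeta>u (\<delta>1u s * norm (u s))))"
    if adm: "admissible_data r D U S2 t0 x0 v u d" and x: "maximal_solution r f t0 x0 v u d \<infinity> x" and t: "t0 \<le> t"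
    for t0 x0 v u d x t
  proof -
    note inp = inputs[OF adm] and sol = maximal_solution_sol[OF adm x t]
    obtain B where B: "\<And>s. s \<in> {0..t} \<Longrightarrow> norm (v s) \<le> B" "\<And>s. s \<in> {0..t} \<Longrightarrow> norm (u s) \<le> B"
      using inp(6)[of t] by blast
    have \<delta>pos: "0 \<le> \<delta>1 s * norm (v s)" "0 \<le> \<delta>1u s * norm (u s)" if "s \<in> {t0..t}" for s
      using cl(6,7) that inp(1) by (auto simp: class_Kplus_def less_imp_le)
    have aimono: "ai (\<zeta> x) \<le> ai (\<zeta> y)" "ai (\<zeta>u x) \<le> ai (\<zeta>u y)" if "0 \<le> x" "x \<le> y" for x y
      using class_ND[OF cl(3)] class_ND[OF cl(4)] that by (auto intro!: ai(3))
    define c1 where "c1 = (SUP s\<in>{t0..t}. ai (\<zeta> (\<delta>1 s * norm (v s))))"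
    define c2 where "c2 = (SUP s\<in>{t0..t}. ai (\<zeta>u (\<delta>1u s * norm (u s))))"
    have c1: "ai (\<zeta> (\<delta>1 s * norm (v s))) \<le> c1" if "s \<in> {t0..t}" for s
      unfolding c1_def by (rule cSUP_upper[OF that])
        (rule bdd_above_gain[of "\<lambda>y. ai (\<zeta> y)", OF aimono(1) cl(6) inp(1) B(1)])
    have c2: "ai (\<zeta>u (\<delta>1u s * norm (u s))) \<le> c2" if "s \<in> {t0..t}" for s
      unfolding c2_def by (rule cSUP_upper[OF that])
        (rule bdd_above_gain[of "\<lambda>y. ai (\<zeta>u y)", OF aimono(2) cl(7) inp(1) B(2)])
    have ai0: "0 \<le> ai (\<zeta> (\<delta>1 s * norm (v s)))" "0 \<le> ai (\<zeta>u (\<delta>1u s * norm (u s)))" if "s \<in> {t0..t}" for s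
      using \<delta>pos[OF that] class_ND(2)[OF cl(3)] class_ND(2)[OF cl(4)] by (auto intro!: ai(5))
    have c0: "0 \<le> c1" "0 \<le> c2" using ai0[of t0] c1[of t0] c2[of t0] t by auto
    have q: "max (\<zeta> (\<delta>1 s * norm (v s))) (\<zeta>u (\<delta>1u s * norm (u s))) \<le> a1 (max c1 c2)" if s: "s \<in> {t0..t}" for s
    proof -
      have "a1 (ai (\<zeta> (\<delta>1 s * norm (v s)))) \<le> a1 (max c1 c2)" "a1 (ai (\<zeta>u (\<delta>1u s * norm (u s)))) \<le> a1 (max c1 c2)"
        using c1[OF s] c2[OF s] ai0[OF s] by (auto intro!: a1(3))
      then show ?thesis using a1ai class_ND(2)[OF cl(3) \<delta>pos(1)[OF s]] class_ND(2)[OF cl(4) \<delta>pos(2)[OF s]] by simp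
    qed
    have hx0: "0 \<le> hnorm r x0" using inp(2) by (intro hnorm_nonneg r_nonneg) (simp add: C0_mem)
    have \<beta>0: "0 \<le> \<beta> t0" using cl(5) inp(1) by (auto simp: class_Kplus_def less_imp_le)
    have \<sigma>K: "(\<lambda>s. \<sigma> s (t - t0)) \<in> class_K" using \<sigma> t by (auto simp: class_KL_def)
    have V00: "0 \<le> V t0 x0" by (rule V_nonneg[OF inp(1,2)])
    have "V t (Tr r t x) \<le> max (a1 (max c1 c2)) (\<sigma> (V t0 x0) (t - t0))"
      using est[OF adm sol(1) t _ q] a1(5) c0 sol(2) by auto
    also have "\<dots> \<le> max (a1 (max c1 c2)) (\<sigma> (a2 (\<beta> t0 * hnorm r x0)) (t - t0))"
      using class_KD(3)[OF \<sigma>K V00 V_upper[rule_format, OF inp(1,2)]] by auto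
    finally have Vle: "V t (Tr r t x) \<le> max (a1 (max c1 c2)) (\<sigma> (a2 (\<beta> t0 * hnorm r x0)) (t - t0))" .
    have mem: "Tr r t x \<in> mspace (C0 r)" by (intro Tr_mem continuous_on_subset[OF sol(3)]) (use t in auto)
    have "norm (H t (Tr r t x)) = ai (a1 (norm (H t (Tr r t x))))" by (simp add: aia1)
    also have "\<dots> \<le> ai (max (a1 (max c1 c2)) (\<sigma> (a2 (\<beta> t0 * hnorm r x0)) (t - t0)))"
      using order_trans[OF A[rule_format, OF _ mem] Vle] inp(1) t by (intro ai(3) a1(5)) auto
    also have "\<dots> \<le> max (max c1 c2) (\<sigma>1 (\<beta> t0 * hnorm r x0) (t - t0))"
      using aia1[of "max c1 c2"] c0 by (auto simp: \<sigma>1_def max_def)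
    also have "\<dots> \<le> \<sigma>1 (\<beta> t0 * hnorm r x0) (t - t0) + c1 + c2"
    proof -
      have "0 \<le> \<sigma>1 (\<beta> t0 * hnorm r x0) (t - t0)"
        unfolding \<sigma>1_def using hx0 \<beta>0 by (intro ai(5) class_KD(5)[OF \<sigma>K] a2(5)) auto
      then show ?thesis using c0 by auto
    qed
    finally show ?thesis unfolding c1_def c2_def .
  qed
  ultimately show ?thesis unfolding ai_def by blast
qed

text \<open>With \<delta>1 = 1 the gain on \<open>v\<close> is \<zeta>(|v|), the form in which (E)
  measures \<open>v\<close>. As \<open>p\<close> is increasing, p(\<mu> |x|) <= p g bounds the
  state, so (ii) reduces to choosing a level \<open>q\<close> and a \<open>g\<close> with q + R <= p
  g.\<close>

lemma state_bound:
  assumes cl: "a2 \<in> class_Kinf" "p \<in> class_Kinf" "\<mu> \<in> class_Kplus"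
    and R: "0 \<le> R" and \<delta>1: "\<forall>t\<ge>0. \<delta>1 t = 1"
    and V_upper: "\<forall>t\<ge>0. \<forall>x\<in>mspace (C0 r). V t x \<le> a2 (\<beta> t * hnorm r x)"
    and B: "\<forall>t\<ge>0. \<forall>x\<in>mspace (C0 r). p (\<mu> t * norm (x 0)) \<le> V t x + R"
    and adm: "admissible_data r D U S2 t0 x0 v u d"
    and x: "functional_ode.sol r t0 (\<lambda>t \<xi>. f t (d t) \<xi> (u t) (v t)) t x" and init: "Tr r t0 x = x0" and t: "t0 \<le> t"
    and q: "\<And>s. s \<in> {t0..t} \<Longrightarrow> \<zeta> (norm (v s)) \<le> q" "\<And>s. s \<in> {t0..t} \<Longrightarrow> \<zeta>u (\<delta>1u s * norm (u s)) \<le> q"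
      "a2 (\<beta> t0 * hnorm r x0) \<le> q" and g: "0 \<le> g" "q + R \<le> p g"
  shows "\<mu> t * norm (x t) \<le> g"
proof -
  interpret functional_ode r t0 "\<lambda>t \<xi>. f t (d t) \<xi> (u t) (v t)" by (rule functional_ode_inputs[OF adm])
  note inp = inputs[OF adm]
  have pK: "p \<in> class_K" using cl by (simp add: class_Kinf_def)
  have cx: "continuous_on {t0 - r..t} x" using x by (simp add: sol_def)
  have mem: "Tr r t x \<in> mspace (C0 r)" by (intro Tr_mem continuous_on_subset[OF cx]) (use t in auto)
  have "V t (Tr r t x) \<le> q"
  proof (rule V_max_bound[OF adm x t])
    show "max (\<zeta> (\<delta>1 s * norm (v s))) (\<zeta>u (\<delta>1u s * norm (u s))) \<le> q" if "s \<in> {t0..t}" for s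
      using q(1,2)[OF that] \<delta>1 inp(1) that by simp
    show "V t0 (Tr r t0 x) \<le> q" using V_upper[rule_format, OF inp(1,2)] q(3) init by simp
  qed
  then have "p (\<mu> t * norm (x t)) \<le> p g"
    using B[rule_format, OF _ mem, of t] g(2) inp(1) t r by (simp add: Tr_apply)
  then show ?thesis using class_KD(4)[OF pK g(1), of "\<mu> t * norm (x t)"] by (meson not_le)
qed

lemma solutions_exist:
  assumes cl: "a2 \<in> class_Kinf" "p \<in> class_Kinf" "\<mu> \<in> class_Kplus" "\<zeta> \<in> class_N" "\<zeta>u \<in> class_N" "\<delta>1u \<in> class_Kplus"
    and R: "0 \<le> R" and \<delta>1: "\<forall>t\<ge>0. \<delta>1 t = 1"
    and V_upper: "\<forall>t\<ge>0. \<forall>x\<in>mspace (C0 r). V t x \<le> a2 (\<beta> t * hnorm r x)"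
    and B: "\<forall>t\<ge>0. \<forall>x\<in>mspace (C0 r). p (\<mu> t * norm (x 0)) \<le> V t x + R"
    and adm: "admissible_data r D U S2 t0 x0 v u d"
  shows "\<exists>x. maximal_solution r f t0 x0 v u d \<infinity> x"
proof (rule maximal_solution_exists[OF adm])
  interpret functional_ode r t0 "\<lambda>t \<xi>. f t (d t) \<xi> (u t) (v t)" by (rule functional_ode_inputs[OF adm])
  note inp = inputs[OF adm]
  fix T
  have pK: "p \<in> class_K" using cl by (simp add: class_Kinf_def)
  define pi where "pi = inv_into {0..} p"
  have piK: "pi \<in> class_K" unfolding pi_def by (rule class_Kinf_inverse[OF cl(2)])
  have ppi: "p (pi y) = y" if "0 \<le> y" for y unfolding pi_def by (rule class_Kinf_inverse(1)[OF cl(2) that])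
  obtain b where b: "b > 0" "\<And>s. s \<in> {0..T} \<Longrightarrow> norm (v s) \<le> b" "\<And>s. s \<in> {0..T} \<Longrightarrow> norm (u s) \<le> b"
    using inp(6)[of T] by blast
  have "bdd_above ((\<lambda>s. \<zeta>u (\<delta>1u s * norm (u s))) ` {t0..T})"
    by (rule bdd_above_gain[OF class_ND(1)[OF cl(5)] cl(6) inp(1) b(3)])
  then obtain qu where qu: "\<And>s. s \<in> {t0..T} \<Longrightarrow> \<zeta>u (\<delta>1u s * norm (u s)) \<le> qu" unfolding bdd_above_def by blast
  \<comment> \<open>One level above everything that feeds V up to time \<open>T\<close>; the 0 makes
    q + R nonnegative, so that \<open>p\<close> can be inverted there.\<close>
  define q where "q = max (max (\<zeta> b) qu) (max 0 (a2 (\<beta> t0 * hnorm r x0)))"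
  define g where "g = pi (q + R)"
  have g: "0 \<le> g" "p g = q + R" unfolding g_def using R by (auto intro!: class_KD(5)[OF piK] ppi simp: q_def)
  have \<mu>pos: "0 < \<mu> t" if "0 \<le> t" for t using cl(3) that by (simp add: class_Kplus_def)
  \<comment> \<open>A positive lower bound of \<mu> on the compact interval; the value 1 serves when
    the interval is empty.\<close>
  have "\<exists>m>0. \<forall>t\<in>{t0..T}. m \<le> \<mu> t"
  proof (cases "t0 \<le> T")
    case True
    have "continuous_on {t0..T} \<mu>" using cl(3) inp(1) by (auto simp: class_Kplus_def intro: continuous_on_subset)
    then obtain s where "s \<in> {t0..T}" "\<And>t. t \<in> {t0..T} \<Longrightarrow> \<mu> s \<le> \<mu> t"
      using continuous_attains_inf[of "{t0..T}" \<mu>] True by auto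
    then show ?thesis using \<mu>pos[of s] inp(1) by auto
  qed (auto intro: exI[of _ 1])
  then obtain m where m: "m > 0" "\<And>t. t \<in> {t0..T} \<Longrightarrow> m \<le> \<mu> t" by blast
  have hx0: "0 \<le> hnorm r x0" using inp(2) by (intro hnorm_nonneg r_nonneg) (simp add: C0_mem)
  have "norm (x t) \<le> max (g / m) (hnorm r x0)"
    if bT: "b' \<in> {t0..T}" and x: "sol b' x" and init: "Tr r t0 x = x0" and t: "t \<in> {t0 - r..b'}" for b' x t
  proof (cases "t \<le> t0")
    case True
    have "norm (x t) \<le> hnorm r (Tr r t0 x)"
      using x True t bT by (intro norm_le_hnorm_Tr) (auto simp: sol_def intro: continuous_on_subset)
    then show ?thesis using init by simp
  next
    case False
    have "\<mu> t * norm (x t) \<le> g"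
    proof (rule state_bound[OF cl(1-3) R \<delta>1 V_upper B adm sol_mono[OF x] init])
      show "\<zeta> (norm (v s)) \<le> q" if "s \<in> {t0..t}" for s
      proof -
        have "\<zeta> (norm (v s)) \<le> \<zeta> b" using that t bT inp(1) by (intro class_ND(1)[OF cl(4)] b(2)) auto
        then show ?thesis by (simp add: q_def)
      qed
      show "\<zeta>u (\<delta>1u s * norm (u s)) \<le> q" if "s \<in> {t0..t}" for s
        using qu[of s] that t bT by (auto simp: q_def)
    qed (use g t bT False in \<open>auto simp: q_def\<close>)
    moreover have "m * norm (x t) \<le> \<mu> t * norm (x t)" using m(2)[of t] t bT False by (intro mult_right_mono) auto
    ultimately have "norm (x t) \<le> g / m" using m(1) by (simp add: pos_le_divide_eq mult.commute)
    then show ?thesis by simp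
  qed
  then show "\<exists>B. \<forall>b\<in>{t0..T}. \<forall>x. sol b x \<longrightarrow> Tr r t0 x = x0 \<longrightarrow> (\<forall>t\<in>{t0 - r..b}. norm (x t) \<le> B)"
    by blast
qed

text \<open>\<kappa> is a monotone function above \<phi>(t) and above \<phi>(t) / \<mu>(s) for s <=
  t, so a bound \<open>g\<close> on \<mu> |x| and on the initial history gives \<phi>(t) |x(s)| <=
  \<kappa>(t) g. Keeping \<kappa> and \<open>b\<close> abstract serves both claims of (ii): running
  suprema and \<beta> for general \<phi>, constants when the function of t0 has to be bounded, since
  it is constant as soon as \<kappa> and \<open>b\<close> are.\<close>

lemma growth_bound:
  assumes cl: "a2 \<in> class_Kinf" "p \<in> class_Kinf" "\<mu> \<in> class_Kplus" "\<zeta> \<in> class_N" "\<zeta>u \<in> class_N"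
      "\<beta> \<in> class_Kplus" "\<delta>1u \<in> class_Kplus" "\<phi> \<in> class_Kplus"
    and R: "0 \<le> R" and \<delta>1: "\<forall>t\<ge>0. \<delta>1 t = 1"
    and V_upper: "\<forall>t\<ge>0. \<forall>x\<in>mspace (C0 r). V t x \<le> a2 (\<beta> t * hnorm r x)"
    and B: "\<forall>t\<ge>0. \<forall>x\<in>mspace (C0 r). p (\<mu> t * norm (x 0)) \<le> V t x + R"
    and \<phi>_le: "\<forall>t\<ge>0. \<phi> t \<le> \<kappa> t" "\<forall>t. \<forall>s\<in>{0..t}. \<phi> t \<le> \<kappa> t * \<mu> s"
    and \<kappa>: "mono_on {0..} \<kappa>" "continuous_on {0..} \<kappa>"
    and \<beta>_le: "\<forall>t\<ge>0. \<beta> t \<le> b t" and b: "continuous_on {0..} b"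
  obtains g1 p1 p1u M where "g1 \<in> class_N" "p1 \<in> class_N" "p1u \<in> class_N"
    "(\<lambda>t. (\<kappa> (2 * t))\<^sup>2 + 1) \<in> class_Kplus" "(\<lambda>t. (\<kappa> (2 * t))\<^sup>2 + M ((b t)\<^sup>2) + 1) \<in> class_Kplus"
    "\<And>t0 x0 v u d x. \<lbrakk>admissible_data r D U S2 t0 x0 v u d; maximal_solution r f t0 x0 v u d \<infinity> x\<rbrakk> \<Longrightarrow>
      growth_estimate r \<phi> (\<lambda>t. (\<kappa> (2 * t))\<^sup>2 + 1) (\<lambda>t. (\<kappa> (2 * t))\<^sup>2 + M ((b t)\<^sup>2) + 1) g1 p1 p1u \<delta>1u t0 x0 v u x"
proof -
  have pK: "p \<in> class_K" and a2K: "a2 \<in> class_K" using cl by (auto simp: class_Kinf_def)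
  note p = class_KD[OF pK] and a2 = class_KD[OF a2K]
  define pi where "pi = inv_into {0..} p"
  have piK: "pi \<in> class_K" unfolding pi_def by (rule class_Kinf_inverse[OF cl(2)])
  note pi = class_KD[OF piK]
  have ppi: "p (pi y) = y" if "0 \<le> y" for y unfolding pi_def by (rule class_Kinf_inverse(1)[OF cl(2) that])
  \<comment> \<open>The bound \<open>V + R \<le> p g\<close> is needed for \<open>g = sqrt G / 2\<close>, where \<open>G\<close> is the maximum in the growth
    estimate; \<open>h\<close> turns the requirement \<open>2 y \<le> p g\<close> on each of its ingredients into \<open>h y \<le> G\<close>. The half
    leaves a factor \<open>sqrt G\<close> for \<open>\<kappa> t\<close>.\<close>
  define h where "h y = 4 * (pi (2 * y))\<^sup>2" for y
  have h_mono: "h x \<le> h y" if "0 \<le> x" "x \<le> y" for x y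
    unfolding h_def using that by (auto intro!: power_mono pi(3) pi(5))
  have h0: "h 0 = 0" by (simp add: h_def pi(2))
  have h_nn: "0 \<le> h y" for y by (simp add: h_def)
  have h_cont: "continuous_on {0..} h"
    unfolding h_def by (intro continuous_intros continuous_on_compose2[OF pi(1)]) auto
  have h_dom: "2 * y \<le> p (sqrt G / 2)" if "h y \<le> G" "0 \<le> y" for y G
  proof -
    have "(2 * pi (2 * y))\<^sup>2 \<le> G" using that by (simp add: h_def power_mult_distrib)
    then have "2 * pi (2 * y) \<le> sqrt G" by (rule real_le_rsqrt)
    then have "p (pi (2 * y)) \<le> p (sqrt G / 2)" using that by (intro p(3) pi(5)) auto
    then show ?thesis using that ppi by simp
  qed
  \<comment> \<open>The term 4 s^2 makes the initial norm at most sqrt G / 2; the other term takes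
    the data half of a2(\<beta>(t0) |x0|) once the product is bounded by squares.\<close>
  define g1 where "g1 s = 4 * s\<^sup>2 + h (a2 (s\<^sup>2))" for s
  define p1 where "p1 s = h (\<zeta> s)" for s
  define p1u where "p1u s = h (\<zeta>u s)" for s
  \<comment> \<open>Collects what depends on \<open>t0\<close> besides \<kappa>: the constant
    \<open>R\<close> and the half of a2(\<beta>(t0) |x0|) carried by \<open>b\<close>.\<close>
  define M where "M s = h R + h (a2 s)" for s
  define \<mu>1 where "\<mu>1 t = (\<kappa> (2 * t))\<^sup>2 + 1" for t
  define c1 where "c1 t = (\<kappa> (2 * t))\<^sup>2 + M ((b t)\<^sup>2) + 1" for t
  note \<zeta> = class_ND[OF cl(4)] and \<zeta>u = class_ND[OF cl(5)]
  have g1N: "g1 \<in> class_N"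
    unfolding class_N_def g1_def
    by (auto intro!: monotone_onI add_mono power_mono h_mono a2(3) a2(5) add_nonneg_nonneg h_nn simp: a2(2) h0)
  have p1N: "p1 \<in> class_N"
    unfolding class_N_def p1_def by (auto intro!: monotone_onI h_mono \<zeta>(1,2) h_nn simp: \<zeta>(3) h0)
  have p1uN: "p1u \<in> class_N"
    unfolding class_N_def p1u_def by (auto intro!: monotone_onI h_mono \<zeta>u(1,2) h_nn simp: \<zeta>u(3) h0)
  have M_cont: "continuous_on {0..} M"
  proof -
    have "continuous_on {0..} (\<lambda>s. h (a2 s))" by (rule continuous_on_compose2[OF h_cont a2(1)]) (use a2(5) in auto)
    then show ?thesis unfolding M_def by (intro continuous_intros)
  qed
  have M_nn: "0 \<le> M s" for s using h_nn by (simp add: M_def)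
  have \<kappa>2: "continuous_on {0..} (\<lambda>t. \<kappa> (2 * t))"
  proof -
    have "continuous_on {0..} (\<lambda>t :: real. 2 * t)" by (intro continuous_intros)
    then show ?thesis by (rule continuous_on_compose2[OF \<kappa>(2)]) auto
  qed
  have \<mu>1K: "\<mu>1 \<in> class_Kplus"
    unfolding class_Kplus_def \<mu>1_def using \<kappa>2 by (auto intro!: continuous_intros add_nonneg_pos)
  have c1K: "c1 \<in> class_Kplus"
  proof -
    have "continuous_on {0..} (\<lambda>t. (b t)\<^sup>2)" by (intro continuous_intros b)
    then have "continuous_on {0..} (\<lambda>t. M ((b t)\<^sup>2))" by (rule continuous_on_compose2[OF M_cont]) auto
    then show ?thesis
      unfolding class_Kplus_def c1_def using \<kappa>2 M_nn
      by (auto intro!: continuous_intros add_nonneg_pos add_nonneg_nonneg)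
  qed
  have "growth_estimate r \<phi> \<mu>1 c1 g1 p1 p1u \<delta>1u t0 x0 v u x"
    if adm: "admissible_data r D U S2 t0 x0 v u d" and x: "maximal_solution r f t0 x0 v u d \<infinity> x" for t0 x0 v u d x
    unfolding growth_estimate_def
  proof (intro allI impI)
    fix t assume t: "t0 \<le> t"
    note inp = inputs[OF adm] and sol = maximal_solution_sol[OF adm x]
    define X where "X = hnorm r x0"
    have X0: "0 \<le> X" unfolding X_def using inp(2) by (intro hnorm_nonneg r_nonneg) (simp add: C0_mem)
    let ?S = "SUP s\<in>{t0..t}. p1 (norm (v s))" and ?Su = "SUP s\<in>{t0..t}. p1u (\<delta>1u s * norm (u s))"
    define G where "G = Max {\<mu>1 (t - t0), c1 t0, g1 X, ?S, ?Su}"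
    have G: "\<mu>1 (t - t0) \<le> G" "c1 t0 \<le> G" "g1 X \<le> G" "?S \<le> G" "?Su \<le> G" by (simp_all add: G_def)
    have G0: "0 \<le> G" using G(3) class_ND(2)[OF g1N X0] by simp
    define g where "g = sqrt G / 2"
    have g0: "0 \<le> g" using G0 by (simp add: g_def)
    obtain Bd where Bd: "\<And>s. s \<in> {0..t} \<Longrightarrow> norm (v s) \<le> Bd" "\<And>s. s \<in> {0..t} \<Longrightarrow> norm (u s) \<le> Bd"
      using inp(6)[of t] by blast
    have one: "(\<lambda>_. 1) \<in> class_Kplus" by (simp add: class_Kplus_def)
    have bdv: "bdd_above ((\<lambda>s. p1 (norm (v s))) ` {t0..t})"
      using bdd_above_gain[OF class_ND(1)[OF p1N] one inp(1) Bd(1)] by simp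
    have bdu: "bdd_above ((\<lambda>s. p1u (\<delta>1u s * norm (u s))) ` {t0..t})"
      by (rule bdd_above_gain[OF class_ND(1)[OF p1uN] cl(7) inp(1) Bd(2)])
    have qv: "\<zeta> (norm (v s)) \<le> p g / 2" if "s \<in> {t0..t}" for s
    proof -
      have "h (\<zeta> (norm (v s))) \<le> G" using cSUP_upper[OF that bdv] G(4) by (simp add: p1_def)
      then show ?thesis using h_dom[of "\<zeta> (norm (v s))" G] \<zeta>(2) by (simp add: g_def)
    qed
    have qu: "\<zeta>u (\<delta>1u s * norm (u s)) \<le> p g / 2" if "s \<in> {t0..t}" for s
    proof -
      have "0 \<le> \<delta>1u s * norm (u s)" using cl(7) that inp(1) by (auto simp: class_Kplus_def less_imp_le)
      moreover have "h (\<zeta>u (\<delta>1u s * norm (u s))) \<le> G" using cSUP_upper[OF that bdu] G(5) by (simp add: p1u_def)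
      ultimately show ?thesis using h_dom[of "\<zeta>u (\<delta>1u s * norm (u s))" G] \<zeta>u(2) by (simp add: g_def)
    qed
    have q0: "a2 (\<beta> t0 * X) \<le> p g / 2"
    proof -
      have \<beta>0: "0 \<le> \<beta> t0" "\<beta> t0 \<le> b t0" using cl(6) \<beta>_le inp(1) by (auto simp: class_Kplus_def less_imp_le)
      \<comment> \<open>A product of a function of \<open>t0\<close> and the initial norm is at most
        the larger of the two squares, so each factor is charged to its own entry of the maximum,
        \<open>c1\<close> or \<open>g1\<close>.\<close>
      define Y where "Y = max ((b t0)\<^sup>2) (X\<^sup>2)"
      have "\<beta> t0 * X \<le> Y"
      proof -
        have "\<beta> t0 * X \<le> b t0 * X" using \<beta>0 X0 by (intro mult_right_mono) auto
        also have "\<dots> \<le> max (b t0) X * max (b t0) X" using \<beta>0 X0 by (intro mult_mono) auto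
        also have "\<dots> \<le> Y" by (auto simp: Y_def max_def power2_eq_square)
        finally show ?thesis .
      qed
      then have "a2 (\<beta> t0 * X) \<le> a2 Y" using \<beta>0 X0 by (intro a2(3)) auto
      moreover have "h (a2 Y) \<le> G"
      proof -
        have "h (a2 ((b t0)\<^sup>2)) \<le> G" using G(2) h_nn[of R] unfolding c1_def M_def
          using zero_le_power2[of "\<kappa> (2 * t0)"] by linarith
        moreover have "h (a2 (X\<^sup>2)) \<le> G" using G(3) unfolding g1_def using zero_le_power2[of X] by linarith
        ultimately show ?thesis by (simp add: Y_def max_def)
      qed
      then have "2 * a2 Y \<le> p g" unfolding g_def by (rule h_dom) (auto intro!: a2(5) simp: Y_def max_def)
      ultimately show ?thesis by simp
    qed
    have Rg: "2 * R \<le> p g"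
    proof -
      have "h R \<le> G" using G(2) h_nn[of "a2 ((b t0)\<^sup>2)"] unfolding c1_def M_def
        using zero_le_power2[of "\<kappa> (2 * t0)"] by linarith
      then show ?thesis unfolding g_def by (rule h_dom[OF _ R])
    qed
    have Xg: "X \<le> g"
    proof -
      have "(2 * X)\<^sup>2 \<le> G" using G(3) h_nn[of "a2 (X\<^sup>2)"] unfolding g1_def by (simp add: power_mult_distrib)
      then have "2 * X \<le> sqrt G" by (rule real_le_rsqrt)
      then show ?thesis by (simp add: g_def)
    qed
    have t00: "0 \<le> t0" "0 \<le> t" using inp(1) t by auto
    \<comment> \<open>Either t <= 2 t0 or t <= 2 (t - t0), so monotonicity charges \<kappa>(t) to
      \<open>c1\<close> at \<open>t0\<close> or to \<mu>1 at t - t0.\<close>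
    have \<kappa>G: "\<kappa> t \<le> sqrt G"
    proof -
      have "\<kappa> t \<le> \<kappa> (2 * t0) \<or> \<kappa> t \<le> \<kappa> (2 * (t - t0))"
        using t00 t mono_onD[OF \<kappa>(1), of t "2 * t0"] mono_onD[OF \<kappa>(1), of t "2 * (t - t0)"] by (cases "t \<le> 2 * t0") auto
      moreover have "(\<kappa> (2 * t0))\<^sup>2 \<le> G" using G(2) M_nn[of "(b t0)\<^sup>2"] unfolding c1_def by linarith
      moreover have "(\<kappa> (2 * (t - t0)))\<^sup>2 \<le> G" using G(1) unfolding \<mu>1_def by linarith
      ultimately show ?thesis using real_le_rsqrt order_trans by blast
    qed
    have \<phi>0: "0 < \<phi> t" using cl(8) t00 by (simp add: class_Kplus_def)
    have \<kappa>0: "0 < \<kappa> t" using \<phi>0 \<phi>_le(1)[rule_format, OF t00(2)] by linarith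
    have final: "\<kappa> t * g \<le> G"
    proof -
      have "\<kappa> t * g \<le> sqrt G * g" using \<kappa>G g0 by (rule mult_right_mono)
      also have "\<dots> = G / 2" using G0 by (simp add: g_def)
      finally show ?thesis using G0 by simp
    qed
    \<comment> \<open>Before \<open>t0\<close> the state belongs to the initial history, bounded by
      X <= g; from \<open>t0\<close> on the bound through V applies.\<close>
    have "norm (x s) \<le> \<kappa> t * g / \<phi> t" if s: "s \<in> {t - r..t}" for s
    proof (cases "s < t0")
      case True
      have "norm (x s) \<le> hnorm r (Tr r t0 x)"
        using s True t by (intro norm_le_hnorm_Tr continuous_on_subset[OF sol(3)[OF order_refl]]) auto
      then have "norm (x s) \<le> g" using sol(2)[OF t] Xg by (simp add: X_def)
      moreover have "\<phi> t * norm (x s) \<le> \<kappa> t * norm (x s)" using \<phi>_le(1)[rule_format, OF t00(2)] by (intro mult_right_mono) auto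
      ultimately have "\<phi> t * norm (x s) \<le> \<kappa> t * g"
        using \<kappa>0 by (meson mult_left_mono less_imp_le order_trans)
      then show ?thesis using \<phi>0 by (simp add: pos_le_divide_eq mult.commute)
    next
      case False
      have "\<mu> s * norm (x s) \<le> g"
      proof (rule state_bound[OF cl(1-3) R \<delta>1 V_upper B adm sol(1) sol(2)[OF t], of s "p g / 2"])
        show "p g / 2 + R \<le> p g" using Rg by simp
      qed (use False s qv qu q0 g0 in \<open>auto simp: X_def\<close>)
      then have "\<kappa> t * (\<mu> s * norm (x s)) \<le> \<kappa> t * g" using \<kappa>0 by (intro mult_left_mono) auto
      moreover have "\<phi> t * norm (x s) \<le> (\<kappa> t * \<mu> s) * norm (x s)"
        using \<phi>_le(2)[rule_format, of s t] False s t00 by (intro mult_right_mono) auto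
      ultimately have "\<phi> t * norm (x s) \<le> \<kappa> t * g" by (simp add: mult.assoc)
      then show ?thesis using \<phi>0 by (simp add: pos_le_divide_eq mult.commute)
    qed
    then have "hnorm r (Tr r t x) \<le> \<kappa> t * g / \<phi> t" by (intro hnorm_Tr_le r_nonneg) auto
    then have "\<phi> t * hnorm r (Tr r t x) \<le> \<kappa> t * g" using \<phi>0 by (simp add: pos_le_divide_eq mult.commute)
    then show "\<phi> t * hnorm r (Tr r t x) \<le> Max {\<mu>1 (t - t0), c1 t0, g1 (hnorm r x0), ?S, ?Su}"
      using final unfolding G_def X_def by linarith
  qed
  then show ?thesis
    using that[OF g1N p1N p1uN] \<mu>1K c1K unfolding \<mu>1_def[abs_def] c1_def[abs_def] by blast
qed

end

section \<open>Assembly: the choices of \<kappa> for general and for bounded \<phi>\<close>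

theorem theorem3p3:
  fixes r1 :: real
    and D :: "(real ^ 'l) set" and U :: "(real ^ 'm) set"
    and S1 :: "(real ^ 'k1) set" and S2 :: "(real ^ 'k2) set"
    and f1 :: "real \<Rightarrow> real ^ 'l \<Rightarrow> (real \<Rightarrow> real ^ 'n) \<Rightarrow> real ^ 'm \<Rightarrow> real ^ 'k2 \<Rightarrow> real ^ 'n"
    and H1 :: "real \<Rightarrow> (real \<Rightarrow> real ^ 'n) \<Rightarrow> real ^ 'k1"
    and V :: "real \<Rightarrow> (real \<Rightarrow> real ^ 'n) \<Rightarrow> real"
    and a1 a2 p \<zeta> \<zeta>u \<beta> \<delta>1 \<delta>1u \<mu> \<rho> :: "real \<Rightarrow> real"
    and R :: real
  assumes sys: "delay_system r1 D U S1 S2 f1 H1"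
    and V: "almost_Lipschitz r1 V"
    and classes: "a2 \<in> class_Kinf" "\<zeta> \<in> class_N" "\<zeta>u \<in> class_N"
      "\<beta> \<in> class_Kplus" "\<delta>1 \<in> class_Kplus" "\<delta>1u \<in> class_Kplus"
    and rho: "continuous_on {0..} \<rho>" "pos_def_fun \<rho>"
    and V_upper: "\<forall>t\<ge>0. \<forall>x\<in>mspace (C0 r1). V t x \<le> a2 (\<beta> t * hnorm r1 x)"
    and V_decay: "\<forall>t\<ge>0. \<forall>x\<in>mspace (C0 r1). \<forall>u\<in>U. \<forall>v\<in>S2. \<forall>d\<in>D.
      max (\<zeta> (\<delta>1 t * norm v)) (\<zeta>u (\<delta>1u t * norm u)) \<le> V t x \<longrightarrow>
      V0 r1 V t x (f1 t d x u v) \<le> ereal (- \<rho> (V t x))"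
    and classes': "a1 \<in> class_Kinf" "p \<in> class_Kinf" "\<mu> \<in> class_Kplus" "0 \<le> R"
    and A_or_B:
      "(\<forall>t\<ge>0. \<forall>x\<in>mspace (C0 r1). a1 (norm (H1 t x)) \<le> V t x) \<or>
       (\<forall>t\<ge>0. \<forall>x\<in>mspace (C0 r1). p (\<mu> t * norm (x 0)) \<le> V t x + R)"
  shows
    "((\<forall>t\<ge>0. \<forall>x\<in>mspace (C0 r1). a1 (norm (H1 t x)) \<le> V t x) \<and>
      (\<exists>\<mu>1\<in>class_Kplus. \<exists>c1\<in>class_Kplus. \<exists>\<phi>\<in>class_Kplus.
         \<exists>g1\<in>class_N. \<exists>p1\<in>class_N. \<exists>p1u\<in>class_N.
         \<forall>t0 x0 v u d. admissible_data r1 D U S2 t0 x0 v u d \<longrightarrow>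
           (\<exists>x. maximal_solution r1 f1 t0 x0 v u d \<infinity> x \<and>
                growth_estimate r1 \<phi> \<mu>1 c1 g1 p1 p1u \<delta>1u t0 x0 v u x))
      \<longrightarrow>
      (\<exists>\<sigma>1\<in>class_KL. \<forall>t0 x0 v u d x.
         admissible_data r1 D U S2 t0 x0 v u d \<and> maximal_solution r1 f1 t0 x0 v u d \<infinity> x \<longrightarrow>
         (\<forall>t\<ge>t0. norm (H1 t (Tr r1 t x)) \<le>
            \<sigma>1 (\<beta> t0 * hnorm r1 x0) (t - t0)
            + (SUP s\<in>{t0..t}. inv_into {0..} a1 (\<zeta> (\<delta>1 s * norm (v s))))
            + (SUP s\<in>{t0..t}. inv_into {0..} a1 (\<zeta>u (\<delta>1u s * norm (u s)))))))
     \<and>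
     ((\<forall>t\<ge>0. \<forall>x\<in>mspace (C0 r1). p (\<mu> t * norm (x 0)) \<le> V t x + R) \<and> (\<forall>t\<ge>0. \<delta>1 t = 1)
      \<longrightarrow>
      (\<forall>t0 x0 v u d. admissible_data r1 D U S2 t0 x0 v u d \<longrightarrow>
         (\<exists>x. maximal_solution r1 f1 t0 x0 v u d \<infinity> x)) \<and>
      (\<forall>\<phi>\<in>class_Kplus.
         \<exists>\<mu>1\<in>class_Kplus. \<exists>c1\<in>class_Kplus. \<exists>g1\<in>class_N. \<exists>p1\<in>class_N. \<exists>p1u\<in>class_N.
         \<forall>t0 x0 v u d x.
           admissible_data r1 D U S2 t0 x0 v u d \<and> maximal_solution r1 f1 t0 x0 v u d \<infinity> x \<longrightarrow>
           growth_estimate r1 \<phi> \<mu>1 c1 g1 p1 p1u \<delta>1u t0 x0 v u x) \<and>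
      (\<forall>\<phi>\<in>class_Kplus. bounded (\<phi> ` {0..}) \<and> (\<exists>L>0. \<forall>t\<ge>0. \<beta> t + 1 / \<mu> t \<le> L) \<longrightarrow>
         (\<exists>\<mu>1\<in>class_Kplus. \<exists>c1\<in>class_Kplus. \<exists>g1\<in>class_N. \<exists>p1\<in>class_N. \<exists>p1u\<in>class_N.
          bounded (c1 ` {0..}) \<and>
          (\<forall>t0 x0 v u d x.
            admissible_data r1 D U S2 t0 x0 v u d \<and> maximal_solution r1 f1 t0 x0 v u d \<infinity> x \<longrightarrow>
            growth_estimate r1 \<phi> \<mu>1 c1 g1 p1 p1u \<delta>1u t0 x0 v u x))))"
proof -
  interpret lyapunov_system r1 D U S1 S2 f1 H1 V \<zeta> \<zeta>u \<delta>1 \<delta>1u \<rho>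
    by (intro lyapunov_system.intro sys lyapunov_system_axioms.intro V rho V_decay)
  have \<mu>pos: "0 < \<mu> t" if "0 \<le> t" for t using classes'(3) that by (simp add: class_Kplus_def)
  show ?thesis
  proof (intro conjI impI allI ballI)
    assume "(\<forall>t\<ge>0. \<forall>x\<in>mspace (C0 r1). a1 (norm (H1 t x)) \<le> V t x) \<and>
      (\<exists>\<mu>1\<in>class_Kplus. \<exists>c1\<in>class_Kplus. \<exists>\<phi>\<in>class_Kplus.
         \<exists>g1\<in>class_N. \<exists>p1\<in>class_N. \<exists>p1u\<in>class_N.
         \<forall>t0 x0 v u d. admissible_data r1 D U S2 t0 x0 v u d \<longrightarrow>
           (\<exists>x. maximal_solution r1 f1 t0 x0 v u d \<infinity> x \<and>
                growth_estimate r1 \<phi> \<mu>1 c1 g1 p1 p1u \<delta>1u t0 x0 v u x))"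
    note A = conjunct1[OF this]
    show "\<exists>\<sigma>1\<in>class_KL. \<forall>t0 x0 v u d x.
         admissible_data r1 D U S2 t0 x0 v u d \<and> maximal_solution r1 f1 t0 x0 v u d \<infinity> x \<longrightarrow>
         (\<forall>t\<ge>t0. norm (H1 t (Tr r1 t x)) \<le>
            \<sigma>1 (\<beta> t0 * hnorm r1 x0) (t - t0)
            + (SUP s\<in>{t0..t}. inv_into {0..} a1 (\<zeta> (\<delta>1 s * norm (v s))))
            + (SUP s\<in>{t0..t}. inv_into {0..} a1 (\<zeta>u (\<delta>1u s * norm (u s)))))"
      by (rule output_estimate[OF classes'(1) classes V_upper A])
  next
    assume B: "(\<forall>t\<ge>0. \<forall>x\<in>mspace (C0 r1). p (\<mu> t * norm (x 0)) \<le> V t x + R) \<and> (\<forall>t\<ge>0. \<delta>1 t = 1)"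
    fix t0 v u d and x0 :: "real \<Rightarrow> real ^ 'n"
    assume "admissible_data r1 D U S2 t0 x0 v u d"
    then show "\<exists>x. maximal_solution r1 f1 t0 x0 v u d \<infinity> x"
      by (rule solutions_exist[OF classes(1) classes'(2,3) classes(2,3,6) classes'(4) conjunct2[OF B] V_upper conjunct1[OF B]])
  next
    assume B: "(\<forall>t\<ge>0. \<forall>x\<in>mspace (C0 r1). p (\<mu> t * norm (x 0)) \<le> V t x + R) \<and> (\<forall>t\<ge>0. \<delta>1 t = 1)"
    note bound = growth_bound[OF classes(1) classes'(2,3) classes(2,3,4,6) _ classes'(4)
      conjunct2[OF B] V_upper conjunct1[OF B]]
    show "\<exists>\<mu>1\<in>class_Kplus. \<exists>c1\<in>class_Kplus. \<exists>g1\<in>class_N. \<exists>p1\<in>class_N. \<exists>p1u\<in>class_N.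
         \<forall>t0 x0 v u d x.
           admissible_data r1 D U S2 t0 x0 v u d \<and> maximal_solution r1 f1 t0 x0 v u d \<infinity> x \<longrightarrow>
           growth_estimate r1 \<phi> \<mu>1 c1 g1 p1 p1u \<delta>1u t0 x0 v u x" if \<phi>: "\<phi> \<in> class_Kplus" for \<phi> :: "real \<Rightarrow> real"
    proof -
      define m1 where "m1 t = (SUP s\<in>{0..t}. \<phi> s)" for t
      define m2 where "m2 t = (SUP s\<in>{0..t}. 1 / \<mu> s)" for t
      \<comment> \<open>\<open>m1\<close> dominates \<phi> and \<open>m2\<close> dominates 1 /
        \<mu>; the summand 1 covers \<phi> itself, \<open>m2\<close> the quotients \<phi>(t) /
        \<mu>(s).\<close>
      define \<kappa> where "\<kappa> t = m1 t * (1 + m2 t)" for t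
      have c1: "continuous_on {0..} \<phi>" using \<phi> by (simp add: class_Kplus_def)
      have c2: "continuous_on {0..} (\<lambda>s. 1 / \<mu> s)"
        using classes'(3) by (auto simp: class_Kplus_def intro!: continuous_intros dest: less_imp_neq[symmetric])
      note m1 = running_sup[OF c1, folded m1_def] and m2 = running_sup[OF c2, folded m2_def]
      have m1pos: "0 < m1 t" if "0 \<le> t" for t
        using m1(1)[of t t] \<phi> that by (force simp: class_Kplus_def)
      have m2pos: "0 < m2 t" if "0 \<le> t" for t
        using m2(1)[of t t] \<mu>pos[OF that] that zero_less_divide_1_iff[of "\<mu> t"] by linarith
      have k1: "\<forall>t\<ge>0. \<phi> t \<le> \<kappa> t"
      proof (intro allI impI)
        fix t :: real assume t: "0 \<le> t"
        have "m1 t * 1 \<le> m1 t * (1 + m2 t)" using m1pos[OF t] m2pos[OF t] by (intro mult_left_mono) auto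
        then show "\<phi> t \<le> \<kappa> t" using m1(1)[of t t] t by (simp add: \<kappa>_def)
      qed
      have k2: "\<forall>t. \<forall>s\<in>{0..t}. \<phi> t \<le> \<kappa> t * \<mu> s"
      proof (intro allI ballI)
        fix t s :: real assume "s \<in> {0..t}"
        then have st: "0 \<le> s" "s \<le> t" and t: "0 \<le> t" by auto
        have "1 \<le> m2 t * \<mu> s" using m2(1)[OF st] \<mu>pos[OF st(1)] by (simp add: pos_divide_le_eq)
        also have "\<dots> \<le> (1 + m2 t) * \<mu> s" using \<mu>pos[OF st(1)] by (intro mult_right_mono) auto
        finally have "m1 t * 1 \<le> m1 t * ((1 + m2 t) * \<mu> s)" using m1pos[OF t] by (intro mult_left_mono) auto
        then show "\<phi> t \<le> \<kappa> t * \<mu> s" using m1(1)[of t t] t by (simp add: \<kappa>_def mult.assoc)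
      qed
      have k3: "mono_on {0..} \<kappa>"
      proof (rule mono_onI)
        fix s t :: real assume "s \<in> {0..}" "t \<in> {0..}" and st: "s \<le> t"
        then have "0 \<le> s" "0 \<le> t" by auto
        then show "\<kappa> s \<le> \<kappa> t"
          unfolding \<kappa>_def using m1(2)[OF _ st] m2(2)[OF _ st] m1pos[of t] m2pos[of s] by (intro mult_mono) auto
      qed
      have k4: "continuous_on {0..} \<kappa>" unfolding \<kappa>_def by (intro continuous_intros m1(3) m2(3))
      have b: "continuous_on {0..} \<beta>" using classes(4) by (simp add: class_Kplus_def)
      show ?thesis
      proof (rule bound[OF \<phi> k1 k2 k3 k4 _ b])
        show "\<forall>t\<ge>0. \<beta> t \<le> \<beta> t" by simp
      next
        fix g1 p1 p1u M
        assume "g1 \<in> class_N" "p1 \<in> class_N" "p1u \<in> class_N" "(\<lambda>t. (\<kappa> (2 * t))\<^sup>2 + 1) \<in> class_Kplus"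
          "(\<lambda>t. (\<kappa> (2 * t))\<^sup>2 + M ((\<beta> t)\<^sup>2) + 1) \<in> class_Kplus"
          "\<And>t0 x0 v u d x. \<lbrakk>admissible_data r1 D U S2 t0 x0 v u d; maximal_solution r1 f1 t0 x0 v u d \<infinity> x\<rbrakk> \<Longrightarrow>
            growth_estimate r1 \<phi> (\<lambda>t. (\<kappa> (2 * t))\<^sup>2 + 1) (\<lambda>t. (\<kappa> (2 * t))\<^sup>2 + M ((\<beta> t)\<^sup>2) + 1) g1 p1 p1u \<delta>1u t0 x0 v u x"
        then show ?thesis by blast
      qed
    qed
    fix \<phi> :: "real \<Rightarrow> real"
    assume \<phi>: "\<phi> \<in> class_Kplus" and bd: "bounded (\<phi> ` {0..}) \<and> (\<exists>L>0. \<forall>t\<ge>0. \<beta> t + 1 / \<mu> t \<le> L)"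
    obtain L where L: "L > 0" "\<And>t. 0 \<le> t \<Longrightarrow> \<beta> t + 1 / \<mu> t \<le> L" using bd by blast
    obtain \<Phi> where "\<Phi> > 0" "\<forall>y\<in>\<phi> ` {0..}. norm y \<le> \<Phi>" using bd unfolding bounded_pos by blast
    then have \<Phi>: "\<Phi> > 0" "\<And>t. 0 \<le> t \<Longrightarrow> \<phi> t \<le> \<Phi>" by (auto simp: abs_le_iff)
    have \<beta>pos: "0 < \<beta> t" if "0 \<le> t" for t using classes(4) that by (simp add: class_Kplus_def)
    \<comment> \<open>The constants \<Phi> (1 + L) for \<kappa> and L for \<open>b\<close> are
      admissible because \<beta> and 1 / \<mu> are each at most L; they make the function of
      \<open>t0\<close> constant, hence bounded.\<close>
    have k1: "\<forall>t\<ge>0. \<phi> t \<le> \<Phi> * (1 + L)"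
    proof (intro allI impI)
      fix t :: real assume t: "0 \<le> t"
      have "\<Phi> * 1 \<le> \<Phi> * (1 + L)" using \<Phi>(1) L(1) by (intro mult_left_mono) auto
      then show "\<phi> t \<le> \<Phi> * (1 + L)" using \<Phi>(2)[OF t] by simp
    qed
    have k2: "\<forall>t. \<forall>s\<in>{0..t}. \<phi> t \<le> \<Phi> * (1 + L) * \<mu> s"
    proof (intro allI ballI)
      fix t s :: real assume "s \<in> {0..t}"
      then have st: "0 \<le> s" "s \<le> t" by auto
      have "1 / \<mu> s \<le> L" using L(2)[OF st(1)] \<beta>pos[OF st(1)] by linarith
      then have "1 \<le> L * \<mu> s" using \<mu>pos[OF st(1)] by (simp add: pos_divide_le_eq)
      also have "\<dots> \<le> (1 + L) * \<mu> s" using \<mu>pos[OF st(1)] by (intro mult_right_mono) auto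
      finally have "\<Phi> * 1 \<le> \<Phi> * ((1 + L) * \<mu> s)" using \<Phi>(1) by (intro mult_left_mono) auto
      then show "\<phi> t \<le> \<Phi> * (1 + L) * \<mu> s" using \<Phi>(2)[of t] st by (simp add: mult.assoc)
    qed
    have b: "\<forall>t\<ge>0. \<beta> t \<le> L"
    proof (intro allI impI)
      fix t :: real assume t: "0 \<le> t"
      show "\<beta> t \<le> L" using L(2)[OF t] \<mu>pos[OF t] zero_less_divide_1_iff[of "\<mu> t"] by linarith
    qed
    show "\<exists>\<mu>1\<in>class_Kplus. \<exists>c1\<in>class_Kplus. \<exists>g1\<in>class_N. \<exists>p1\<in>class_N. \<exists>p1u\<in>class_N.
          bounded (c1 ` {0..}) \<and>
          (\<forall>t0 x0 v u d x.
            admissible_data r1 D U S2 t0 x0 v u d \<and> maximal_solution r1 f1 t0 x0 v u d \<infinity> x \<longrightarrow>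
            growth_estimate r1 \<phi> \<mu>1 c1 g1 p1 p1u \<delta>1u t0 x0 v u x)"
    proof (rule bound[OF \<phi> k1 k2 _ continuous_on_const b continuous_on_const])
      show "mono_on {0..} (\<lambda>_ :: real. \<Phi> * (1 + L))" by (simp add: monotone_on_def)
    next
      fix g1 p1 p1u M
      let ?c1 = "\<lambda>t :: real. (\<Phi> * (1 + L))\<^sup>2 + M (L\<^sup>2) + 1"
      assume *: "g1 \<in> class_N" "p1 \<in> class_N" "p1u \<in> class_N" "(\<lambda>t. (\<Phi> * (1 + L))\<^sup>2 + 1) \<in> class_Kplus"
        "?c1 \<in> class_Kplus"
        "\<And>t0 x0 v u d x. \<lbrakk>admissible_data r1 D U S2 t0 x0 v u d; maximal_solution r1 f1 t0 x0 v u d \<infinity> x\<rbrakk> \<Longrightarrow>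
          growth_estimate r1 \<phi> (\<lambda>t. (\<Phi> * (1 + L))\<^sup>2 + 1) ?c1 g1 p1 p1u \<delta>1u t0 x0 v u x"
      have "bounded (?c1 ` {0..})" by (rule bounded_subset[of "{(\<Phi> * (1 + L))\<^sup>2 + M (L\<^sup>2) + 1}"]) auto
      with * show ?thesis by blast
    qed
  qed
qed

end
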